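(* Let $m \geq 1$ be an integer and, for each $n$, let $Y_i = f_o(t_i) + \epsilon_i$, $i=1,\ldots,n$, where $f_o \in \mathcal{W}^{m,2}([0,1])$, the $t_i = t_{n,i} \in [0,1]$ are non-random design points, and $\epsilon_1, \epsilon_2, \ldots$ are independent and identically distributed random variables. Let $\rho:\mathbb{R}\to[0,\infty)$ with $\rho(0)=0$, and assume: (A1) $\rho$ is absolutely continuous and convex, and $\psi$ is any choice of its subgradient. (A2) There exist finite constants $\kappa>0$ and $M_1$ such that $|\psi(x+y)-\psi(x)| \leq M_1$ for all $x\in\mathbb{R}$ and all $|y|<\kappa$. (A3) There exists a finite constant $M_2$ such that $\sup_{|t|\leq h} \mathbb{E}\{|\psi(\epsilon_1+t)-\psi(\epsilon_1)|^2\} \leq M_2 |h|$ as $h\to 0$ (i.e. for all sufficiently small $h>0$). (A4) $\mathbb{E}\{|\psi(\epsilon_1)|^2\} \leq \tau^2 < \infty$, $\mathbb{E}\{\psi(\epsilon_1)\}=0$, and there exists a constant $\xi>0$ such that $\mathbb{E}\{\psi(\epsilon_1+t)\} = \xi t + o(t)$ as $t\to 0$. (A5) There exists a constant $M_3$ such that for all $n\geq 2$ and all $f\in\mathcal{W}^{1,1}([0,1])$, $$\left|\frac1n\sum_{i=1}^n f(t_i) - \int_0^1 f(t)\,dt\right| \leq \frac{M_3}{n}\int_0^1 |f'(t)|\,dt.$$ Let $\lambda=\lambda_n>0$ be any deterministic sequence with $\lambda \asymp n^{-2m/(2m+1)}$. Then there exists a sequence of M-type smoothing splines $\widehat f_n$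 that satisfies $\|\widehat f_n - f_o\|_{m,\lambda}^2 = O_P\left(\lambda + (n\lambda^{1/(2m)})^{-1}\right)$ and, for every $j = 1,\ldots,m$, $$\|\widehat f_n^{(j)} - f_o^{(j)}\|_2^2 = O_P\left(n^{-2(m-j)/(2m+1)}\right).$$
   Context: $\mathcal{W}^{m,2}([0,1])$ is the Sobolev space of functions $f:[0,1]\to\mathbb{R}$ such that $f, f^{(1)}, \ldots, f^{(m-1)}$ are absolutely continuous and $\int_0^1 |f^{(m)}(x)|^2\,dx < \infty$; $\mathcal{W}^{1,1}([0,1])$ is the space of absolutely continuous functions on $[0,1]$ (with integrable derivative). With $\langle\cdot,\cdot\rangle_2$ and $\|\cdot\|_2$ the $\mathcal{L}^2([0,1])$ inner product and norm, set $\langle f,g\rangle_{m,\lambda} = \langle f,g\rangle_2 + \lambda\langle f^{(m)},g^{(m)}\rangle_2$ and $\|f\|_{m,\lambda} = \langle f,f\rangle_{m,\lambda}^{1/2}$. $a_n \asymp b_n$ means that $a_n/b_n$ is bounded away from zero and infinity. An M-type smoothing spline $\widehat f_n$ (for given $n$, $\lambda$, $\rho$) is any minimizer over $f\in\mathcal{W}^{m,2}([0,1])$ of $$\frac1n\sum_{i=1}^n \rho(Y_i - f(t_i)) + \lambda\int_0^1 |f^{(m)}(x)|^2\,dx.$$ *)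

theory Defs
  imports "HOL-Probability.Probability" "HOL-Library.Landau_Symbols"
begin

definition absolutely_continuous_on :: "real set \<Rightarrow> (real \<Rightarrow> real) \<Rightarrow> bool" where
  "absolutely_continuous_on S f \<longleftrightarrow>
     (\<forall>e>0. \<exists>d>0. \<forall>D. D division_of \<Union>D \<longrightarrow> \<Union>D \<subseteq> S \<longrightarrow> (\<Sum>k\<in>D. Sup k - Inf k) < d
        \<longrightarrow> (\<Sum>k\<in>D. \<bar>f (Sup k) - f (Inf k)\<bar>) < e)"

text \<open>Functions on \<open>[0,1]\<close> are represented by total functions \<open>real \<Rightarrow> real\<close>; all notions below
  depend only on the values on \<open>[0,1]\<close>, the derivatives at the end points being one-sided.
  Where a derivative does not exist its value is arbitrary. On the Sobolev spaces this
  only affects the values of the highest derivative on a null set: if \<open>f\<close> and \<open>deriv01 1 f\<close> are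
  absolutely continuous, then \<open>f\<close> is differentiable everywhere on \<open>[0,1]\<close>.\<close>

definition deriv01 :: "nat \<Rightarrow> (real \<Rightarrow> real) \<Rightarrow> real \<Rightarrow> real" where
  "deriv01 k f = ((\<lambda>g x. vector_derivative g (at x within {0..1})) ^^ k) f"

text \<open>The space \<open>W\<^sup>m\<^sup>,\<^sup>p([0,1])\<close>, needed for \<open>p = 1, 2\<close>. Lebesgue (rather than Borel) integrals are
  used because of the arbitrary values of the highest derivative on a null set.\<close>

definition sobolev :: "nat \<Rightarrow> nat \<Rightarrow> (real \<Rightarrow> real) set" where
  "sobolev m p = {f. (\<forall>k<m. absolutely_continuous_on {0..1} (deriv01 k f)) \<and>
                     integrable (lebesgue_on {0..1}) (\<lambda>x. \<bar>deriv01 m f x\<bar> ^ p)}"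

definition l2_inner :: "(real \<Rightarrow> real) \<Rightarrow> (real \<Rightarrow> real) \<Rightarrow> real" where
  "l2_inner f g = (LINT x|lebesgue_on {0..1}. f x * g x)"

definition l2_norm :: "(real \<Rightarrow> real) \<Rightarrow> real" where
  "l2_norm f = sqrt (l2_inner f f)"

definition sobolev_inner :: "nat \<Rightarrow> real \<Rightarrow> (real \<Rightarrow> real) \<Rightarrow> (real \<Rightarrow> real) \<Rightarrow> real" where
  "sobolev_inner m l f g = l2_inner f g + l * l2_inner (deriv01 m f) (deriv01 m g)"

definition sobolev_norm :: "nat \<Rightarrow> real \<Rightarrow> (real \<Rightarrow> real) \<Rightarrow> real" where
  "sobolev_norm m l f = sqrt (sobolev_inner m l f f)"

definition subgradient_selection :: "(real \<Rightarrow> real) \<Rightarrow> (real \<Rightarrow> real) \<Rightarrow> bool" where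
  "subgradient_selection \<rho> \<psi> \<longleftrightarrow> (\<forall>x y. \<rho> y \<ge> \<rho> x + \<psi> x * (y - x))"

definition m_objective ::
  "nat \<Rightarrow> (real \<Rightarrow> real) \<Rightarrow> real \<Rightarrow> nat \<Rightarrow> (nat \<Rightarrow> real) \<Rightarrow> (nat \<Rightarrow> real) \<Rightarrow> (real \<Rightarrow> real) \<Rightarrow> real" where
  "m_objective m \<rho> l n t y f =
     1 / real n * (\<Sum>i=1..n. \<rho> (y i - f (t i))) +
     l * (LINT x|lebesgue_on {0..1}. \<bar>deriv01 m f x\<bar>\<^sup>2)"

definition m_smoothing_spline ::
  "nat \<Rightarrow> (real \<Rightarrow> real) \<Rightarrow> real \<Rightarrow> nat \<Rightarrow> (nat \<Rightarrow> real) \<Rightarrow> (nat \<Rightarrow> real) \<Rightarrow> (real \<Rightarrow> real) \<Rightarrow> bool" where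
  "m_smoothing_spline m \<rho> l n t y f \<longleftrightarrow> is_arg_min (m_objective m \<rho> l n t y) (\<lambda>g. g \<in> sobolev m 2) f"

text \<open>\<open>X\<^sub>n = O\<^sub>P(a\<^sub>n)\<close>. Minimizers need not be unique, and an arbitrary choice of a minimizer for
  each outcome need not be measurable; hence the outer measure. It is the probability
  whenever the event is measurable, and it is small only if the event is contained in a
  measurable event of small probability.\<close>

definition bigO_prob :: "'a measure \<Rightarrow> (nat \<Rightarrow> 'a \<Rightarrow> real) \<Rightarrow> (nat \<Rightarrow> real) \<Rightarrow> bool" where
  "bigO_prob M X a \<longleftrightarrow>
     (\<forall>\<delta>>0. \<exists>C>0. \<forall>\<^sub>F n in sequentially.
        outer_measure_of M {\<omega> \<in> space M. \<bar>X n \<omega>\<bar> > C * a n} \<le> ennreal \<delta>)"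

end

theory Submission
  imports Defs "HOL-Real_Asymp.Real_Asymp" "HOL-Computational_Algebra.Polynomial"
begin

text \<open>By convexity of the objective, a minimizer stays within distance \<open>D h\<^sup>m\<close> of \<open>f\<^sub>o\<close>, where
  \<open>h = n powr (- 1 / (2 m + 1))\<close>, as soon as the objective exceeds its value at \<open>f\<^sub>o\<close> on the whole
  sphere of that radius. On the sphere write the increment for a perturbation \<open>g\<close> as a linear noise term,
  the sum over \<open>i\<close> of the integrals of \<open>\<psi> (\<epsilon>\<^sub>i) - \<psi> (\<epsilon>\<^sub>i - s)\<close> over \<open>0 \<le> s \<le> g (t\<^sub>i)\<close>, and the penalty.
  The noise term is bounded through a representation \<open>g (t) = \<langle>A\<^sub>t, g\<rangle> + \<langle>K\<^sub>t, g'\<rangle>\<close> with kernels living on a window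
  of width \<open>h\<close>. The mean of the integral term is at least a multiple of the empirical squared norm of \<open>g\<close>,
  which is close to the squared norm by the quadrature condition. Its fluctuation is controlled uniformly in \<open>g\<close>
  by dyadic chaining over the sorted design points together with fourth moments; no entropy bound
  for the Sobolev ball is needed, since \<open>g\<close> enters only through the total variation of its values at the design points.

  Minimizers exist by the parallelogram law for the penalty, with Lagrange interpolation at the design points
  for the polynomial part, on which the penalty has no effect. That functions with the given absolute continuity
  property are integrals of their derivatives follows from Radon-Nikodym, applied to
  the variation function, and Lebesgue differentiation.\<close>

subsection \<open>Absolutely continuous functions\<close>

text \<open>The score \<psi> may jump, so the objective has no second-order expansion: only the mean
  \<open>mu\<close> of its increments is nearly linear, and the increments have second moment at
  most of order \<open>a\<close> at sup-distance \<open>a\<close>. On the sphere \<open>a\<close> is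
  of order \<open>H / sqrt h\<close> with \<open>H = h ^ m\<close>, which tends to 0 because m is
  positive, so the local conditions on \<psi> apply. All terms are compared with
  \<open>H\<^sup>2\<close>, where \<open>real n * h * H\<^sup>2 = 1\<close>. The chaining trades
  variation against moments at a level \<open>\<theta> = \<eta> / H\<close>, with \<eta> a small
  negative power of n; variation then costs \<eta> log n relative to \<open>H\<^sup>2\<close>.
  Second moments would leave a relative error of order \<open>h ^ (m - 1) / \<eta>\<close> up to
  logarithms, which does not vanish for m = 1; fourth moments leave
  \<open>h powr (2 * m - 3 / 2) / \<eta> ^ 3\<close> as the main term, which does. The splines need
  be neither unique nor measurable in the outcome. Hence the random bounds are fixed before the
  perturbation and hold for all perturbations simultaneously, outside one measurable exceptional
  event.\<close>

definition nonoverlapping :: "real \<Rightarrow> real \<Rightarrow> (real \<times> real) set \<Rightarrow> bool" where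
  "nonoverlapping a b P \<longleftrightarrow> finite P \<and> (\<forall>p\<in>P. a \<le> fst p \<and> fst p < snd p \<and> snd p \<le> b) \<and>
     (\<forall>p\<in>P. \<forall>q\<in>P. p \<noteq> q \<longrightarrow> snd p \<le> fst q \<or> snd q \<le> fst p)"

definition increments :: "(real \<Rightarrow> real) \<Rightarrow> (real \<times> real) set \<Rightarrow> real" where
  "increments f P = (\<Sum>p\<in>P. \<bar>f (snd p) - f (fst p)\<bar>)"

lemma nonoverlapping_mono: "nonoverlapping a b P \<Longrightarrow> a' \<le> a \<Longrightarrow> b \<le> b' \<Longrightarrow> nonoverlapping a' b' P"
  unfolding nonoverlapping_def by (meson order_trans)

text \<open>The open intervals are pairwise disjoint subsets of [a, b], so this is a comparison of
  Lebesgue measures.\<close>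

lemma nonoverlapping_length:
  assumes "nonoverlapping a b P" "a \<le> b"
  shows "(\<Sum>p\<in>P. snd p - fst p) \<le> b - a"
proof -
  have fin: "finite P" and pr: "\<And>p. p \<in> P \<Longrightarrow> a \<le> fst p \<and> fst p < snd p \<and> snd p \<le> b"
    and dj: "\<And>p q. p \<in> P \<Longrightarrow> q \<in> P \<Longrightarrow> p \<noteq> q \<Longrightarrow> snd p \<le> fst q \<or> snd q \<le> fst p"
    using assms by (auto simp: nonoverlapping_def)
  have "disjoint_family_on (\<lambda>p. {fst p<..<snd p}) P"
    unfolding disjoint_family_on_def using dj by fastforce
  then have "(\<Sum>p\<in>P. emeasure lborel {fst p<..<snd p}) = emeasure lborel (\<Union>p\<in>P. {fst p<..<snd p})"
    using fin by (intro sum_emeasure) auto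
  also have "\<dots> \<le> emeasure lborel {a..b}"
    using pr by (intro emeasure_mono) fastforce+
  also have "\<dots> = ennreal (b - a)" using assms by simp
  also have "(\<Sum>p\<in>P. emeasure lborel {fst p<..<snd p}) = (\<Sum>p\<in>P. ennreal (snd p - fst p))"
    using pr by (intro sum.cong) (auto simp: less_imp_le)
  also have "\<dots> = ennreal (\<Sum>p\<in>P. snd p - fst p)"
    using pr by (intro sum_ennreal) (auto simp: less_imp_le)
  finally show ?thesis using assms by (simp add: ennreal_le_iff)
qed

lemma nonoverlapping_Un:
  assumes "nonoverlapping a b P" "nonoverlapping b c Q" "a \<le> b" "b \<le> c"
  shows "nonoverlapping a c (P \<union> Q)" "increments f (P \<union> Q) = increments f P + increments f Q"
proof -
  show "nonoverlapping a c (P \<union> Q)"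
    unfolding nonoverlapping_def
  proof (intro conjI ballI impI)
    show "finite (P \<union> Q)" using assms by (auto simp: nonoverlapping_def)
    fix p assume p: "p \<in> P \<union> Q"
    show "a \<le> fst p" "fst p < snd p" "snd p \<le> c"
      using p assms unfolding nonoverlapping_def by fastforce+
    fix q assume q: "q \<in> P \<union> Q" "p \<noteq> q"
    show "snd p \<le> fst q \<or> snd q \<le> fst p"
      using p q assms unfolding nonoverlapping_def by (smt (verit) UnE)
  qed
  have "P \<inter> Q = {}" using assms unfolding nonoverlapping_def by fastforce
  then show "increments f (P \<union> Q) = increments f P + increments f Q"
    using assms unfolding increments_def nonoverlapping_def by (simp add: sum.union_disjoint)
qed

text \<open>An interval straddling \<open>b\<close> is cut there, and the triangle inequality
  absorbs the new point. \<open>g\<close> clips right end points and \<open>g'\<close> left ones;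
  both are injective on the intervals they keep because intervals of positive length that share an
  end point coincide.\<close>

lemma nonoverlapping_split:
  assumes P: "nonoverlapping a c P" and "a \<le> b" "b \<le> c"
  obtains P1 P2 where "nonoverlapping a b P1" "nonoverlapping b c P2"
    "increments f P \<le> increments f P1 + increments f P2"
proof -
  have fin: "finite P" and pr: "\<And>p. p \<in> P \<Longrightarrow> a \<le> fst p \<and> fst p < snd p \<and> snd p \<le> c"
    and dj: "\<And>p q. p \<in> P \<Longrightarrow> q \<in> P \<Longrightarrow> p \<noteq> q \<Longrightarrow> snd p \<le> fst q \<or> snd q \<le> fst p"
    using assms by (auto simp: nonoverlapping_def)
  define g where "g = (\<lambda>p::real\<times>real. (fst p, min (snd p) b))"
  define g' where "g' = (\<lambda>p::real\<times>real. (max (fst p) b, snd p))"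
  define A where "A = {p\<in>P. fst p < b}"
  define B where "B = {p\<in>P. b < snd p}"
  have ig: "inj_on g A"
  proof (rule inj_onI)
    fix p q assume "p \<in> A" "q \<in> A" "g p = g q"
    then have "fst p = fst q" "p \<in> P" "q \<in> P" by (auto simp: g_def A_def)
    then show "p = q" using dj[of p q] pr[of p] pr[of q] by force
  qed
  have ig': "inj_on g' B"
  proof (rule inj_onI)
    fix p q assume "p \<in> B" "q \<in> B" "g' p = g' q"
    then have "snd p = snd q" "p \<in> P" "q \<in> P" by (auto simp: g'_def B_def)
    then show "p = q" using dj[of p q] pr[of p] pr[of q] by force
  qed
  have 1: "nonoverlapping a b (g ` A)"
    unfolding nonoverlapping_def
  proof (intro conjI ballI impI)
    show "finite (g ` A)" using fin by (simp add: A_def)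
    fix p assume "p \<in> g ` A"
    then obtain p' where p': "p' \<in> A" "p = g p'" by auto
    then show "a \<le> fst p" "fst p < snd p" "snd p \<le> b"
      using pr[of p'] by (auto simp: g_def A_def)
    fix q assume "q \<in> g ` A" "p \<noteq> q"
    then obtain q' where q': "q' \<in> A" "q = g q'" "q' \<noteq> p'" using p' by auto
    then show "snd p \<le> fst q \<or> snd q \<le> fst p"
      using p' dj[of p' q'] by (auto simp: g_def A_def min_le_iff_disj)
  qed
  have 2: "nonoverlapping b c (g' ` B)"
    unfolding nonoverlapping_def
  proof (intro conjI ballI impI)
    show "finite (g' ` B)" using fin by (simp add: B_def)
    fix p assume "p \<in> g' ` B"
    then obtain p' where p': "p' \<in> B" "p = g' p'" by auto
    then show "b \<le> fst p" "fst p < snd p" "snd p \<le> c"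
      using pr[of p'] by (auto simp: g'_def B_def)
    fix q assume "q \<in> g' ` B" "p \<noteq> q"
    then obtain q' where q': "q' \<in> B" "q = g' q'" "q' \<noteq> p'" using p' by auto
    then show "snd p \<le> fst q \<or> snd q \<le> fst p"
      using p' dj[of p' q'] by (auto simp: g'_def B_def le_max_iff_disj)
  qed
  have "increments f P \<le> (\<Sum>p\<in>P. (if fst p < b then \<bar>f (snd (g p)) - f (fst (g p))\<bar> else 0) +
      (if b < snd p then \<bar>f (snd (g' p)) - f (fst (g' p))\<bar> else 0))"
    unfolding increments_def
  proof (rule sum_mono)
    fix p assume "p \<in> P"
    then show "\<bar>f (snd p) - f (fst p)\<bar> \<le> (if fst p < b then \<bar>f (snd (g p)) - f (fst (g p))\<bar> else 0) +
      (if b < snd p then \<bar>f (snd (g' p)) - f (fst (g' p))\<bar> else 0)"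
      using pr[of p] by (cases "fst p < b"; cases "b < snd p") (auto simp: g_def g'_def min_def max_def)
  qed
  also have "\<dots> = (\<Sum>p\<in>A. \<bar>f (snd (g p)) - f (fst (g p))\<bar>) + (\<Sum>p\<in>B. \<bar>f (snd (g' p)) - f (fst (g' p))\<bar>)"
    unfolding A_def B_def sum.distrib using fin by (simp add: sum.inter_filter)
  also have "\<dots> = increments f (g ` A) + increments f (g' ` B)"
    unfolding increments_def by (simp add: sum.reindex[OF ig] sum.reindex[OF ig'])
  finally show ?thesis using that 1 2 by blast
qed

text \<open>Families of end point pairs are easier to clip and refine than divisions, which are sets
  of sets. The degenerate intervals allowed in a division contribute zero to both sums and are
  dropped in \<open>D'\<close>.\<close>

lemma absolutely_continuous_on_nonoverlapping:
  "absolutely_continuous_on {a..b} f \<longleftrightarrow>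
    (\<forall>e>0. \<exists>d>0. \<forall>P. nonoverlapping a b P \<longrightarrow> (\<Sum>p\<in>P. snd p - fst p) < d \<longrightarrow> increments f P < e)"
proof
  assume L: "absolutely_continuous_on {a..b} f"
  show "\<forall>e>0. \<exists>d>0. \<forall>P. nonoverlapping a b P \<longrightarrow> (\<Sum>p\<in>P. snd p - fst p) < d \<longrightarrow> increments f P < e"
  proof (intro allI impI)
    fix e :: real assume "0 < e"
    from L[unfolded absolutely_continuous_on_def, rule_format, OF this]
    obtain d where "d > 0" and d: "\<And>D. D division_of \<Union>D \<Longrightarrow> \<Union>D \<subseteq> {a..b} \<Longrightarrow>
        (\<Sum>k\<in>D. Sup k - Inf k) < d \<Longrightarrow> (\<Sum>k\<in>D. \<bar>f (Sup k) - f (Inf k)\<bar>) < e"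
      by blast
    show "\<exists>d>0. \<forall>P. nonoverlapping a b P \<longrightarrow> (\<Sum>p\<in>P. snd p - fst p) < d \<longrightarrow> increments f P < e"
    proof (intro exI[of _ d] conjI allI impI)
      fix P assume P: "nonoverlapping a b P" and len: "(\<Sum>p\<in>P. snd p - fst p) < d"
      have fin: "finite P" and pr: "\<And>p. p \<in> P \<Longrightarrow> a \<le> fst p \<and> fst p < snd p \<and> snd p \<le> b"
        and dj: "\<And>p q. p \<in> P \<Longrightarrow> q \<in> P \<Longrightarrow> p \<noteq> q \<Longrightarrow> snd p \<le> fst q \<or> snd q \<le> fst p"
        using P by (auto simp: nonoverlapping_def)
      define D where "D = (\<lambda>p. {fst p..snd p}) ` P"
      have inj: "inj_on (\<lambda>p. {fst p..snd p}) P"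
        by (rule inj_onI) (use pr in \<open>force simp: Icc_eq_Icc prod_eq_iff\<close>)
      have "D division_of \<Union>D"
      proof (rule division_ofI)
        show "finite D" using fin by (simp add: D_def)
        fix K1 K2 assume "K1 \<in> D" "K2 \<in> D" "K1 \<noteq> K2"
        then obtain p q where "p \<in> P" "q \<in> P" "p \<noteq> q" "K1 = {fst p..snd p}" "K2 = {fst q..snd q}"
          unfolding D_def by auto
        then show "interior K1 \<inter> interior K2 = {}" using dj[of p q] by (auto simp: interior_atLeastAtMost_real)
      qed (use pr in \<open>force simp: D_def\<close>)+
      moreover have "\<Union>D \<subseteq> {a..b}" using pr by (fastforce simp: D_def)
      moreover have "(\<Sum>k\<in>D. Sup k - Inf k) = (\<Sum>p\<in>P. snd p - fst p)"
        unfolding D_def sum.reindex[OF inj] using pr by (intro sum.cong) (auto simp: less_imp_le)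
      moreover have "(\<Sum>k\<in>D. \<bar>f (Sup k) - f (Inf k)\<bar>) = increments f P"
        unfolding D_def sum.reindex[OF inj] increments_def using pr by (intro sum.cong) (auto simp: less_imp_le)
      ultimately show "increments f P < e" using d[of D] len by simp
    qed fact
  qed
next
  assume R: "\<forall>e>0. \<exists>d>0. \<forall>P. nonoverlapping a b P \<longrightarrow> (\<Sum>p\<in>P. snd p - fst p) < d \<longrightarrow> increments f P < e"
  show "absolutely_continuous_on {a..b} f"
    unfolding absolutely_continuous_on_def
  proof (intro allI impI)
    fix e :: real assume "0 < e"
    with R obtain d where "d > 0" and d: "\<And>P. nonoverlapping a b P \<Longrightarrow> (\<Sum>p\<in>P. snd p - fst p) < d \<Longrightarrow> increments f P < e"
      by metis
    show "\<exists>d>0. \<forall>D. D division_of \<Union>D \<longrightarrow> \<Union>D \<subseteq> {a..b} \<longrightarrow> (\<Sum>k\<in>D. Sup k - Inf k) < d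
        \<longrightarrow> (\<Sum>k\<in>D. \<bar>f (Sup k) - f (Inf k)\<bar>) < e"
    proof (intro exI[of _ d] conjI allI impI)
      fix D assume D: "D division_of \<Union>D" "\<Union>D \<subseteq> {a..b}" and len: "(\<Sum>k\<in>D. Sup k - Inf k) < d"
      have fin: "finite D" using D by auto
      have K: "\<exists>u v. k = {u..v} \<and> u \<le> v \<and> Inf k = u \<and> Sup k = v \<and> a \<le> u \<and> v \<le> b" if k: "k \<in> D" for k
      proof -
        obtain u v where uv: "k = cbox u v" "k \<noteq> {}" using division_ofD(3,4)[OF D(1) k] by blast
        then have "u \<le> v" by auto
        moreover have "k \<subseteq> {a..b}" using D(2) k by auto
        ultimately show ?thesis using uv by (auto intro!: exI[of _ u] exI[of _ v])
      qed
      define D' where "D' = {k\<in>D. Inf k < Sup k}"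
      define h where "h = (\<lambda>k::real set. (Inf k, Sup k))"
      have inj: "inj_on h D'"
      proof (rule inj_onI)
        fix k l assume "k \<in> D'" "l \<in> D'" "h k = h l"
        then show "k = l" using K[of k] K[of l] by (auto simp: D'_def h_def)
      qed
      have P: "nonoverlapping a b (h ` D')"
        unfolding nonoverlapping_def
      proof (intro conjI ballI impI)
        show "finite (h ` D')" using fin by (simp add: D'_def)
        fix p assume "p \<in> h ` D'"
        then obtain k where k: "k \<in> D'" "p = h k" by auto
        then show "a \<le> fst p" "fst p < snd p" "snd p \<le> b"
          using K[of k] by (auto simp: h_def D'_def)
        fix q assume "q \<in> h ` D'" "p \<noteq> q"
        then obtain l where l: "l \<in> D'" "q = h l" "k \<noteq> l" using k by auto
        obtain u v where uv: "k = {u..v}" "u < v" "p = (u,v)" using K[of k] k by (auto simp: D'_def h_def)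
        obtain w z where wz: "l = {w..z}" "w < z" "q = (w,z)" using K[of l] l by (auto simp: D'_def h_def)
        have "interior k \<inter> interior l = {}" using D(1) k l unfolding division_of_def D'_def by blast
        then have "{u<..<v} \<inter> {w<..<z} = {}" using uv wz by (simp add: interior_atLeastAtMost_real)
        then have "\<not> (max u w < min v z)"
        proof -
          have "(max u w + min v z) / 2 \<in> {u<..<v} \<inter> {w<..<z}" if "max u w < min v z"
            using that by auto
          then show ?thesis using \<open>{u<..<v} \<inter> {w<..<z} = {}\<close> by blast
        qed
        then show "snd p \<le> fst q \<or> snd q \<le> fst p" using uv wz by (auto simp: max_def min_def split: if_splits)
      qed
      have s: "(\<Sum>k\<in>D. F k) = (\<Sum>k\<in>D'. F k)" if "\<And>k. Inf k = Sup k \<Longrightarrow> F k = 0" for F :: "real set \<Rightarrow> real"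
      proof (rule sum.mono_neutral_right)
        show "\<forall>i\<in>D - D'. F i = 0"
        proof
          fix i assume "i \<in> D - D'"
          then show "F i = 0" using K[of i] by (intro that) (auto simp: D'_def)
        qed
      qed (use fin in \<open>auto simp: D'_def\<close>)
      have "(\<Sum>p\<in>h ` D'. snd p - fst p) = (\<Sum>k\<in>D. Sup k - Inf k)"
        unfolding sum.reindex[OF inj] by (subst s) (auto simp: h_def)
      moreover have "increments f (h ` D') = (\<Sum>k\<in>D. \<bar>f (Sup k) - f (Inf k)\<bar>)"
        unfolding increments_def sum.reindex[OF inj] by (subst s) (auto simp: h_def)
      ultimately show "(\<Sum>k\<in>D. \<bar>f (Sup k) - f (Inf k)\<bar>) < e" using d[OF P] len by simp
    qed fact
  qed
qed

text \<open>With tolerance 1 in the definition, cutting [a, b] into pieces of length at most d/2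
  bounds the increments on each piece by 1. The half leaves room for the strict inequality in the
  definition.\<close>

lemma absolutely_continuous_on_increments_bounded:
  assumes "absolutely_continuous_on {a..b} f"
  obtains B where "\<And>P. nonoverlapping a b P \<Longrightarrow> increments f P \<le> B"
proof -
  obtain d where "d > 0" and d: "\<And>P. nonoverlapping a b P \<Longrightarrow> (\<Sum>p\<in>P. snd p - fst p) < d \<Longrightarrow> increments f P < 1"
    using assms unfolding absolutely_continuous_on_nonoverlapping by (meson zero_less_one)
  have "\<forall>P. nonoverlapping a (min b (a + real n * (d/2))) P \<longrightarrow> increments f P \<le> real n" for n
  proof (induction n)
    case 0
    show ?case
    proof (intro allI impI)
      fix P assume "nonoverlapping a (min b (a + real 0 * (d/2))) P"
      then have "P = {}" unfolding nonoverlapping_def by fastforce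
      then show "increments f P \<le> real 0" by (simp add: increments_def)
    qed
  next
    case (Suc n)
    show ?case
    proof (intro allI impI)
      fix P assume P: "nonoverlapping a (min b (a + real (Suc n) * (d/2))) P"
      show "increments f P \<le> real (Suc n)"
      proof (cases "a \<le> b")
        case False
        then have "P = {}" using P unfolding nonoverlapping_def by fastforce
        then show ?thesis by (simp add: increments_def)
      next
        case True
        let ?x = "min b (a + real n * (d/2))" and ?y = "min b (a + real (Suc n) * (d/2))"
        have xy: "a \<le> ?x" "?x \<le> ?y" "?y - ?x \<le> d/2" "?y \<le> b"
        proof -
          have "0 \<le> real n * (d/2)" "real (Suc n) * (d/2) = real n * (d/2) + d/2"
            using \<open>d > 0\<close> by (auto simp: field_simps)
          then show "a \<le> ?x" "?x \<le> ?y" "?y - ?x \<le> d/2" "?y \<le> b"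
            using True \<open>d > 0\<close> by linarith+
        qed
        obtain P1 P2 where *: "nonoverlapping a ?x P1" "nonoverlapping ?x ?y P2"
            "increments f P \<le> increments f P1 + increments f P2"
          using nonoverlapping_split[OF P xy(1,2)] by blast
        have "(\<Sum>p\<in>P2. snd p - fst p) < d"
          using nonoverlapping_length[OF *(2) xy(2)] xy(3) \<open>d > 0\<close> by linarith
        then have "increments f P2 < 1"
          using nonoverlapping_mono[OF *(2) xy(1,4)] by (intro d)
        then show ?thesis using Suc * by fastforce
      qed
    qed
  qed
  moreover obtain n where "b - a < real n * (d/2)"
    using \<open>d > 0\<close> ex_less_of_nat_mult[of "d/2" "b - a"] by auto
  then have "min b (a + real n * (d/2)) = b" by auto
  ultimately show ?thesis using that by metis
qed

text \<open>The total variation on [a, x]. A real \<open>SUP\<close> is only meaningful for bounded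
  sets, which absolute continuity on [a, b] provides for x up to b.\<close>

definition variation_upto :: "real \<Rightarrow> (real \<Rightarrow> real) \<Rightarrow> real \<Rightarrow> real" where
  "variation_upto a f x = (SUP P\<in>{P. nonoverlapping a x P}. increments f P)"

lemma nonoverlapping_empty[simp]: "nonoverlapping a b {}" by (simp add: nonoverlapping_def)

lemma nonoverlapping_single: "a < b \<Longrightarrow> nonoverlapping a b {(a,b)}" by (simp add: nonoverlapping_def)

text \<open>Needed to refine every interval of a family by its own family of nearly maximal
  variation.\<close>

lemma nonoverlapping_UN:
  assumes P: "nonoverlapping a b P" and Q: "\<And>p. p \<in> P \<Longrightarrow> nonoverlapping (fst p) (snd p) (Q p)"
  shows "nonoverlapping a b (\<Union>p\<in>P. Q p)"
    "(\<Sum>q\<in>(\<Union>p\<in>P. Q p). w q) = (\<Sum>p\<in>P. \<Sum>q\<in>Q p. (w q::real))"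
proof -
  have fin: "finite P" and pr: "\<And>p. p \<in> P \<Longrightarrow> a \<le> fst p \<and> fst p < snd p \<and> snd p \<le> b"
    and dj: "\<And>p q. p \<in> P \<Longrightarrow> q \<in> P \<Longrightarrow> p \<noteq> q \<Longrightarrow> snd p \<le> fst q \<or> snd q \<le> fst p"
    using P by (auto simp: nonoverlapping_def)
  have finQ: "finite (Q p)" if "p \<in> P" for p using Q[OF that] by (simp add: nonoverlapping_def)
  have prQ: "fst p \<le> fst q \<and> fst q < snd q \<and> snd q \<le> snd p" if "p \<in> P" "q \<in> Q p" for p q
    using Q[OF that(1)] that(2) by (simp add: nonoverlapping_def)
  show "nonoverlapping a b (\<Union>p\<in>P. Q p)"
    unfolding nonoverlapping_def
  proof (intro conjI ballI impI)
    show "finite (\<Union>p\<in>P. Q p)" using fin finQ by auto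
    fix q assume "q \<in> (\<Union>p\<in>P. Q p)"
    then obtain p where p: "p \<in> P" "q \<in> Q p" by auto
    show "a \<le> fst q" "fst q < snd q" "snd q \<le> b" using pr[OF p(1)] prQ[OF p] by auto
    fix q' assume "q' \<in> (\<Union>p\<in>P. Q p)" and ne: "q \<noteq> q'"
    then obtain p' where p': "p' \<in> P" "q' \<in> Q p'" by auto
    show "snd q \<le> fst q' \<or> snd q' \<le> fst q"
    proof (cases "p = p'")
      case True
      then show ?thesis using Q[OF p(1)] p p' ne unfolding nonoverlapping_def by blast
    next
      case False
      then show ?thesis using dj[OF p(1) p'(1)] prQ[OF p] prQ[OF p'] by linarith
    qed
  qed
  show "(\<Sum>q\<in>(\<Union>p\<in>P. Q p). w q) = (\<Sum>p\<in>P. \<Sum>q\<in>Q p. w q)"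
  proof (rule sum.UNION_disjoint)
    show "\<forall>i\<in>P. \<forall>j\<in>P. i \<noteq> j \<longrightarrow> Q i \<inter> Q j = {}"
      using dj prQ by (smt (verit, best) disjoint_iff)
  qed (use fin finQ in auto)
qed

text \<open>Concatenating families gives superadditivity of the variation, cutting them gives the
  reverse up to \<eta>. The increment of the variation over an interval is thus nearly attained by a
  family inside it, and the union of these families has no greater total length.\<close>

lemma variation_upto_props:
  assumes ac: "absolutely_continuous_on {a..b} f"
  shows "a \<le> x \<Longrightarrow> x \<le> y \<Longrightarrow> y \<le> b \<Longrightarrow> \<bar>f y - f x\<bar> \<le> variation_upto a f y - variation_upto a f x"
    and "absolutely_continuous_on {a..b} (variation_upto a f)"
proof -
  let ?V = "variation_upto a f"
  obtain B where B: "\<And>P. nonoverlapping a b P \<Longrightarrow> increments f P \<le> B"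
    using absolutely_continuous_on_increments_bounded[OF ac] by blast
  have bdd: "bdd_above (increments f ` {P. nonoverlapping a x P})" if "x \<le> b" for x
    using B nonoverlapping_mono[OF _ order_refl that] by (auto intro!: bdd_aboveI[of _ B])
  have ne: "{P. nonoverlapping a x P} \<noteq> {}" for x using nonoverlapping_empty by blast
  have up: "increments f P \<le> ?V x" if "nonoverlapping a x P" "x \<le> b" for P x
    unfolding variation_upto_def using that bdd by (intro cSUP_upper) auto
  have add: "?V x + increments f P \<le> ?V y" if "nonoverlapping x y P" "a \<le> x" "x \<le> y" "y \<le> b" for P x y
  proof -
    have "?V x \<le> ?V y - increments f P"
      unfolding variation_upto_def[of a f x]
    proof (rule cSUP_least[OF ne])
      fix Q assume "Q \<in> {P. nonoverlapping a x P}"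
      then have "nonoverlapping a y (Q \<union> P)" "increments f (Q \<union> P) = increments f Q + increments f P"
        using nonoverlapping_Un(1)[of a x Q y P] nonoverlapping_Un(2)[of a x Q y P f] that by auto
      then show "increments f Q \<le> ?V y - increments f P" using up[of y "Q \<union> P"] that by simp
    qed
    then show ?thesis by simp
  qed
  show "\<bar>f y - f x\<bar> \<le> ?V y - ?V x" if xy: "a \<le> x" "x \<le> y" "y \<le> b" for x y
  proof (cases "x = y")
    case False
    then show ?thesis using add[OF nonoverlapping_single[of x y]] xy by (simp add: increments_def)
  qed simp
  have sub: "\<exists>Q. nonoverlapping x y Q \<and> ?V y - ?V x \<le> increments f Q + \<eta>"
    if "a \<le> x" "x \<le> y" "y \<le> b" "\<eta> > 0" for x y \<eta>
  proof -
    have "?V y - \<eta> < (SUP P\<in>{P. nonoverlapping a y P}. increments f P)"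
      using that by (simp add: variation_upto_def)
    then obtain P where P: "nonoverlapping a y P" "?V y - \<eta> < increments f P"
      using less_cSUP_iff[OF ne bdd[OF \<open>y \<le> b\<close>]] by blast
    obtain P1 P2 where "nonoverlapping a x P1" "nonoverlapping x y P2"
        "increments f P \<le> increments f P1 + increments f P2"
      using nonoverlapping_split[OF P(1) \<open>a \<le> x\<close> \<open>x \<le> y\<close>] by blast
    then show ?thesis using P up[of x P1] that by (intro exI[of _ P2]) auto
  qed
  show "absolutely_continuous_on {a..b} ?V"
    unfolding absolutely_continuous_on_nonoverlapping
  proof (intro allI impI)
    fix e :: real assume "e > 0"
    then obtain d where "d > 0" and d: "\<And>P. nonoverlapping a b P \<Longrightarrow> (\<Sum>p\<in>P. snd p - fst p) < d \<Longrightarrow> increments f P < e/2"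
      using ac unfolding absolutely_continuous_on_nonoverlapping by (meson half_gt_zero)
    show "\<exists>d>0. \<forall>P. nonoverlapping a b P \<longrightarrow> (\<Sum>p\<in>P. snd p - fst p) < d \<longrightarrow> increments ?V P < e"
    proof (intro exI[of _ d] conjI allI impI)
      fix P assume P: "nonoverlapping a b P" and len: "(\<Sum>p\<in>P. snd p - fst p) < d"
      have pr: "a \<le> fst p \<and> fst p < snd p \<and> snd p \<le> b" if "p \<in> P" for p
        using P that by (auto simp: nonoverlapping_def)
      \<comment> \<open>The error \<eta> occurs once per interval, so the errors add up to less than
        \<open>e/2\<close>; the added 1 covers an empty \<open>P\<close>.\<close>
      define \<eta> where "\<eta> = e / (2 * (real (card P) + 1))"
      have "\<eta> > 0" using \<open>e > 0\<close> by (simp add: \<eta>_def)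
      have "\<forall>p\<in>P. \<exists>Q. nonoverlapping (fst p) (snd p) Q \<and> ?V (snd p) - ?V (fst p) \<le> increments f Q + \<eta>"
        using sub pr \<open>\<eta> > 0\<close> by (meson less_imp_le)
      then obtain Q where Q: "\<And>p. p \<in> P \<Longrightarrow> nonoverlapping (fst p) (snd p) (Q p)"
        and Q2: "\<And>p. p \<in> P \<Longrightarrow> ?V (snd p) - ?V (fst p) \<le> increments f (Q p) + \<eta>" by metis
      note U = nonoverlapping_UN[OF P Q]
      have "(\<Sum>q\<in>(\<Union>p\<in>P. Q p). snd q - fst q) = (\<Sum>p\<in>P. \<Sum>q\<in>Q p. snd q - fst q)"
        by (rule U)
      also have "\<dots> \<le> (\<Sum>p\<in>P. snd p - fst p)"
        using nonoverlapping_length[OF Q] pr by (intro sum_mono) (simp add: less_imp_le)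
      finally have "increments f (\<Union>p\<in>P. Q p) < e/2" using len U(1) by (intro d) auto
      moreover have "increments f (\<Union>p\<in>P. Q p) = (\<Sum>p\<in>P. increments f (Q p))"
        unfolding increments_def by (rule U)
      moreover have "increments ?V P = (\<Sum>p\<in>P. ?V (snd p) - ?V (fst p))"
        unfolding increments_def
      proof (intro sum.cong refl)
        fix p assume "p \<in> P"
        then have "?V (fst p) + increments f {} \<le> ?V (snd p)"
          using pr[of p] by (intro add) auto
        then show "\<bar>?V (snd p) - ?V (fst p)\<bar> = ?V (snd p) - ?V (fst p)" by (simp add: increments_def)
      qed
      moreover have "(\<Sum>p\<in>P. ?V (snd p) - ?V (fst p)) \<le> (\<Sum>p\<in>P. increments f (Q p)) + real (card P) * \<eta>"
        using sum_mono[OF Q2, of P] by (simp add: sum.distrib)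
      moreover have "real (card P) * \<eta> < e/2"
        using \<open>e > 0\<close> by (simp add: \<eta>_def field_simps)
      ultimately show "increments ?V P < e" by linarith
    qed fact
  qed
qed

section \<open>Lebesgue differentiation, and absolutely continuous functions as integrals\<close>

text \<open>On \<open>E k\<close> the difference quotient misses \<open>g x\<close> by more than
  1/(k+1) on arbitrarily short intervals with end point x. Disjoint such intervals form a tagged
  partial division fine for a Henstock gauge, so their total length is small, and Vitali covering
  passes from them to all of \<open>E k\<close>.\<close>

lemma lebesgue_differentiation_interval:
  fixes g :: "real \<Rightarrow> real"
  assumes int: "g integrable_on {a..b}"
  shows "negligible {x\<in>{a..b}. \<not> ((\<lambda>x. integral {a..x} g) has_vector_derivative g x) (at x within {a..b})}"
proof -
  define G where "G = (\<lambda>x. integral {a..x} g)"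
  have incr: "integral {x..y} g = G y - G x" if "a \<le> x" "x \<le> y" "y \<le> b" for x y
  proof -
    have "g integrable_on {a..y}" using integrable_subinterval_real[OF int, of a y] that by simp
    from Henstock_Kurzweil_Integration.integral_combine[OF that(1,2) this]
    show ?thesis by (simp add: G_def)
  qed
  define E where "E = (\<lambda>k::nat. {x\<in>{a..b}. \<forall>d>0. \<exists>y\<in>{a..b}. y \<noteq> x \<and> \<bar>y - x\<bar> < d \<and>
      \<bar>G y - G x - g x * (y - x)\<bar> > \<bar>y - x\<bar> / real (Suc k)})"
  have neg: "negligible (E k)" for k
    unfolding negligible_outer_le
  proof (intro allI impI)
    fix e :: real assume "e > 0"
    \<comment> \<open>The factor 5 is the enlargement of the Vitali balls; \<open>Suc k\<close>
      converts the excess of the error into length.\<close>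
    define e' where "e' = e / (5 * real (Suc k))"
    have "e' > 0" using \<open>e > 0\<close> by (simp add: e'_def)
    have gi: "g integrable_on cbox a b" using int by simp
    obtain \<gamma> where \<gamma>: "gauge \<gamma>"
      and H: "\<And>p. p tagged_partial_division_of (cbox a b) \<Longrightarrow> \<gamma> fine p \<Longrightarrow>
             (\<Sum>(x,k)\<in>p. norm (measure lborel k *\<^sub>R g x - integral k g)) < e'"
      by (rule Henstock_lemma[OF gi \<open>e' > 0\<close>], rule that)
    have "\<forall>x\<in>E k. \<exists>y\<in>{a..b}. y \<noteq> x \<and> {min x y..max x y} \<subseteq> \<gamma> x \<and>
      \<bar>G y - G x - g x * (y - x)\<bar> > \<bar>y - x\<bar> / real (Suc k)"
    proof
      fix x assume x: "x \<in> E k"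
      obtain d where d: "d > 0" "ball x d \<subseteq> \<gamma> x"
        using \<gamma> by (meson gaugeD openE)
      then obtain y where y: "y \<in> {a..b}" "y \<noteq> x" "\<bar>y - x\<bar> < d" "\<bar>G y - G x - g x * (y - x)\<bar> > \<bar>y - x\<bar> / real (Suc k)"
        using x unfolding E_def by blast
      moreover have "{min x y..max x y} \<subseteq> ball x d"
        using y(3) by (auto simp: dist_real_def min_def max_def split: if_splits)
      ultimately show "\<exists>y\<in>{a..b}. y \<noteq> x \<and> {min x y..max x y} \<subseteq> \<gamma> x \<and>
        \<bar>G y - G x - g x * (y - x)\<bar> > \<bar>y - x\<bar> / real (Suc k)" using d by blast
    qed
    then obtain y where y: "\<And>x. x \<in> E k \<Longrightarrow> y x \<in> {a..b} \<and> y x \<noteq> x \<and> {min x (y x)..max x (y x)} \<subseteq> \<gamma> x \<and>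
      \<bar>G (y x) - G x - g x * (y x - x)\<bar> > \<bar>y x - x\<bar> / real (Suc k)" by metis
    \<comment> \<open>\<open>cball (c x) (r x)\<close> is the interval between x and
      \<open>y x\<close>; its tag x is an end point, not the centre.\<close>
    define c where "c = (\<lambda>x. (x + y x) / 2)"
    define r where "r = (\<lambda>x. \<bar>y x - x\<bar> / 2)"
    have cb: "cball (c x) (r x) = {min x (y x)..max x (y x)}" for x
      unfolding cball_eq_atLeastAtMost c_def r_def by (auto simp: min_def max_def abs_if field_simps)
    have Eab: "x \<in> {a..b}" if "x \<in> E k" for x using that by (simp add: E_def)
    have r: "0 < r x \<and> r x \<le> b - a" if "x \<in> E k" for x
      using y[OF that] Eab[OF that] by (auto simp: r_def abs_if)
    have S: "E k \<subseteq> (\<Union>x\<in>E k. cball (c x) (r x))" unfolding cb by fastforce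
    obtain C where C: "countable C" "C \<subseteq> E k"
       and pw: "pairwise (\<lambda>i j. disjnt (cball (c i) (r i)) (cball (c j) (r j))) C"
       and cov: "E k \<subseteq> (\<Union>i\<in>C. cball (c i) (5 * r i))"
      by (rule Vitali_covering_lemma_cballs[OF S r])
    have fin: "(\<Sum>x\<in>F. 10 * r x) \<le> e" if F: "F \<subseteq> C" "finite F" for F
    proof -
      define p where "p = (\<lambda>x. (x, cball (c x) (r x))) ` F"
      have inj: "inj_on (\<lambda>x. (x, cball (c x) (r x))) F" by (rule inj_onI) simp
      have "p tagged_partial_division_of cbox a b"
        unfolding tagged_partial_division_of_def
      proof (intro conjI allI impI)
        show "finite p" using F by (simp add: p_def)
        fix x K assume "(x, K) \<in> p"
        then have xF: "x \<in> E k" "K = {min x (y x)..max x (y x)}" using F C by (auto simp: p_def cb)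
        then show "x \<in> K" by auto
        show "K \<subseteq> cbox a b" using xF y[OF xF(1)] Eab[OF xF(1)] by auto
        show "\<exists>a b. K = cbox a b" using xF by auto
      next
        fix x1 K1 x2 K2 assume "(x1, K1) \<in> p \<and> (x2, K2) \<in> p \<and> (x1, K1) \<noteq> (x2, K2)"
        then have "x1 \<in> C" "x2 \<in> C" "x1 \<noteq> x2" "K1 = cball (c x1) (r x1)" "K2 = cball (c x2) (r x2)"
          using F by (auto simp: p_def)
        then have "K1 \<inter> K2 = {}" using pw unfolding pairwise_def disjnt_def by blast
        then show "interior K1 \<inter> interior K2 = {}" using interior_subset by blast
      qed
      moreover have "\<gamma> fine p"
        unfolding fine_def p_def cb using y F C by blast
      ultimately have "(\<Sum>(x,k)\<in>p. norm (measure lborel k *\<^sub>R g x - integral k g)) < e'" by (rule H)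
      then have "(\<Sum>x\<in>F. \<bar>measure lborel (cball (c x) (r x)) * g x - integral (cball (c x) (r x)) g\<bar>) < e'"
        unfolding p_def by (simp add: sum.reindex[OF inj])
      moreover have "2 * r x / real (Suc k) \<le> \<bar>measure lborel (cball (c x) (r x)) * g x - integral (cball (c x) (r x)) g\<bar>"
        if "x \<in> F" for x
      proof -
        have xE: "x \<in> E k" using that F C by auto
        note yx = y[OF xE] and xab = Eab[OF xE]
        show ?thesis
        proof (cases "x < y x")
          case True
          then have *: "integral (cball (c x) (r x)) g = G (y x) - G x" "measure lborel (cball (c x) (r x)) = y x - x"
            unfolding cb using yx xab incr[of x "y x"] by auto
          have "\<bar>measure lborel (cball (c x) (r x)) * g x - integral (cball (c x) (r x)) g\<bar> = \<bar>G (y x) - G x - g x * (y x - x)\<bar>"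
            unfolding * by (subst abs_minus_commute) (simp add: algebra_simps)
          then show ?thesis using yx unfolding r_def by simp
        next
          case False
          then have *: "integral (cball (c x) (r x)) g = G x - G (y x)" "measure lborel (cball (c x) (r x)) = x - y x"
            unfolding cb using yx xab incr[of "y x" x] by auto
          have "\<bar>measure lborel (cball (c x) (r x)) * g x - integral (cball (c x) (r x)) g\<bar> = \<bar>G (y x) - G x - g x * (y x - x)\<bar>"
            unfolding * by (simp add: algebra_simps)
          then show ?thesis using yx unfolding r_def by simp
        qed
      qed
      ultimately have "(\<Sum>x\<in>F. 2 * r x / real (Suc k)) < e'"
        using sum_mono[of F "\<lambda>x. 2 * r x / real (Suc k)"] by (smt (verit))
      then have "(\<Sum>x\<in>F. 2 * r x) < e' * real (Suc k)"
        by (simp add: sum_divide_distrib[symmetric] pos_divide_less_eq)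
      moreover have "e' * real (Suc k) = e / 5" unfolding e'_def by (simp add: field_simps del: of_nat_Suc)
      moreover have "(\<Sum>x\<in>F. 10 * r x) = 5 * (\<Sum>x\<in>F. 2 * r x)" by (simp add: sum_distrib_left)
      ultimately show ?thesis by linarith
    qed
    have bd: "measure lebesgue (\<Union>i\<in>F. cball (c i) (5 * r i)) \<le> e" if F: "F \<subseteq> C" "finite F" for F
    proof -
      have "measure lebesgue (\<Union>i\<in>F. cball (c i) (5 * r i)) \<le> (\<Sum>i\<in>F. measure lebesgue (cball (c i) (5 * r i)))"
        using F by (intro measure_UNION_le) auto
      also have "\<dots> = (\<Sum>x\<in>F. 10 * r x)"
      proof (intro sum.cong refl)
        fix x assume "x \<in> F"
        then have "r x > 0" using F C r by blast
        then show "measure lebesgue (cball (c x) (5 * r x)) = 10 * r x"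
          unfolding cball_eq_atLeastAtMost by simp
      qed
      finally show ?thesis using fin[OF F] by simp
    qed
    show "\<exists>T. E k \<subseteq> T \<and> T \<in> lmeasurable \<and> measure lebesgue T \<le> e"
      using cov
      by (intro exI[of _ "\<Union>i\<in>C. cball (c i) (5 * r i)"] conjI) (auto intro!: fmeasurable_UN_bound[OF C(1) _ bd] measure_UN_bound[OF C(1) _ bd])
  qed
  have "negligible (\<Union>k. E k)" using neg by (intro negligible_countable_Union) auto
  moreover have "{x\<in>{a..b}. \<not> (G has_vector_derivative g x) (at x within {a..b})} \<subseteq> (\<Union>k. E k)"
  proof (rule subsetI, rule ccontr)
    fix x assume "x \<in> {x\<in>{a..b}. \<not> (G has_vector_derivative g x) (at x within {a..b})}" and xE: "x \<notin> (\<Union>k. E k)"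
    then have xab: "x \<in> {a..b}" and nd: "\<not> (G has_vector_derivative g x) (at x within {a..b})" by auto
    have "(G has_vector_derivative g x) (at x within {a..b})"
      unfolding has_vector_derivative_def has_derivative_within_alt
    proof (intro conjI allI impI)
      show "bounded_linear (\<lambda>h. h *\<^sub>R g x)" by (rule bounded_linear_scaleR_left)
      fix e :: real assume "e > 0"
      then obtain k where k: "1 / real (Suc k) < e" using nat_approx_posE by blast
      have "x \<notin> E k" using xE by auto
      then obtain d where d: "d > 0" "\<And>z. z \<in> {a..b} \<Longrightarrow> z \<noteq> x \<Longrightarrow> \<bar>z - x\<bar> < d \<Longrightarrow> \<bar>G z - G x - g x * (z - x)\<bar> \<le> \<bar>z - x\<bar> / real (Suc k)"
        using xab unfolding E_def by (fastforce simp: not_less)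
      show "\<exists>d>0. \<forall>z\<in>{a..b}. norm (z - x) < d \<longrightarrow> norm (G z - G x - (z - x) *\<^sub>R g x) \<le> e * norm (z - x)"
      proof (intro exI[of _ d] conjI ballI impI)
        fix z assume z: "z \<in> {a..b}" "norm (z - x) < d"
        have "\<bar>z - x\<bar> * (1 / real (Suc k)) \<le> \<bar>z - x\<bar> * e" using k by (intro mult_left_mono) auto
        then show "norm (G z - G x - (z - x) *\<^sub>R g x) \<le> e * norm (z - x)"
          using d(2)[OF z(1)] z(2) by (cases "z = x") (auto simp: mult.commute)
      qed fact
    qed
    then show False using nd by simp
  qed
  ultimately show ?thesis unfolding G_def by (rule negligible_subset)
qed

text \<open>Induction removes the interval with the largest left end point; the others lie in
  \<open>[a, fst p]\<close>, hence the generalisation over \<open>b\<close>.\<close>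

lemma nonoverlapping_increments_mono:
  fixes H :: "real \<Rightarrow> real"
  assumes "nonoverlapping a b P" "a \<le> b" and mono: "\<And>x y. a \<le> x \<Longrightarrow> x \<le> y \<Longrightarrow> y \<le> b \<Longrightarrow> H x \<le> H y"
  shows "(\<Sum>p\<in>P. H (snd p) - H (fst p)) \<le> H b - H a"
proof -
  have "finite P" using assms by (simp add: nonoverlapping_def)
  then show ?thesis using assms
  proof (induction "card P" arbitrary: P b)
    case 0
    then show ?case by simp
  next
    case (Suc n)
    then have ne: "P \<noteq> {}" by auto
    obtain p where p: "p \<in> P" "fst p = Max (fst ` P)"
      using Max_in[of "fst ` P"] Suc.prems(1) ne by (metis (no_types, lifting) finite_imageI image_iff image_is_empty)
    have mx: "fst q \<le> fst p" if "q \<in> P" for q using p that Suc.prems(1) by simp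
    have pr: "a \<le> fst q \<and> fst q < snd q \<and> snd q \<le> b" if "q \<in> P" for q
      using Suc.prems(2) that by (auto simp: nonoverlapping_def)
    have "snd q \<le> fst p" if "q \<in> P" "q \<noteq> p" for q
    proof -
      have "snd q \<le> fst p \<or> snd p \<le> fst q" using Suc.prems(2) that p unfolding nonoverlapping_def by blast
      then show ?thesis using mx[OF that(1)] pr[OF p(1)] by linarith
    qed
    then have no: "nonoverlapping a (fst p) (P - {p})"
      using Suc.prems(2) unfolding nonoverlapping_def by auto
    have "card (P - {p}) = n" using Suc p by simp
    then have "(\<Sum>q\<in>P - {p}. H (snd q) - H (fst q)) \<le> H (fst p) - H a"
      using Suc.prems pr[OF p(1)] by (intro Suc.hyps(1)[OF _ _ no]) auto
    moreover have "H (snd p) \<le> H b" using pr[OF p(1)] by (intro Suc.prems(4)) auto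
    moreover have "(\<Sum>q\<in>P. H (snd q) - H (fst q)) = H (snd p) - H (fst p) + (\<Sum>q\<in>P - {p}. H (snd q) - H (fst q))"
      using Suc.prems(1) p(1) by (rule sum.remove)
    ultimately show ?case by linarith
  qed
qed

lemma absolutely_continuous_on_imp_continuous_on:
  assumes "absolutely_continuous_on {a..b} f"
  shows "continuous_on {a..b} f"
  unfolding continuous_on_iff
proof (intro ballI allI impI)
  fix x e :: real assume x: "x \<in> {a..b}" and "e > 0"
  then obtain d where "d > 0" and d: "\<And>P. nonoverlapping a b P \<Longrightarrow> (\<Sum>p\<in>P. snd p - fst p) < d \<Longrightarrow> increments f P < e"
    using assms unfolding absolutely_continuous_on_nonoverlapping by meson
  show "\<exists>d>0. \<forall>x'\<in>{a..b}. dist x' x < d \<longrightarrow> dist (f x') (f x) < e"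
  proof (intro exI[of _ d] conjI ballI impI)
    fix y assume y: "y \<in> {a..b}" "dist y x < d"
    consider "y = x" | "x < y" | "y < x" by linarith
    then show "dist (f y) (f x) < e"
    proof cases
      case 2
      then have "increments f {(x,y)} < e" using x y by (intro d) (auto simp: nonoverlapping_def dist_real_def)
      then show ?thesis by (simp add: increments_def dist_real_def)
    next
      case 3
      then have "increments f {(y,x)} < e" using x y by (intro d) (auto simp: nonoverlapping_def dist_real_def)
      then show ?thesis by (simp add: increments_def dist_real_def abs_minus_commute)
    qed (use \<open>e > 0\<close> in simp)
  qed fact
qed

text \<open>The Stieltjes measure of \<open>F\<close> charges no Lebesgue null subset of [a, b], so
  it has a Radon-Nikodym density there. A null set is enclosed in an open set of small measure,
  whose intersection with [a, b] is exhausted by finite unions of intervals, and to these the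
  definition of absolute continuity applies.\<close>

lemma absolutely_continuous_mono_density:
  assumes ac: "absolutely_continuous_on {a..b} F" and ab: "a \<le> b"
    and mono: "\<And>x y. a \<le> x \<Longrightarrow> x \<le> y \<Longrightarrow> y \<le> b \<Longrightarrow> F x \<le> F y"
  shows "\<exists>g. g absolutely_integrable_on {a..b} \<and> (\<forall>x\<in>{a..b}. (g has_integral (F x - F a)) {a..x})"
proof -
  \<comment> \<open>Constant continuation makes \<open>F\<close> monotone and continuous on the
    whole line, as \<open>interval_measure\<close> requires.\<close>
  define F' where "F' = (\<lambda>x. F (max a (min b x)))"
  have mono': "F' x \<le> F' y" if "x \<le> y" for x y
    unfolding F'_def using ab that by (intro mono) auto
  have cont': "continuous_on UNIV F'"
    unfolding F'_def
    by (rule continuous_on_compose2[OF absolutely_continuous_on_imp_continuous_on[OF ac]])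
       (use ab in \<open>auto intro!: continuous_intros\<close>)
  define \<mu> where "\<mu> = interval_measure F'"
  have Icc: "emeasure \<mu> {u..v} = ennreal (F v - F u)" if "a \<le> u" "u \<le> v" "v \<le> b" for u v
    using emeasure_interval_measure_Icc[OF that(2) mono' cont'] that
    by (simp add: \<mu>_def F'_def)
  have sets_\<mu>[simp, measurable_cong]: "sets \<mu> = sets borel" by (simp add: \<mu>_def)
  have small: "\<exists>d>0. \<forall>\<F>. finite \<F> \<longrightarrow> (\<forall>s\<in>\<F>. \<exists>u v. s = cbox u v) \<longrightarrow> \<Union>\<F> \<subseteq> {a..b} \<longrightarrow>
      emeasure lborel (\<Union>\<F>) < ennreal d \<longrightarrow> emeasure \<mu> (\<Union>\<F>) \<le> ennreal e" if "e > 0" for e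
  proof -
    from ac[unfolded absolutely_continuous_on_def, rule_format, OF that]
    obtain d where "d > 0" and d: "\<And>D. D division_of \<Union>D \<Longrightarrow> \<Union>D \<subseteq> {a..b} \<Longrightarrow>
        (\<Sum>k\<in>D. Sup k - Inf k) < d \<Longrightarrow> (\<Sum>k\<in>D. \<bar>F (Sup k) - F (Inf k)\<bar>) < e" by blast
    show ?thesis
    proof (intro exI[of _ d] conjI allI impI)
      fix \<F> :: "real set set" assume \<F>: "finite \<F>" "\<forall>s\<in>\<F>. \<exists>u v. s = cbox u v" "\<Union>\<F> \<subseteq> {a..b}" "emeasure lborel (\<Union>\<F>) < ennreal d"
      \<comment> \<open>The boxes may overlap; they are replaced by a division of the same
        union.\<close>
      obtain D where D0: "D division_of (\<Union>\<F>)" using elementary_unions_intervals[OF \<F>(1)] \<F>(2) by metis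
      then have U: "\<Union>D = \<Union>\<F>" using division_ofD(6) by blast
      then have D: "D division_of \<Union>D" using D0 by simp
      have K: "\<exists>u v. k = {u..v} \<and> u \<le> v \<and> Inf k = u \<and> Sup k = v \<and> a \<le> u \<and> v \<le> b" if k: "k \<in> D" for k
      proof -
        obtain u v where uv: "k = cbox u v" "k \<noteq> {}" using division_ofD(3,4)[OF D k] by blast
        then have "u \<le> v" by auto
        moreover have "k \<subseteq> {a..b}" using U \<F> k by auto
        ultimately show ?thesis using uv by (auto intro!: exI[of _ u] exI[of _ v])
      qed
      have finD: "finite D" using D by auto
      have int: "interior k = {Inf k<..<Sup k}" if "k \<in> D" for k
      proof -
        from K[OF that] obtain u v where "k = {u..v}" "Inf k = u" "Sup k = v" by blast
        then show ?thesis by (metis interior_atLeastAtMost_real)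
      qed
      have "disjoint_family_on (\<lambda>k. {Inf k<..<Sup k}) D"
        unfolding disjoint_family_on_def using division_ofD(5)[OF D] int by auto
      then have "(\<Sum>k\<in>D. emeasure lborel {Inf k<..<Sup k}) = emeasure lborel (\<Union>k\<in>D. {Inf k<..<Sup k})"
        using finD by (intro sum_emeasure) auto
      also have "\<dots> \<le> emeasure lborel (\<Union>D)"
      proof (rule emeasure_mono)
        show "(\<Union>k\<in>D. {Inf k<..<Sup k}) \<subseteq> \<Union>D" using int interior_subset by blast
        have "k \<in> sets lborel" if "k \<in> D" for k using K[OF that] by (metis borel_closed closed_real_atLeastAtMost sets_lborel)
        then show "\<Union>D \<in> sets lborel" using finD by (intro sets.finite_Union) auto
      qed
      also have "\<dots> < ennreal d" using U \<F> by simp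
      also have "(\<Sum>k\<in>D. emeasure lborel {Inf k<..<Sup k}) = (\<Sum>k\<in>D. ennreal (Sup k - Inf k))"
        using K by (intro sum.cong) force+
      also have "\<dots> = ennreal (\<Sum>k\<in>D. Sup k - Inf k)"
        using K by (intro sum_ennreal) force
      finally have "(\<Sum>k\<in>D. Sup k - Inf k) < d"
        using \<open>d > 0\<close> K by (subst (asm) ennreal_less_iff) (force intro!: sum_nonneg)+
      then have lt: "(\<Sum>k\<in>D. \<bar>F (Sup k) - F (Inf k)\<bar>) < e" using d[OF D] U \<F> by simp
      have "emeasure \<mu> (\<Union>D) = emeasure \<mu> (\<Union>k\<in>D. k)" by simp
      also have "\<dots> \<le> (\<Sum>k\<in>D. emeasure \<mu> k)"
        using finD K by (intro emeasure_subadditive_finite) (auto, metis borel_closed closed_real_atLeastAtMost)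
      also have "\<dots> = (\<Sum>k\<in>D. ennreal \<bar>F (Sup k) - F (Inf k)\<bar>)"
      proof (intro sum.cong refl)
        fix k assume "k \<in> D"
        from K[OF this] obtain u v where "k = {u..v}" "u \<le> v" "Inf k = u" "Sup k = v" "a \<le> u" "v \<le> b" by blast
        then show "emeasure \<mu> k = ennreal \<bar>F (Sup k) - F (Inf k)\<bar>"
          using Icc[of u v] mono[of u v] by simp
      qed
      also have "\<dots> = ennreal (\<Sum>k\<in>D. \<bar>F (Sup k) - F (Inf k)\<bar>)" by (intro sum_ennreal) auto
      also have "\<dots> \<le> ennreal e" using lt by (intro ennreal_leI) simp
      finally show "emeasure \<mu> (\<Union>\<F>) \<le> ennreal e" using U by simp
    qed fact
  qed
  have null: "emeasure \<mu> (N \<inter> {a..b}) = 0" if N: "N \<in> null_sets lborel" for N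
  proof -
    have "emeasure \<mu> (N \<inter> {a..b}) \<le> ennreal e" if "e > 0" for e
    proof -
      obtain d where "d > 0" and d: "\<And>\<F>. finite \<F> \<Longrightarrow> (\<forall>s\<in>\<F>. \<exists>u v. s = cbox u v) \<Longrightarrow> \<Union>\<F> \<subseteq> {a..b} \<Longrightarrow>
        emeasure lborel (\<Union>\<F>) < ennreal d \<Longrightarrow> emeasure \<mu> (\<Union>\<F>) \<le> ennreal e"
        using small[OF \<open>e > 0\<close>] by meson
      have Nb: "N \<in> sets borel" using N by auto
      obtain U where U: "open U" "N \<subseteq> U" "emeasure lborel (U - N) < ennreal d"
        using outer_regular_lborel[OF Nb \<open>d > 0\<close>] by blast
      have "emeasure lborel U = emeasure lborel (U - N)"
        using N U by (intro emeasure_Diff_null_set[symmetric]) auto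
      then have Ud: "emeasure lborel U < ennreal d" using U by simp
      obtain \<D> where \<D>: "countable \<D>" "\<And>X. X \<in> \<D> \<Longrightarrow> \<exists>u v. X = cbox u v" "\<Union>\<D> = U"
        using open_countable_Union_open_cbox[OF U(1)] by metis
      \<comment> \<open>Inserting the empty set keeps the family nonempty when \<open>U\<close> is
        empty, so that it can be enumerated.\<close>
      define A where "A = (\<lambda>n. \<Union>i<n. from_nat_into (insert {} \<D>) i \<inter> {a..b})"
      have cc: "countable (insert {} \<D>)" "insert {} \<D> \<noteq> {}" using \<D> by auto
      have box: "\<exists>u v. from_nat_into (insert {} \<D>) i = cbox u v" for i
        using from_nat_into[OF cc(2), of i] \<D>(2) by (metis empty_as_interval insertE)
      have UA: "(\<Union>n. A n) = U \<inter> {a..b}"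
      proof -
        have "(\<Union>i. from_nat_into (insert {} \<D>) i) = U"
          using range_from_nat_into[OF cc(2,1)] \<D>(3) by auto
        moreover have "(\<Union>n. A n) = (\<Union>i. from_nat_into (insert {} \<D>) i) \<inter> {a..b}"
          unfolding A_def by auto
        ultimately show ?thesis by simp
      qed
      have bs: "from_nat_into (insert {} \<D>) i \<in> sets borel" for i using box[of i] by auto
      have An: "emeasure \<mu> (A n) \<le> ennreal e" for n
      proof -
        have eq: "A n = \<Union>((\<lambda>i. from_nat_into (insert {} \<D>) i \<inter> {a..b}) ` {..<n})" by (simp add: A_def)
        show ?thesis
          unfolding eq
        proof (rule d)
          show "\<forall>s\<in>(\<lambda>i. from_nat_into (insert {} \<D>) i \<inter> {a..b}) ` {..<n}. \<exists>u v. s = cbox u v"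
          proof
            fix s assume "s \<in> (\<lambda>i. from_nat_into (insert {} \<D>) i \<inter> {a..b}) ` {..<n}"
            then obtain i where "s = from_nat_into (insert {} \<D>) i \<inter> cbox a b" by auto
            moreover obtain u v where "from_nat_into (insert {} \<D>) i = cbox u v" using box[of i] by blast
            ultimately have "s = cbox u v \<inter> cbox a b" by simp
            then show "\<exists>u v. s = cbox u v" unfolding Int_interval by blast
          qed
          have "emeasure lborel (A n) \<le> emeasure lborel U"
            using UA U by (intro emeasure_mono) auto
          then show "emeasure lborel (\<Union>((\<lambda>i. from_nat_into (insert {} \<D>) i \<inter> {a..b}) ` {..<n})) < ennreal d"
            unfolding eq[symmetric] using Ud by (rule le_less_trans)
        qed auto
      qed
      have "emeasure \<mu> (N \<inter> {a..b}) \<le> emeasure \<mu> (\<Union>n. A n)"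
        unfolding UA using U by (intro emeasure_mono) auto
      also have "\<dots> = (SUP n. emeasure \<mu> (A n))"
      proof (rule SUP_emeasure_incseq[symmetric])
        show "incseq A" unfolding A_def incseq_def by (auto intro: order_less_le_trans)
        show "range A \<subseteq> sets \<mu>" unfolding A_def using bs by auto
      qed
      also have "\<dots> \<le> ennreal e" using An by (intro SUP_least)
      finally show ?thesis .
    qed
    note le = this
    have "emeasure \<mu> (N \<inter> {a..b}) \<le> 0"
    proof (rule ennreal_le_epsilon)
      fix e :: real assume "0 < e"
      from le[OF this] show "emeasure \<mu> (N \<inter> {a..b}) \<le> 0 + ennreal e" by (simp only: add_0)
    qed
    then show ?thesis by (simp only: le_zero_eq)
  qed
  \<comment> \<open>\<open>null\<close> controls the measure inside [a, b] only, hence the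
    restriction before comparing with \<open>lborel\<close>.\<close>
  define \<nu> where "\<nu> = density \<mu> (indicator {a..b})"
  have \<nu>: "emeasure \<nu> A = emeasure \<mu> (A \<inter> {a..b})" if "A \<in> sets borel" for A
    unfolding \<nu>_def using that
    by (simp add: emeasure_density indicator_inter_arith[symmetric] Int_commute)
  have "absolutely_continuous lborel \<nu>"
    unfolding absolutely_continuous_def
  proof
    fix N :: "real set" assume N: "N \<in> null_sets lborel"
    then have "N \<in> sets borel" using null_setsD2 by fastforce
    then show "N \<in> null_sets \<nu>" using null[OF N] \<nu> by (intro null_setsI) (auto simp: \<nu>_def)
  qed
  moreover have "sets \<nu> = sets lborel" by (simp add: \<nu>_def)
  ultimately obtain f where f: "f \<in> borel_measurable lborel" "density lborel f = \<nu>"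
    using sigma_finite_measure.Radon_Nikodym[OF sigma_finite_lborel] by blast
  have I: "(\<integral>\<^sup>+t. f t * indicator {a..x} t \<partial>lborel) = ennreal (F x - F a)" if "x \<in> {a..b}" for x
  proof -
    have "(\<integral>\<^sup>+t. f t * indicator {a..x} t \<partial>lborel) = emeasure \<nu> {a..x}"
      unfolding f(2)[symmetric] using f(1) by (subst emeasure_density) auto
    also have "\<dots> = emeasure \<mu> {a..x}" using that by (subst \<nu>) (auto intro!: arg_cong[where f="emeasure \<mu>"])
    also have "\<dots> = ennreal (F x - F a)" using that by (intro Icc) auto
    finally show ?thesis .
  qed
  have fin: "AE t in lborel. f t * indicator {a..b} t \<noteq> \<infinity>"
    using I[of b] ab f(1) by (intro nn_integral_PInf_AE) auto
  define g where "g = (\<lambda>t. enn2real (f t))"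
  have gi: "(g has_integral (F x - F a)) {a..x}" if x: "x \<in> {a..b}" for x
  proof -
    have m: "(\<lambda>t. g t * indicator {a..x} t) \<in> borel_measurable lborel" using f(1) by (simp add: g_def)
    have "(\<integral>\<^sup>+t. ennreal (g t * indicator {a..x} t) \<partial>lborel) = (\<integral>\<^sup>+t. f t * indicator {a..x} t \<partial>lborel)"
    proof (rule nn_integral_cong_AE, use fin in eventually_elim)
      fix t assume "f t * indicator {a..b} t \<noteq> \<infinity>"
      then show "ennreal (g t * indicator {a..x} t) = f t * indicator {a..x} t"
        using x by (auto simp: g_def indicator_def less_top)
    qed
    then have eq: "(\<integral>\<^sup>+t. ennreal (g t * indicator {a..x} t) \<partial>lborel) = ennreal (F x - F a)" using I[OF x] by simp
    have "has_bochner_integral lborel (\<lambda>t. g t * indicator {a..x} t) (F x - F a)"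
      using m eq mono[of a x] x by (intro has_bochner_integral_nn_integral) (auto simp: g_def)
    then have "((\<lambda>t. g t * indicator {a..x} t) has_integral (F x - F a)) UNIV"
      using has_integral_integral_lborel by (metis has_bochner_integral_iff)
    moreover have "(\<lambda>t. g t * indicator {a..x} t) = (\<lambda>t. if t \<in> {a..x} then g t else 0)" by (auto simp: indicator_def)
    ultimately show ?thesis using has_integral_restrict_UNIV by metis
  qed
  have "g absolutely_integrable_on {a..b}"
    using gi[of b] ab by (intro nonnegative_absolutely_integrable_1) (auto simp: g_def)
  then show ?thesis using gi by blast
qed

text \<open>Jordan decomposition: f is the difference of its variation and of
  \<open>?V x - f x\<close>, both monotone and absolutely continuous.\<close>

lemma absolutely_continuous_density:
  assumes ac: "absolutely_continuous_on {a..b} f" and ab: "a \<le> b"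
  shows "\<exists>g. g absolutely_integrable_on {a..b} \<and> (\<forall>x\<in>{a..b}. (g has_integral (f x - f a)) {a..x})"
proof -
  let ?V = "variation_upto a f"
  note V = variation_upto_props[OF ac]
  have "absolutely_continuous_on {a..b} (\<lambda>x. ?V x - f x)"
    unfolding absolutely_continuous_on_nonoverlapping
  proof (intro allI impI)
    fix e :: real assume "e > 0"
    then obtain d1 where d1: "d1 > 0" "\<And>P. nonoverlapping a b P \<Longrightarrow> (\<Sum>p\<in>P. snd p - fst p) < d1 \<Longrightarrow> increments f P < e/2"
      using ac unfolding absolutely_continuous_on_nonoverlapping by (meson half_gt_zero)
    obtain d2 where d2: "d2 > 0" "\<And>P. nonoverlapping a b P \<Longrightarrow> (\<Sum>p\<in>P. snd p - fst p) < d2 \<Longrightarrow> increments ?V P < e/2"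
      using \<open>e > 0\<close> V(2) unfolding absolutely_continuous_on_nonoverlapping by (meson half_gt_zero)
    show "\<exists>d>0. \<forall>P. nonoverlapping a b P \<longrightarrow> (\<Sum>p\<in>P. snd p - fst p) < d \<longrightarrow> increments (\<lambda>x. ?V x - f x) P < e"
    proof (intro exI[of _ "min d1 d2"] conjI allI impI)
      fix P assume P: "nonoverlapping a b P" "(\<Sum>p\<in>P. snd p - fst p) < min d1 d2"
      have "increments (\<lambda>x. ?V x - f x) P \<le> increments ?V P + increments f P"
        unfolding increments_def sum.distrib[symmetric] by (intro sum_mono) linarith
      then show "increments (\<lambda>x. ?V x - f x) P < e" using d1(2)[of P] d2(2)[of P] P by simp
    qed (use d1 d2 in auto)
  qed
  moreover have "?V x - f x \<le> ?V y - f y" if "a \<le> x" "x \<le> y" "y \<le> b" for x y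
    using V(1)[OF that] by linarith
  ultimately obtain g2 where g2: "g2 absolutely_integrable_on {a..b}"
      "\<forall>x\<in>{a..b}. (g2 has_integral (?V x - f x - (?V a - f a))) {a..x}"
    using absolutely_continuous_mono_density[OF _ ab] by blast
  have "?V x \<le> ?V y" if "a \<le> x" "x \<le> y" "y \<le> b" for x y
    using V(1)[OF that] by linarith
  then obtain g1 where g1: "g1 absolutely_integrable_on {a..b}"
      "\<forall>x\<in>{a..b}. (g1 has_integral (?V x - ?V a)) {a..x}"
    using absolutely_continuous_mono_density[OF V(2) ab] by blast
  have "((\<lambda>t. g1 t - g2 t) has_integral (f x - f a)) {a..x}" if "x \<in> {a..b}" for x
    using has_integral_diff[OF g1(2)[rule_format, OF that] g2(2)[rule_format, OF that]] by simp
  moreover have "(\<lambda>t. g1 t - g2 t) absolutely_integrable_on {a..b}"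
    using g1 g2 by (intro set_integral_diff) auto
  ultimately show ?thesis by blast
qed

text \<open>Truncation gives absolute continuity: |g| exceeds a suitable level k only by a function
  of integral below e/2, and the part up to k contributes at most k times the total length.\<close>

lemma absolutely_continuous_on_integral:
  assumes g: "g absolutely_integrable_on {a..b}" and ab: "a \<le> b"
    and f: "\<And>x. x \<in> {a..b} \<Longrightarrow> (g has_integral (f x - f a)) {a..x}"
  shows "absolutely_continuous_on {a..b} f"
    and "negligible {x\<in>{a..b}. \<not> (f has_vector_derivative g x) (at x within {a..b})}"
proof -
  have gint: "g integrable_on {a..b}" using g by (simp add: set_lebesgue_integral_eq_integral(1))
  have feq: "f x = f a + integral {a..x} g" if "x \<in> {a..b}" for x
    using f[OF that] by (simp add: integral_unique)
  have "{x\<in>{a..b}. \<not> (f has_vector_derivative g x) (at x within {a..b})} \<subseteq>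
      {x\<in>{a..b}. \<not> ((\<lambda>x. integral {a..x} g) has_vector_derivative g x) (at x within {a..b})}"
  proof -
    have "(f has_vector_derivative g x) (at x within {a..b})"
      if x: "x \<in> {a..b}" and "((\<lambda>x. integral {a..x} g) has_vector_derivative g x) (at x within {a..b})" for x
    proof -
    have "((\<lambda>x. f a + integral {a..x} g) has_vector_derivative 0 + g x) (at x within {a..b})"
      by (intro has_vector_derivative_add has_vector_derivative_const that)
    then have "(f has_vector_derivative 0 + g x) (at x within {a..b})"
      by (rule has_vector_derivative_transform[OF x, rotated]) (rule feq)
    then show ?thesis by simp
    qed
    then show ?thesis by blast
  qed
  then show "negligible {x\<in>{a..b}. \<not> (f has_vector_derivative g x) (at x within {a..b})}"
    using lebesgue_differentiation_interval[OF gint] negligible_subset by blast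
  show "absolutely_continuous_on {a..b} f"
    unfolding absolutely_continuous_on_nonoverlapping
  proof (intro allI impI)
    fix e :: real assume "e > 0"
    define tr where "tr = (\<lambda>k::nat. \<lambda>x. max (\<bar>g x\<bar> - real k) 0)"
    have absg: "(\<lambda>x. \<bar>g x\<bar>) integrable_on {a..b}"
      using g by (simp add: absolutely_integrable_on_def)
    have absgL: "(\<lambda>x. \<bar>g x\<bar>) absolutely_integrable_on {a..b}"
      using absolutely_integrable_norm[OF g] by (simp add: o_def)
    have trL: "tr k absolutely_integrable_on {a..b}" for k
      unfolding tr_def using absgL
      by (intro absolutely_integrable_max_1 set_integral_diff absolutely_integrable_on_const) auto
    have tr: "tr k integrable_on {a..b}" for k
      using trL[of k] set_lebesgue_integral_eq_integral(1) by blast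
    have "(\<lambda>k. integral {a..b} (tr k)) \<longlonglongrightarrow> integral {a..b} (\<lambda>x. 0)"
    proof (rule dominated_convergence(2)[where h="\<lambda>x. \<bar>g x\<bar>"])
      show "norm (tr k x) \<le> \<bar>g x\<bar>" for k x by (auto simp: tr_def)
      fix x
      obtain N where "\<bar>g x\<bar> \<le> real N" using real_arch_simple by blast
      then have "\<forall>k\<ge>N. tr k x = 0" by (auto simp: tr_def)
      then show "(\<lambda>k. tr k x) \<longlonglongrightarrow> 0"
        by (intro tendsto_eventually) (auto simp: eventually_sequentially)
    qed (use tr absg in auto)
    then have "\<forall>\<^sub>F k in sequentially. integral {a..b} (tr k) < e/2"
      using \<open>e > 0\<close> by (intro order_tendstoD(2)) auto
    then obtain k where k: "integral {a..b} (tr k) < e/2"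
      by (auto simp: eventually_sequentially)
    define H where "H = (\<lambda>x. integral {a..x} (tr k))"
    have trs: "tr k integrable_on {u..v}" "g integrable_on {u..v}" if "a \<le> u" "v \<le> b" for u v
      using integrable_subinterval_real[OF tr] integrable_subinterval_real[OF gint] that by auto
    have Hd: "integral {u..v} (tr k) = H v - H u" if "a \<le> u" "u \<le> v" "v \<le> b" for u v
      using Henstock_Kurzweil_Integration.integral_combine[OF that(1,2) trs(1)] that by (simp add: H_def)
    have Hmono: "H u \<le> H v" if "a \<le> u" "u \<le> v" "v \<le> b" for u v
    proof -
      have "0 \<le> integral {u..v} (tr k)" by (intro integral_nonneg trs) (use that in \<open>auto simp: tr_def\<close>)
      then show ?thesis using Hd[OF that] by simp
    qed
    have step: "\<bar>f v - f u\<bar> \<le> (H v - H u) + real k * (v - u)" if "a \<le> u" "u < v" "v \<le> b" for u v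
    proof -
      have "f v - f u = integral {u..v} g"
        using Henstock_Kurzweil_Integration.integral_combine[of a u v g] trs(2) that feq[of u] feq[of v] by auto
      also have "\<bar>\<dots>\<bar> \<le> integral {u..v} (\<lambda>x. tr k x + real k)"
      proof -
        have "norm (integral {u..v} g) \<le> integral {u..v} (\<lambda>x. tr k x + real k)"
          by (rule integral_norm_bound_integral) (use that trs in \<open>auto simp: tr_def intro!: integrable_add\<close>)
        then show ?thesis by simp
      qed
      also have "\<dots> = (H v - H u) + real k * (v - u)"
        using that trs by (subst Henstock_Kurzweil_Integration.integral_add) (auto simp: Hd)
      finally show ?thesis .
    qed
    \<comment> \<open>Makes \<open>real k * d\<close> at most \<open>e/2\<close>; the added 1 allows
      k = 0.\<close>
    define d where "d = e / (2 * (real k + 1))"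
    have "d > 0" using \<open>e > 0\<close> by (simp add: d_def)
    show "\<exists>d>0. \<forall>P. nonoverlapping a b P \<longrightarrow> (\<Sum>p\<in>P. snd p - fst p) < d \<longrightarrow> increments f P < e"
    proof (intro exI[of _ d] conjI allI impI)
      fix P assume P: "nonoverlapping a b P" "(\<Sum>p\<in>P. snd p - fst p) < d"
      have "increments f P \<le> (\<Sum>p\<in>P. (H (snd p) - H (fst p)) + real k * (snd p - fst p))"
        unfolding increments_def using P(1) by (intro sum_mono step) (auto simp: nonoverlapping_def)
      also have "\<dots> = (\<Sum>p\<in>P. H (snd p) - H (fst p)) + real k * (\<Sum>p\<in>P. snd p - fst p)"
        by (simp add: sum.distrib sum_distrib_left)
      also have "(\<Sum>p\<in>P. H (snd p) - H (fst p)) \<le> H b - H a"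
        using nonoverlapping_increments_mono[OF P(1) ab] Hmono by blast
      also have "H b - H a < e/2" using k by (simp add: H_def)
      also have "real k * (\<Sum>p\<in>P. snd p - fst p) \<le> real k * d" using P(2) by (intro mult_left_mono) auto
      also have "real k * d \<le> e/2" using \<open>e > 0\<close> by (simp add: d_def field_simps)
      finally show "increments f P < e" by simp
    qed fact
  qed
qed

text \<open>The pointwise derivative agrees with the Radon-Nikodym density off the null set
  \<open>N\<close> by Lebesgue differentiation, and integrals do not see \<open>N\<close>. The
  arbitrary value of \<open>vector_derivative\<close> where no derivative exists is therefore
  harmless.\<close>

theorem absolutely_continuous_on_FTC:
  assumes ac: "absolutely_continuous_on {a..b} f" and ab: "a < b"
  defines "f' \<equiv> \<lambda>x. vector_derivative f (at x within {a..b})"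
  shows "f' absolutely_integrable_on {a..b}"
    and "\<And>x y. a \<le> x \<Longrightarrow> x \<le> y \<Longrightarrow> y \<le> b \<Longrightarrow> (f' has_integral (f y - f x)) {x..y}"
proof -
  obtain g where g: "g absolutely_integrable_on {a..b}" "\<And>x. x \<in> {a..b} \<Longrightarrow> (g has_integral (f x - f a)) {a..x}"
    using absolutely_continuous_density[OF ac] ab by auto
  define N where "N = {x\<in>{a..b}. \<not> (f has_vector_derivative g x) (at x within {a..b})}"
  have N: "negligible N" unfolding N_def using absolutely_continuous_on_integral(2)[OF g(1) _ g(2)] ab by simp
  have eq: "f' x = g x" if "x \<in> {a..b} - N" for x
    unfolding f'_def using vector_derivative_within_cbox[OF ab, of x f "g x"] that by (simp add: N_def)
  show "f' absolutely_integrable_on {a..b}"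
    by (rule absolutely_integrable_spike[OF g(1) N eq])
  show "(f' has_integral (f y - f x)) {x..y}" if xy: "a \<le> x" "x \<le> y" "y \<le> b" for x y
  proof -
    have "g integrable_on {a..b}" using g by (simp add: set_lebesgue_integral_eq_integral(1))
    then have gi: "g integrable_on {a..y}" "g integrable_on {x..y}"
      using xy integrable_subinterval_real by force+
    have "integral {x..y} g = f y - f x"
      using Henstock_Kurzweil_Integration.integral_combine[OF xy(1,2) gi(1)] g(2)[of x] g(2)[of y] xy
      by (auto dest!: integral_unique)
    then have "(g has_integral (f y - f x)) {x..y}" using gi by (metis integrable_integral)
    then show ?thesis by (rule has_integral_spike[OF N, rotated]) (use eq xy in auto)
  qed
qed

subsection \<open>Square-integrable functions and chains of derivatives\<close>

text \<open>Measurability is a separate clause because it does not follow from that of the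
  square.\<close>

definition sq_int :: "(real \<Rightarrow> real) \<Rightarrow> bool" where
  "sq_int f \<longleftrightarrow> f \<in> borel_measurable (lebesgue_on {0..1}) \<and> integrable (lebesgue_on {0..1}) (\<lambda>x. (f x)\<^sup>2)"

lemma finite_measure_lebesgue_01: "finite_measure (lebesgue_on {0..1::real})"
  by (rule finite_measureI) (simp add: emeasure_restrict_space space_restrict_space)

lemma measure_lebesgue_01: "measure (lebesgue_on {0..1::real}) (space (lebesgue_on {0..1})) = 1"
  by (simp add: measure_restrict_space space_restrict_space)

lemma sq_int_mult:
  assumes "sq_int f" "sq_int g"
  shows "integrable (lebesgue_on {0..1}) (\<lambda>x. f x * g x)"
proof (rule Bochner_Integration.integrable_bound)
  show "integrable (lebesgue_on {0..1}) (\<lambda>x. (f x)\<^sup>2 + (g x)\<^sup>2)" using assms by (auto simp: sq_int_def)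
  show "(\<lambda>x. f x * g x) \<in> borel_measurable (lebesgue_on {0..1})" using assms by (auto simp: sq_int_def)
  show "AE x in lebesgue_on {0..1}. norm (f x * g x) \<le> norm ((f x)\<^sup>2 + (g x)\<^sup>2)"
  proof (rule AE_I2)
    fix x
    have "2 * (\<bar>f x\<bar> * \<bar>g x\<bar>) \<le> (f x)\<^sup>2 + (g x)\<^sup>2"
      using sum_squares_bound[of "\<bar>f x\<bar>" "\<bar>g x\<bar>"] by (simp add: mult.assoc)
    moreover have "0 \<le> \<bar>f x\<bar> * \<bar>g x\<bar>" by simp
    ultimately have "\<bar>f x * g x\<bar> \<le> (f x)\<^sup>2 + (g x)\<^sup>2" unfolding abs_mult by linarith
    then show "norm (f x * g x) \<le> norm ((f x)\<^sup>2 + (g x)\<^sup>2)" by simp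
  qed
qed

lemma sq_int_lin:
  assumes "sq_int f" "sq_int g"
  shows "sq_int (\<lambda>x. c * f x + d * g x)"
proof -
  have "(\<lambda>x. (c * f x + d * g x)\<^sup>2) = (\<lambda>x. c\<^sup>2 * (f x)\<^sup>2 + (2 * c * d) * (f x * g x) + d\<^sup>2 * (g x)\<^sup>2)"
    by (rule ext) (simp add: power2_eq_square algebra_simps)
  moreover have "integrable (lebesgue_on {0..1}) \<dots>"
    using assms sq_int_mult[OF assms] by (intro Bochner_Integration.integrable_add integrable_mult_right) (auto simp: sq_int_def)
  ultimately show ?thesis using assms by (auto simp: sq_int_def)
qed

lemma sq_int_bounded:
  assumes "f \<in> borel_measurable (lebesgue_on {0..1})" "\<And>x. x \<in> {0..1} \<Longrightarrow> \<bar>f x\<bar> \<le> B"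
  shows "sq_int f"
proof -
  interpret finite_measure "lebesgue_on {0..1::real}" by (rule finite_measure_lebesgue_01)
  have "(f x)\<^sup>2 \<le> B\<^sup>2" if "x \<in> {0..1}" for x
    using assms(2)[OF that] by (metis abs_ge_zero power2_abs power_mono)
  then have "AE x in lebesgue_on {0..1}. norm ((f x)\<^sup>2) \<le> B\<^sup>2" by (intro AE_I2) (simp add: space_restrict_space)
  then show ?thesis using assms(1) unfolding sq_int_def by (auto intro!: integrable_const_bound[where B="B\<^sup>2"])
qed

lemma sq_int_continuous:
  assumes "continuous_on {0..1} f" shows "sq_int f"
proof -
  have "bounded (f ` {0..1})" using assms compact_continuous_image compact_imp_bounded by blast
  then obtain B where "\<forall>x\<in>{0..1}. \<bar>f x\<bar> \<le> B" by (auto simp: bounded_iff)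
  then have "\<And>x. x \<in> {0..1} \<Longrightarrow> \<bar>f x\<bar> \<le> B" by blast
  moreover have "f \<in> borel_measurable (lebesgue_on {0..1})"
    using assms by (intro continuous_imp_measurable_on_sets_lebesgue) auto
  ultimately show ?thesis by (intro sq_int_bounded)
qed

lemma l2_norm_power2: "(l2_norm f)\<^sup>2 = (LINT x|lebesgue_on {0..1}. (f x)\<^sup>2)"
  unfolding l2_norm_def l2_inner_def power2_eq_square[of "f _"] by (rule real_sqrt_pow2) simp

lemma l2_norm_nonneg[simp]: "0 \<le> l2_norm f"
  unfolding l2_norm_def l2_inner_def by simp

lemma l2_inner_lin:
  assumes "sq_int f" "sq_int g" "sq_int u"
  shows "l2_inner (\<lambda>x. c * f x + d * g x) u = c * l2_inner f u + d * l2_inner g u"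
proof -
  have "(\<lambda>x. (c * f x + d * g x) * u x) = (\<lambda>x. c * (f x * u x) + d * (g x * u x))" by (auto simp: algebra_simps)
  then show ?thesis unfolding l2_inner_def using sq_int_mult[OF assms(1,3)] sq_int_mult[OF assms(2,3)] by simp
qed

lemma l2_inner_commute: "l2_inner f g = l2_inner g f" by (simp add: l2_inner_def mult.commute)

lemma l2_norm_lin_power2:
  assumes "sq_int f" "sq_int g"
  shows "(l2_norm (\<lambda>x. c * f x + d * g x))\<^sup>2 = c\<^sup>2 * (l2_norm f)\<^sup>2 + 2 * c * d * l2_inner f g + d\<^sup>2 * (l2_norm g)\<^sup>2"
proof -
  have "(\<lambda>x. (c * f x + d * g x)\<^sup>2) = (\<lambda>x. c\<^sup>2 * (f x)\<^sup>2 + (2 * c * d) * (f x * g x) + d\<^sup>2 * (g x)\<^sup>2)"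
    by (rule ext) (simp add: power2_eq_square algebra_simps)
  then show ?thesis
    unfolding l2_norm_power2 l2_inner_def using assms sq_int_mult[OF assms] by (simp add: sq_int_def)
qed

lemma quadratic_nonneg_discriminant:
  fixes a b c :: real
  assumes q: "\<And>t. 0 \<le> a + 2 * t * b + t\<^sup>2 * c" and c: "0 \<le> c"
  shows "b\<^sup>2 \<le> a * c"
proof (cases "c = 0")
  case True
  have "b = 0"
  proof (rule ccontr)
    assume "b \<noteq> 0"
    \<comment> \<open>The chosen t makes \<open>a + 2 * t * b\<close> equal to -1.\<close>
    then show False using q[of "- (a + 1) / (2 * b)"] True by (simp add: field_simps)
  qed
  then show ?thesis using True by simp
next
  case False
  then have "c > 0" using c by simp
  then show ?thesis using q[of "- b / c"] by (simp add: field_simps power2_eq_square)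
qed

lemma l2_Cauchy_Schwarz:
  assumes "sq_int f" "sq_int g"
  shows "\<bar>l2_inner f g\<bar> \<le> l2_norm f * l2_norm g"
proof -
  let ?A = "(l2_norm f)\<^sup>2" and ?B = "l2_inner f g" and ?C = "(l2_norm g)\<^sup>2"
  have q: "0 \<le> ?A + 2 * t * ?B + t\<^sup>2 * ?C" for t
  proof -
    have "0 \<le> (l2_norm (\<lambda>x. 1 * f x + t * g x))\<^sup>2" by simp
    then show ?thesis unfolding l2_norm_lin_power2[OF assms] by simp
  qed
  have "?B\<^sup>2 \<le> ?A * ?C" using q by (intro quadratic_nonneg_discriminant) auto
  then have "\<bar>?B\<bar>\<^sup>2 \<le> (l2_norm f * l2_norm g)\<^sup>2" by (simp add: power_mult_distrib)
  then show ?thesis by (rule power2_le_imp_le) simp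
qed

lemma l2_norm_lin:
  assumes "sq_int f" "sq_int g"
  shows "l2_norm (\<lambda>x. c * f x + d * g x) \<le> \<bar>c\<bar> * l2_norm f + \<bar>d\<bar> * l2_norm g"
proof (rule power2_le_imp_le)
  have "c * d * l2_inner f g \<le> \<bar>c\<bar> * \<bar>d\<bar> * (l2_norm f * l2_norm g)"
  proof -
    have "c * d * l2_inner f g \<le> \<bar>c * d * l2_inner f g\<bar>" by simp
    also have "\<dots> = \<bar>c\<bar> * \<bar>d\<bar> * \<bar>l2_inner f g\<bar>" by (simp add: abs_mult)
    also have "\<dots> \<le> \<bar>c\<bar> * \<bar>d\<bar> * (l2_norm f * l2_norm g)"
      using l2_Cauchy_Schwarz[OF assms] by (intro mult_left_mono) auto
    finally show ?thesis .
  qed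
  then show "(l2_norm (\<lambda>x. c * f x + d * g x))\<^sup>2 \<le> (\<bar>c\<bar> * l2_norm f + \<bar>d\<bar> * l2_norm g)\<^sup>2"
    unfolding l2_norm_lin_power2[OF assms] by (simp add: power2_sum power_mult_distrib algebra_simps)
qed simp

lemma l2_norm_scale: "l2_norm (\<lambda>x. c * f x) = \<bar>c\<bar> * l2_norm f"
proof -
  have "(\<lambda>x. c * f x * (c * f x)) = (\<lambda>x. c\<^sup>2 * (f x * f x))" by (auto simp: power2_eq_square algebra_simps)
  then show ?thesis unfolding l2_norm_def l2_inner_def by (simp add: real_sqrt_mult)
qed

lemma sq_int_integrable: assumes "sq_int f" shows "integrable (lebesgue_on {0..1}) f"
  using sq_int_mult[OF assms sq_int_continuous[of "\<lambda>_. 1"]] by simp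

lemma l1_le_l2:
  assumes "sq_int f" shows "(LINT x|lebesgue_on {0..1}. \<bar>f x\<bar>) \<le> l2_norm f"
proof -
  have a: "sq_int (\<lambda>x. \<bar>f x\<bar>)" using assms by (auto simp: sq_int_def)
  have "l2_inner (\<lambda>x. \<bar>f x\<bar>) (\<lambda>_. 1) \<le> l2_norm (\<lambda>x. \<bar>f x\<bar>) * l2_norm (\<lambda>_. 1)"
    using l2_Cauchy_Schwarz[OF a sq_int_continuous[of "\<lambda>_. 1"]] by simp
  moreover have "l2_norm (\<lambda>x. \<bar>f x\<bar>) = l2_norm f" unfolding l2_norm_def l2_inner_def by simp
  moreover have "l2_norm (\<lambda>_. 1) = 1" unfolding l2_norm_def l2_inner_def using measure_lebesgue_01 by simp
  ultimately show ?thesis by (simp add: l2_inner_def)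
qed

section \<open>Indefinite integrals on the unit interval\<close>

text \<open>The relation is integral, not pointwise: it is linear and unaffected by changing
  \<open>f'\<close> on a null set (\<open>primitive01_spike\<close>), unlike a statement about
  \<open>vector_derivative\<close>.\<close>

definition primitive01 :: "(real \<Rightarrow> real) \<Rightarrow> (real \<Rightarrow> real) \<Rightarrow> bool" where
  "primitive01 f f' \<longleftrightarrow> f' absolutely_integrable_on {0..1} \<and>
     (\<forall>x y. 0 \<le> x \<longrightarrow> x \<le> y \<longrightarrow> y \<le> 1 \<longrightarrow> (f' has_integral (f y - f x)) {x..y})"

lemma primitive01_absolutely_continuous:
  assumes "primitive01 f f'"
  shows "absolutely_continuous_on {0..1} f"
    "negligible {x\<in>{0..1}. \<not> (f has_vector_derivative f' x) (at x within {0..1})}"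
  using absolutely_continuous_on_integral[where g=f' and a=0 and b=1 and f=f] assms unfolding primitive01_def by auto

lemma primitive01_continuous: "primitive01 f f' \<Longrightarrow> continuous_on {0..1} f"
  using primitive01_absolutely_continuous(1) absolutely_continuous_on_imp_continuous_on by blast

lemma primitive01_spike:
  assumes "primitive01 f f'" "negligible N" "\<And>x. x \<in> {0..1} - N \<Longrightarrow> g x = f' x"
  shows "primitive01 f g"
  unfolding primitive01_def
proof (intro conjI allI impI)
  show "g absolutely_integrable_on {0..1}"
    by (rule absolutely_integrable_spike[where f=f' and S=N])
       (use assms in \<open>auto simp: primitive01_def\<close>)
  fix x y :: real assume "0 \<le> x" "x \<le> y" "y \<le> 1"
  then show "(g has_integral (f y - f x)) {x..y}"
    using assms(1) unfolding primitive01_def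
    by (intro has_integral_spike[OF assms(2), of "{x..y}" g f']) (auto simp: assms(3))
qed

lemma absolutely_continuous_primitive01:
  assumes "absolutely_continuous_on {0..1} f"
  shows "primitive01 f (\<lambda>x. vector_derivative f (at x within {0..1}))"
  using absolutely_continuous_on_FTC[OF assms] unfolding primitive01_def by auto

lemma primitive01_lin:
  assumes "primitive01 f f'" "primitive01 g g'"
  shows "primitive01 (\<lambda>x. c * f x + d * g x) (\<lambda>x. c * f' x + d * g' x)"
  unfolding primitive01_def
proof (intro conjI allI impI)
  show "(\<lambda>x. c * f' x + d * g' x) absolutely_integrable_on {0..1}"
    using assms unfolding primitive01_def by (intro set_integral_add set_integrable_mult_right) auto
  fix x y :: real assume "0 \<le> x" "x \<le> y" "y \<le> 1"
  then have "((\<lambda>x. c * f' x + d * g' x) has_integral (c * (f y - f x) + d * (g y - g x))) {x..y}"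
    using assms unfolding primitive01_def by (intro has_integral_add has_integral_mult_right) auto
  then show "((\<lambda>x. c * f' x + d * g' x) has_integral (c * f y + d * g y - (c * f x + d * g x))) {x..y}"
    by (simp add: algebra_simps)
qed

text \<open>Both factors are bounded, so the product inherits absolute continuity; its derivative is
  then identified off the null set where one of the factors fails to have the given
  derivative.\<close>

lemma primitive01_mult:
  assumes f: "primitive01 f f'" and g: "primitive01 g g'"
  shows "primitive01 (\<lambda>x. f x * g x) (\<lambda>x. f' x * g x + f x * g' x)"
proof -
  have bd: "\<exists>B>0. \<forall>x\<in>{0..1}. \<bar>u x\<bar> \<le> B" if "primitive01 u u'" for u u'
  proof -
    have "bounded (u ` {0..1})" using primitive01_continuous[OF that] compact_continuous_image compact_imp_bounded by blast
    then show ?thesis by (auto simp: bounded_pos)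
  qed
  obtain A where A: "A > 0" "\<And>x. x \<in> {0..1} \<Longrightarrow> \<bar>f x\<bar> \<le> A" using bd[OF f] by blast
  obtain B where B: "B > 0" "\<And>x. x \<in> {0..1} \<Longrightarrow> \<bar>g x\<bar> \<le> B" using bd[OF g] by blast
  have ac: "absolutely_continuous_on {0..1} (\<lambda>x. f x * g x)"
    unfolding absolutely_continuous_on_nonoverlapping
  proof (intro allI impI)
    fix e :: real assume "e > 0"
    then have "e / (2 * A) > 0" "e / (2 * B) > 0" using A B by auto
    obtain d1 where d1: "d1 > 0" "\<And>P. nonoverlapping 0 1 P \<Longrightarrow> (\<Sum>p\<in>P. snd p - fst p) < d1 \<Longrightarrow> increments f P < e / (2 * B)"
      using primitive01_absolutely_continuous(1)[OF f] \<open>e / (2 * B) > 0\<close> unfolding absolutely_continuous_on_nonoverlapping by meson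
    obtain d2 where d2: "d2 > 0" "\<And>P. nonoverlapping 0 1 P \<Longrightarrow> (\<Sum>p\<in>P. snd p - fst p) < d2 \<Longrightarrow> increments g P < e / (2 * A)"
      using primitive01_absolutely_continuous(1)[OF g] \<open>e / (2 * A) > 0\<close> unfolding absolutely_continuous_on_nonoverlapping by meson
    show "\<exists>d>0. \<forall>P. nonoverlapping 0 1 P \<longrightarrow> (\<Sum>p\<in>P. snd p - fst p) < d \<longrightarrow> increments (\<lambda>x. f x * g x) P < e"
    proof (intro exI[of _ "min d1 d2"] conjI allI impI)
      fix P assume P: "nonoverlapping 0 1 P" "(\<Sum>p\<in>P. snd p - fst p) < min d1 d2"
      have "increments (\<lambda>x. f x * g x) P \<le> (\<Sum>p\<in>P. A * \<bar>g (snd p) - g (fst p)\<bar> + B * \<bar>f (snd p) - f (fst p)\<bar>)"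
        unfolding increments_def
      proof (rule sum_mono)
        fix p assume "p \<in> P"
        then have p: "fst p \<in> {0..1}" "snd p \<in> {0..1}" using P(1) unfolding nonoverlapping_def by fastforce+
        have "f (snd p) * g (snd p) - f (fst p) * g (fst p)
          = f (snd p) * (g (snd p) - g (fst p)) + g (fst p) * (f (snd p) - f (fst p))"
          by (simp add: algebra_simps)
        also have "\<bar>\<dots>\<bar> \<le> \<bar>f (snd p)\<bar> * \<bar>g (snd p) - g (fst p)\<bar> + \<bar>g (fst p)\<bar> * \<bar>f (snd p) - f (fst p)\<bar>"
          by (metis abs_mult abs_triangle_ineq)
        also have "\<dots> \<le> A * \<bar>g (snd p) - g (fst p)\<bar> + B * \<bar>f (snd p) - f (fst p)\<bar>"
          using A(2)[OF p(2)] B(2)[OF p(1)] by (intro add_mono mult_right_mono) auto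
        finally show "\<bar>f (snd p) * g (snd p) - f (fst p) * g (fst p)\<bar>
          \<le> A * \<bar>g (snd p) - g (fst p)\<bar> + B * \<bar>f (snd p) - f (fst p)\<bar>" .
      qed
      also have "\<dots> = A * increments g P + B * increments f P"
        unfolding increments_def by (simp add: sum.distrib sum_distrib_left)
      also have "\<dots> < A * (e / (2 * A)) + B * (e / (2 * B))"
        using d1(2)[of P] d2(2)[of P] P A B by (intro add_strict_mono mult_strict_left_mono) auto
      also have "\<dots> = e" using A B by simp
      finally show "increments (\<lambda>x. f x * g x) P < e" .
    qed (use d1 d2 in auto)
  qed
  let ?N = "{x\<in>{0..1}. \<not> (f has_vector_derivative f' x) (at x within {0..1})} \<union> {x\<in>{0..1}. \<not> (g has_vector_derivative g' x) (at x within {0..1})}"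
  show ?thesis
  proof (rule primitive01_spike[OF absolutely_continuous_primitive01[OF ac], of ?N])
    show "negligible ?N"
      using primitive01_absolutely_continuous(2)[OF f] primitive01_absolutely_continuous(2)[OF g] by (rule negligible_Un)
    fix x assume x: "x \<in> {0..1} - ?N"
    then have "((\<lambda>x. f x * g x) has_vector_derivative f x * g' x + f' x * g x) (at x within {0..1})"
      by (intro has_vector_derivative_mult) auto
    then show "f' x * g x + f x * g' x = vector_derivative (\<lambda>x. f x * g x) (at x within {0..1})"
      using x vector_derivative_within_cbox[of 0 1 x "\<lambda>x. f x * g x"] by fastforce
  qed
qed

lemma primitive01_LINT:
  assumes "primitive01 f f'" "0 \<le> x" "x \<le> y" "y \<le> 1"
  shows "integrable (lebesgue_on {0..1}) (\<lambda>t. indicator {x..y} t * f' t)"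
    "(LINT t|lebesgue_on {0..1}. indicator {x..y} t * f' t) = f y - f x"
proof -
  have ai: "f' absolutely_integrable_on {0..1}" and hi: "(f' has_integral (f y - f x)) {x..y}"
    using assms by (auto simp: primitive01_def)
  have "f' absolutely_integrable_on {x..y}"
    using absolutely_integrable_on_subinterval[OF ai, of x y] assms by auto
  moreover have "(\<lambda>t. indicator {0..1} t *\<^sub>R (indicator {x..y} t * f' t)) = (\<lambda>t. indicator {x..y} t *\<^sub>R f' t)"
    using assms by (auto simp: indicator_def)
  ultimately have "(\<lambda>t. indicator {x..y} t * f' t) absolutely_integrable_on {0..1}" by (simp add: set_integrable_def)
  moreover have eq: "(\<lambda>t. if t \<in> {x..y} then f' t else 0) = (\<lambda>t. indicator {x..y} t * f' t)" by (auto simp: indicator_def)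
  ultimately show i: "integrable (lebesgue_on {0..1}) (\<lambda>t. indicator {x..y} t * f' t)"
    using absolutely_integrable_imp_integrable by fastforce
  have "((\<lambda>t. if t \<in> {x..y} then f' t else 0) has_integral (f y - f x)) {0..1}"
    using hi assms has_integral_restrict[of "{x..y}" "{0..1}" f' "f y - f x"] by auto
  then show "(LINT t|lebesgue_on {0..1}. indicator {x..y} t * f' t) = f y - f x"
    using lebesgue_integral_eq_integral[OF i] unfolding eq by (simp add: integral_unique)
qed

lemma LINT_01: "(LINT t|lebesgue_on {0..1}. indicator {0..1} t * (u t :: real)) = (LINT t|lebesgue_on {0..1}. u t)"
  by (intro Bochner_Integration.integral_cong refl) (auto simp: space_restrict_space)

text \<open>Integrating by parts over the window gives \<open>g t\<close> as the average of \<open>g\<close> over the window plus a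
  remainder in \<open>g'\<close>. The window lies on the side of \<open>t\<close> where it fits into \<open>[0,1]\<close> for \<open>h \<le> 1/2\<close>.\<close>

definition window :: "real \<Rightarrow> real \<Rightarrow> real set" where
  "window h t = (if t \<le> 1/2 then {t..t+h} else {t-h..t})"

definition average_kernel :: "real \<Rightarrow> real \<Rightarrow> real \<Rightarrow> real" where
  "average_kernel h t x = indicator (window h t) x / h"

definition remainder_kernel :: "real \<Rightarrow> real \<Rightarrow> real \<Rightarrow> real" where
  "remainder_kernel h t x = indicator (window h t) x * (x - (if t \<le> 1/2 then t + h else t - h)) / h"

lemma primitive01_id: "primitive01 (\<lambda>x. x) (\<lambda>_. 1)" and primitive01_const: "primitive01 (\<lambda>_. c) (\<lambda>_. 0)"
proof -
  have "((\<lambda>_. 1::real) has_integral y - x) {x..y}" if "x \<le> y" for x y :: real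
    using has_integral_const_real[of "1::real" x y] that by simp
  then show "primitive01 (\<lambda>x. x) (\<lambda>_. 1)" unfolding primitive01_def by (auto simp: absolutely_integrable_on_const)
  show "primitive01 (\<lambda>_. c) (\<lambda>_. 0)" unfolding primitive01_def by auto
qed

text \<open>The squared norms \<open>1/h\<close> and at most \<open>h\<close> fix the relative
  weights of g and g' in every later bound: on the sphere the available bound for
  \<open>l2_norm g'\<close> exceeds the one for \<open>l2_norm g\<close> by a factor of order
  \<open>1/h\<close>, which these weights compensate.\<close>

lemma kernels_sq_int:
  assumes h: "0 < h" "h \<le> 1/2" and t: "t \<in> {0..1}"
  shows "sq_int (average_kernel h t)" "sq_int (remainder_kernel h t)" "(l2_norm (average_kernel h t))\<^sup>2 = 1 / h"
    "(l2_norm (remainder_kernel h t))\<^sup>2 \<le> h"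
proof -
  have ws: "window h t \<subseteq> {0..1}" "window h t \<in> sets lebesgue" using h t by (auto simp: window_def)
  have wb[measurable]: "window h t \<in> sets borel" by (auto simp: window_def)
  have wm: "(indicator (window h t) :: real \<Rightarrow> real) \<in> borel_measurable (lebesgue_on {0..1})"
    using ws by (intro borel_measurable_indicator) (auto simp: sets_restrict_space_iff)
  have K1: "\<bar>remainder_kernel h t x\<bar> \<le> indicator (window h t) x" for x
    using h by (auto simp: remainder_kernel_def window_def indicator_def field_simps abs_if)
  show A: "sq_int (average_kernel h t)"
  proof (rule sq_int_bounded[where B="1/h"])
    have "(\<lambda>x. indicator (window h t) x / h) \<in> borel_measurable (lebesgue_on {0..1})" using wm by measurable
    then show "average_kernel h t \<in> borel_measurable (lebesgue_on {0..1})" by (simp add: average_kernel_def[abs_def])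
    show "\<bar>average_kernel h t x\<bar> \<le> 1 / h" for x using h by (auto simp: average_kernel_def indicator_def)
  qed
  show K: "sq_int (remainder_kernel h t)"
  proof (rule sq_int_bounded[where B=1])
    have "(\<lambda>x::real. x) \<in> borel_measurable (lebesgue_on {0..1})" by (intro continuous_imp_measurable_on_sets_lebesgue) auto
    then show "remainder_kernel h t \<in> borel_measurable (lebesgue_on {0..1})" using wm unfolding remainder_kernel_def by measurable
    show "\<bar>remainder_kernel h t x\<bar> \<le> 1" for x using K1[of x] indicator_le_1[of "window h t" x] by (rule order_trans)
  qed
  have mw: "measure (lebesgue_on {0..1}) (window h t) = h"
    using ws h by (subst measure_restrict_space) (auto simp: window_def)
  have Iw: "integrable (lebesgue_on {0..1}) (indicator (window h t) :: real \<Rightarrow> real)"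
    using sq_int_integrable[OF sq_int_bounded[OF wm, of 1]] by (auto simp: indicator_le_1)
  have Lw: "(LINT x|lebesgue_on {0..1}. indicator (window h t) x) = h"
  proof -
    have "window h t \<inter> space (lebesgue_on {0..1}) = window h t" using ws by (auto simp: space_restrict_space)
    then show ?thesis using mw by simp
  qed
  have "(\<lambda>x. (average_kernel h t x)\<^sup>2) = (\<lambda>x. indicator (window h t) x / h\<^sup>2)"
    by (auto simp: average_kernel_def indicator_def power2_eq_square)
  then show "(l2_norm (average_kernel h t))\<^sup>2 = 1 / h"
    unfolding l2_norm_power2 using Lw h by (simp add: power2_eq_square)
  have "(l2_norm (remainder_kernel h t))\<^sup>2 \<le> (LINT x|lebesgue_on {0..1}. indicator (window h t) x)"
    unfolding l2_norm_power2
  proof (rule integral_mono)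
    show "(remainder_kernel h t x)\<^sup>2 \<le> indicator (window h t) x" for x
      using K1[of x] by (auto simp: indicator_def abs_square_le_1 split: if_splits)
  qed (use K Iw in \<open>auto simp: sq_int_def\<close>)
  then show "(l2_norm (remainder_kernel h t))\<^sup>2 \<le> h" using Lw by simp
qed

text \<open>The linear weight \<open>(x - c) / h\<close> vanishes at the end of the window away from
  t and is plus or minus 1 at t, so that the boundary terms of the integration by parts amount to
  \<open>g t\<close>.\<close>

lemma kernel_representation:
  assumes g: "primitive01 g g'" and sq: "sq_int g'" and h: "0 < h" "h \<le> 1/2" and t: "t \<in> {0..1}"
  shows "g t = l2_inner (average_kernel h t) g + l2_inner (remainder_kernel h t) g'"
proof -
  define c where "c = (if t \<le> 1/2 then t + h else t - h)"
  define u where "u = (if t \<le> 1/2 then t else t - h)"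
  have w: "window h t = {u..u+h}" by (auto simp: window_def u_def)
  have u: "0 \<le> u" "u \<le> u + h" "u + h \<le> 1" using h t by (auto simp: u_def)
  have p1: "primitive01 (\<lambda>x. (x - c) / h) (\<lambda>x. 1 / h)"
    using primitive01_lin[OF primitive01_id primitive01_const[of 1], of "1/h" "- c/h"] by (simp add: diff_divide_distrib)
  have "primitive01 (\<lambda>x. (x - c) / h * g x) (\<lambda>x. 1 / h * g x + (x - c) / h * g' x)"
    by (rule primitive01_mult[OF p1 g])
  note L = primitive01_LINT[OF this u]
  have "(LINT x|lebesgue_on {0..1}. average_kernel h t x * g x + remainder_kernel h t x * g' x)
    = (u + h - c) / h * g (u + h) - (u - c) / h * g u"
    unfolding L(2)[symmetric]
    by (intro Bochner_Integration.integral_cong refl) (auto simp: average_kernel_def remainder_kernel_def w c_def indicator_def)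
  also have "\<dots> = g t" using h by (auto simp: u_def c_def)
  finally show ?thesis
    unfolding l2_inner_def
    using sq_int_mult[OF kernels_sq_int(1)[OF h t] sq_int_continuous[OF primitive01_continuous[OF g]]]
      sq_int_mult[OF kernels_sq_int(2)[OF h t] sq] by simp
qed

text \<open>Cauchy-Schwarz for both kernels. The width h is free: h/64 serves to gain a small factor
  in the interpolation inequality, and the smoothing scale is used on the sphere.\<close>

lemma primitive01_sup_bound:
  assumes g: "primitive01 g g'" and sq: "sq_int g'" and h: "0 < h" "h \<le> 1/2" and t: "t \<in> {0..1}"
  shows "\<bar>g t\<bar> \<le> l2_norm g / sqrt h + sqrt h * l2_norm g'"
proof -
  have "l2_norm (average_kernel h t) = sqrt (1 / h)" "l2_norm (remainder_kernel h t) \<le> sqrt h"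
    using kernels_sq_int(3,4)[OF h t] by (metis l2_norm_nonneg real_sqrt_unique, metis real_le_rsqrt)
  then have "\<bar>l2_inner (average_kernel h t) g\<bar> \<le> sqrt (1 / h) * l2_norm g"
    "\<bar>l2_inner (remainder_kernel h t) g'\<bar> \<le> sqrt h * l2_norm g'"
    using l2_Cauchy_Schwarz[OF kernels_sq_int(1)[OF h t] sq_int_continuous[OF primitive01_continuous[OF g]]]
      l2_Cauchy_Schwarz[OF kernels_sq_int(2)[OF h t] sq]
    by (auto intro: order_trans[OF _ mult_right_mono])
  then show ?thesis unfolding kernel_representation[OF assms] by (simp add: real_sqrt_divide)
qed

section \<open>Interpolation inequalities between derivatives\<close>

text \<open>Integration by parts bounds the squared norm of f1 by boundary terms and
  \<open>l2_norm f * l2_norm f2\<close>. The boundary terms are estimated by the sup bound, with f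
  at width h/64 and f1 at width h; the resulting quadratic inequality in
  \<open>h * l2_norm f1\<close> closes because f1 enters the bound for f with factor 1/8
  only.\<close>

lemma interpolation_second_order:
  assumes f: "primitive01 f f1" and f1: "primitive01 f1 f2" and sq: "sq_int f2" and h: "0 < h" "h \<le> 1/2"
  shows "h * l2_norm f1 \<le> 40 * (l2_norm f + h\<^sup>2 * l2_norm f2)"
proof -
  have sqf: "sq_int f" "sq_int f1" using f f1 primitive01_continuous sq_int_continuous by blast+
  have "primitive01 (\<lambda>x. f x * f1 x) (\<lambda>x. f1 x * f1 x + f x * f2 x)" by (rule primitive01_mult[OF f f1])
  from primitive01_LINT(2)[OF this, of 0 1]
  have "(LINT x|lebesgue_on {0..1}. f1 x * f1 x + f x * f2 x) = f 1 * f1 1 - f 0 * f1 0"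
    unfolding LINT_01 by simp
  then have ibp: "(l2_norm f1)\<^sup>2 = f 1 * f1 1 - f 0 * f1 0 - l2_inner f f2"
    unfolding l2_norm_power2 l2_inner_def power2_eq_square[of "f1 _"]
    using sq_int_mult[OF sqf(2,2)] sq_int_mult[OF sqf(1) sq] by simp
  define S0 where "S0 = l2_norm f / sqrt (h/64) + sqrt (h/64) * l2_norm f1"
  define S1 where "S1 = l2_norm f1 / sqrt h + sqrt h * l2_norm f2"
  have b: "\<bar>f t\<bar> \<le> S0" "\<bar>f1 t\<bar> \<le> S1" if "t \<in> {0..1}" for t
    unfolding S0_def S1_def using h sqf sq f f1 that by (auto intro!: primitive01_sup_bound)
  have bb: "\<bar>f t * f1 t\<bar> \<le> S0 * S1" if "t \<in> {0..1}" for t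
    unfolding abs_mult using b[OF that] by (intro mult_mono) auto
  define a0 a1 a2 where "a0 = l2_norm f" and "a1 = h * l2_norm f1" and "a2 = h\<^sup>2 * l2_norm f2"
  have nn: "a0 \<ge> 0" "a1 \<ge> 0" "a2 \<ge> 0" using h by (auto simp: a0_def a1_def a2_def)
  have s: "sqrt (h/64) = sqrt h / 8" by (simp add: real_sqrt_divide)
  have e0: "sqrt h * S0 = 8 * a0 + a1 / 8"
    using h unfolding S0_def s a0_def a1_def by (simp add: field_simps)
  have e1: "h * sqrt h * S1 = a1 + a2"
    using h unfolding S1_def a1_def a2_def by (simp add: field_simps power2_eq_square)
  have "(l2_norm f1)\<^sup>2 \<le> 2 * (S0 * S1) + l2_norm f * l2_norm f2"
    using ibp bb[of 0] bb[of 1] l2_Cauchy_Schwarz[OF sqf(1) sq] by auto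
  then have "h\<^sup>2 * (l2_norm f1)\<^sup>2 \<le> h\<^sup>2 * (2 * (S0 * S1) + l2_norm f * l2_norm f2)"
    by (intro mult_left_mono) auto
  also have "\<dots> = 2 * ((sqrt h * S0) * (h * sqrt h * S1)) + a0 * a2"
    using h by (simp add: a0_def a2_def power2_eq_square algebra_simps)
  finally have main: "a1 * a1 \<le> 2 * ((8 * a0 + a1 / 8) * (a1 + a2)) + a0 * a2"
    unfolding e0 e1 by (simp add: a1_def power2_eq_square algebra_simps)
  have "a1 \<le> 40 * (a0 + a2)"
  proof (rule ccontr)
    assume "\<not> a1 \<le> 40 * (a0 + a2)"
    then have lt: "40 * a0 + 40 * a2 < a1" by simp
    then have p: "a1 > 0" using nn by linarith
    \<comment> \<open>If the claim failed, \<open>a0\<close> and \<open>a2\<close> would both be at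
      most \<open>a1 / 40\<close>, and the right side of \<open>main\<close> at most 1067/1600 of
      \<open>a1 * a1\<close>.\<close>
    have "(8 * a0 + a1 / 8) * (a1 + a2) \<le> (a1 * (8/40) + a1 / 8) * (a1 + a1 / 40)"
      using lt nn by (intro mult_mono) auto
    moreover have "a0 * a2 \<le> (a1 / 40) * (a1 / 40)" using lt nn by (intro mult_mono) auto
    moreover have "0 < a1 * a1" using p by simp
    moreover have "(a1 * (8/40) + a1 / 8) * (a1 + a1 / 40) = (533/1600) * (a1 * a1)" "(a1 / 40) * (a1 / 40) = (a1 * a1) / 1600"
      by (simp_all add: algebra_simps)
    ultimately show False using main by linarith
  qed
  then show ?thesis by (simp add: a0_def a1_def a2_def)
qed

text \<open>A function is represented by the sequence of its derivatives, so that changes of the highest one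
  on a null set are harmless; values beyond index \<open>m\<close> are irrelevant.\<close>

definition sob_chain :: "nat \<Rightarrow> (nat \<Rightarrow> real \<Rightarrow> real) \<Rightarrow> bool" where
  "sob_chain m F \<longleftrightarrow> (\<forall>k<m. primitive01 (F k) (F (Suc k))) \<and> sq_int (F m)"

lemma sob_chain_primitive: "sob_chain m F \<Longrightarrow> k < m \<Longrightarrow> primitive01 (F k) (F (Suc k))"
  by (simp add: sob_chain_def)

lemma sob_chain_continuous: "sob_chain m F \<Longrightarrow> k < m \<Longrightarrow> continuous_on {0..1} (F k)"
  using sob_chain_primitive primitive01_continuous by blast

lemma sob_chain_sq_int: "sob_chain m F \<Longrightarrow> k \<le> m \<Longrightarrow> sq_int (F k)"
  using sob_chain_continuous sq_int_continuous by (cases "k = m") (auto simp: sob_chain_def)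

lemma sob_chain_lin:
  assumes "sob_chain m F" "sob_chain m G"
  shows "sob_chain m (\<lambda>k x. c * F k x + d * G k x)"
  using assms unfolding sob_chain_def by (auto intro!: primitive01_lin sq_int_lin)

lemma sob_chain_le: "sob_chain m F \<Longrightarrow> k \<le> m \<Longrightarrow> sob_chain k F"
  using sob_chain_sq_int unfolding sob_chain_def by auto

text \<open>Induction on m. The second-order inequality bounds \<open>F m\<close> by its neighbours
  \<open>F p\<close> and \<open>F (Suc m)\<close>; the induction hypothesis for \<open>F p\<close>
  is used at the smaller scale \<open>\<eta> * h\<close>, which brings \<open>F m\<close> back with
  a coefficient small enough to be absorbed on the left.\<close>

lemma interpolation_general:
  "\<exists>C>0. \<forall>F h j. sob_chain m F \<longrightarrow> 0 < h \<longrightarrow> h \<le> 1/2 \<longrightarrow> j \<le> m \<longrightarrow>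
     h ^ j * l2_norm (F j) \<le> C * (l2_norm (F 0) + h ^ m * l2_norm (F m))"
proof (induction m)
  case 0
  show ?case by (intro exI[of _ 1]) auto
next
  case (Suc m)
  show ?case
  proof (cases m)
    case 0
    show ?thesis
    proof (intro exI[of _ "1::real"] conjI allI impI)
      fix F h j assume "(0::real) < h" "j \<le> Suc m"
      then show "h ^ j * l2_norm (F j) \<le> 1 * (l2_norm (F 0) + h ^ Suc m * l2_norm (F (Suc m)))"
        using 0 by (cases j) auto
    qed simp
  next
    case (Suc p)
    obtain C where "C > 0" and C: "\<And>F h j. sob_chain m F \<Longrightarrow> 0 < h \<Longrightarrow> h \<le> 1/2 \<Longrightarrow> j \<le> m \<Longrightarrow>
     h ^ j * l2_norm (F j) \<le> C * (l2_norm (F 0) + h ^ m * l2_norm (F m))"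
      using Suc.IH by metis
    \<comment> \<open>The induction hypothesis returns \<open>F m\<close> with factor \<eta> after
      division by \<open>\<eta> ^ p\<close>; the choice makes the total coefficient
      \<open>40 * C * \<eta>\<close> at most 1/2.\<close>
    define \<eta> where "\<eta> = 1 / (80 * C + 1)"
    have \<eta>: "0 < \<eta>" "\<eta> \<le> 1" "40 * C * \<eta> \<le> 1/2" using \<open>C > 0\<close> by (auto simp: \<eta>_def field_simps)
    define D where "D = 80 * (C / \<eta> ^ p + 1)"
    have "D > 0" using \<open>C > 0\<close> \<eta> by (auto simp: D_def intro!: add_pos_pos)
    have top: "h ^ m * l2_norm (F m) \<le> D * (l2_norm (F 0) + h ^ Suc m * l2_norm (F (Suc m)))"
      if F: "sob_chain (Suc m) F" and h: "0 < h" "h \<le> 1/2" for F h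
    proof -
      have ch: "sob_chain m F" using sob_chain_le[OF F] by simp
      have "h * l2_norm (F m) \<le> 40 * (l2_norm (F p) + h\<^sup>2 * l2_norm (F (Suc m)))"
        using interpolation_second_order[OF _ _ _ h, of "F p" "F m" "F (Suc m)"]
          sob_chain_primitive[OF F, of p] sob_chain_primitive[OF F, of m] F Suc by (simp add: sob_chain_def)
      then have "h ^ p * (h * l2_norm (F m)) \<le> h ^ p * (40 * (l2_norm (F p) + h\<^sup>2 * l2_norm (F (Suc m))))"
        using h by (intro mult_left_mono) auto
      then have 1: "h ^ m * l2_norm (F m) \<le> 40 * (h ^ p * l2_norm (F p)) + 40 * (h ^ Suc m * l2_norm (F (Suc m)))"
        using Suc by (simp add: algebra_simps power2_eq_square)
      have "(\<eta> * h) ^ p * l2_norm (F p) \<le> C * (l2_norm (F 0) + (\<eta> * h) ^ m * l2_norm (F m))"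
        using C[OF ch, of "\<eta> * h" p] \<eta> h Suc mult_mono[of \<eta> 1 h "1/2"] by auto
      then have "\<eta> ^ p * (h ^ p * l2_norm (F p)) \<le> C * (l2_norm (F 0) + \<eta> ^ p * (\<eta> * (h ^ m * l2_norm (F m))))"
        using Suc by (simp add: power_mult_distrib algebra_simps)
      then have "h ^ p * l2_norm (F p) \<le> C / \<eta> ^ p * l2_norm (F 0) + C * \<eta> * (h ^ m * l2_norm (F m))"
        using \<eta> by (simp add: field_simps)
      moreover have "(40 * C * \<eta>) * (h ^ m * l2_norm (F m)) = 40 * (C * \<eta> * (h ^ m * l2_norm (F m)))" by simp
      ultimately have "h ^ m * l2_norm (F m)
        \<le> 40 * (C / \<eta> ^ p * l2_norm (F 0)) + (40 * C * \<eta>) * (h ^ m * l2_norm (F m)) + 40 * (h ^ Suc m * l2_norm (F (Suc m)))"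
        using 1 by linarith
      also have "(40 * C * \<eta>) * (h ^ m * l2_norm (F m)) \<le> (1/2) * (h ^ m * l2_norm (F m))"
        using \<eta> h by (intro mult_right_mono) auto
      finally have "h ^ m * l2_norm (F m) \<le> 80 * (C / \<eta> ^ p * l2_norm (F 0)) + 80 * (h ^ Suc m * l2_norm (F (Suc m)))"
        by linarith
      then have "h ^ m * l2_norm (F m) \<le> 80 * (C / \<eta> ^ p) * l2_norm (F 0) + 80 * (h ^ Suc m * l2_norm (F (Suc m)))"
        by simp
      also have "\<dots> \<le> D * l2_norm (F 0) + D * (h ^ Suc m * l2_norm (F (Suc m)))"
        unfolding D_def using \<open>C > 0\<close> \<eta> h by (intro add_mono mult_right_mono) auto
      finally show ?thesis by (simp add: algebra_simps)
    qed
    show ?thesis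
    proof (intro exI[of _ "C * (1 + D) + D + 1"] conjI allI impI)
      show "C * (1 + D) + D + 1 > 0" using \<open>C > 0\<close> \<open>D > 0\<close> by (auto intro!: add_pos_pos)
      fix F h j assume F: "sob_chain (Suc m) F" and h: "(0::real) < h" "h \<le> 1/2" and j: "j \<le> Suc m"
      let ?R = "l2_norm (F 0) + h ^ Suc m * l2_norm (F (Suc m))"
      have R: "0 \<le> ?R" "h ^ Suc m * l2_norm (F (Suc m)) \<le> ?R" "l2_norm (F 0) \<le> ?R" using h by auto
      show "h ^ j * l2_norm (F j) \<le> (C * (1 + D) + D + 1) * ?R"
      proof (cases "j = Suc m")
        case True
        have "1 * ?R \<le> (C * (1 + D) + D + 1) * ?R"
          using R \<open>C > 0\<close> \<open>D > 0\<close> by (intro mult_right_mono) auto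
        from order_trans[OF R(2) this[unfolded mult_1]] show ?thesis unfolding True .
      next
        case False
        have "h ^ j * l2_norm (F j) \<le> C * (l2_norm (F 0) + h ^ m * l2_norm (F m))"
          using C[of F h j] sob_chain_le[OF F] h j False by auto
        also have "\<dots> \<le> C * (?R + D * ?R)"
          using top[OF F h] R \<open>C > 0\<close> by (intro mult_left_mono add_mono) auto
        also have "\<dots> \<le> (C * (1 + D) + D + 1) * ?R"
          using R \<open>D > 0\<close> by (simp add: algebra_simps)
        finally show ?thesis .
      qed
    qed
  qed
qed

section \<open>Sobolev functions and chains of derivatives\<close>

lemma deriv01_0: "deriv01 0 f = f" by (simp add: deriv01_def)

lemma deriv01_Suc: "deriv01 (Suc k) f = (\<lambda>x. vector_derivative (deriv01 k f) (at x within {0..1}))"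
  by (simp add: deriv01_def)

text \<open>Each derivative below order m is absolutely continuous and so a primitive of the next
  one. This also makes the top derivative measurable, which integrability of its square alone would
  not.\<close>

lemma sobolev_chain:
  assumes "f \<in> sobolev m 2" "m \<ge> 1"
  shows "sob_chain m (\<lambda>k. deriv01 k f)"
proof -
  have ac: "absolutely_continuous_on {0..1} (deriv01 k f)" if "k < m" for k
    using assms that by (simp add: sobolev_def)
  have p: "primitive01 (deriv01 k f) (deriv01 (Suc k) f)" if "k < m" for k
    unfolding deriv01_Suc by (rule absolutely_continuous_primitive01[OF ac[OF that]])
  obtain k where k: "m = Suc k" using assms by (cases m) auto
  have "deriv01 m f absolutely_integrable_on {0..1}" using p[of k] k by (simp add: primitive01_def)
  then have "deriv01 m f \<in> borel_measurable (lebesgue_on {0..1})"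
    by (rule absolutely_integrable_imp_borel_measurable) auto
  then have "sq_int (deriv01 m f)" using assms by (simp add: sq_int_def sobolev_def)
  then show ?thesis using p by (simp add: sob_chain_def)
qed

lemma absolutely_continuous_on_cong:
  assumes "absolutely_continuous_on {a..b} f" "\<And>x. x \<in> {a..b} \<Longrightarrow> f x = g x"
  shows "absolutely_continuous_on {a..b} g"
proof -
  have "increments g P = increments f P" if "nonoverlapping a b P" for P
    unfolding increments_def using that assms(2) by (intro sum.cong refl) (force simp: nonoverlapping_def)
  then show ?thesis using assms(1) unfolding absolutely_continuous_on_nonoverlapping by metis
qed

text \<open>Values of \<open>v\<close> outside [0, 1] do not affect a derivative within [0, 1]. Off
  a null set Lebesgue differentiation applies; for continuous \<open>u'\<close> the elementary
  fundamental theorem leaves no exceptional points.\<close>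

lemma primitive01_deriv01:
  assumes p: "primitive01 u u'" and eq: "\<And>x. x \<in> {0..1} \<Longrightarrow> v x = u x"
  shows "negligible {x\<in>{0..1}. vector_derivative v (at x within {0..1}) \<noteq> u' x}"
    and "continuous_on {0..1} u' \<Longrightarrow> x \<in> {0..1} \<Longrightarrow> vector_derivative v (at x within {0..1}) = u' x"
proof -
  have *: "vector_derivative v (at x within {0..1}) = u' x"
    if "(u has_vector_derivative u' x) (at x within {0..1})" "x \<in> {0..1}" for x
  proof -
    have "(v has_vector_derivative u' x) (at x within {0..1})"
      by (rule has_vector_derivative_transform[OF that(2) _ that(1)]) (rule eq)
    then show ?thesis using vector_derivative_within_cbox[of 0 1 x v] that by simp
  qed
  show "negligible {x\<in>{0..1}. vector_derivative v (at x within {0..1}) \<noteq> u' x}"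
    by (rule negligible_subset[OF primitive01_absolutely_continuous(2)[OF p]]) (use * in blast)
  show "vector_derivative v (at x within {0..1}) = u' x" if c: "continuous_on {0..1} u'" and x: "x \<in> {0..1}"
  proof (rule *[OF _ x])
    have "((\<lambda>y. integral {0..y} u') has_vector_derivative u' x) (at x within {0..1})"
      by (rule integral_has_vector_derivative[OF c x])
    then have "((\<lambda>y. u 0 + integral {0..y} u') has_vector_derivative 0 + u' x) (at x within {0..1})"
      by (intro has_vector_derivative_add has_vector_derivative_const)
    then have "(u has_vector_derivative 0 + u' x) (at x within {0..1})"
    proof (rule has_vector_derivative_transform[OF x, rotated])
      fix y :: real assume "y \<in> {0..1}"
      then have "integral {0..y} u' = u y - u 0" using p by (intro integral_unique) (auto simp: primitive01_def)
      then show "u y = u 0 + integral {0..y} u'" by simp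
    qed
    then show "(u has_vector_derivative u' x) (at x within {0..1})" by simp
  qed
qed

text \<open>Below order m the chain is continuous, so iterated derivatives agree with it everywhere
  on [0, 1] and the induction can proceed; only the last step loses a null set.\<close>

lemma chain_sobolev:
  assumes F: "sob_chain m F" and m: "m \<ge> 1"
  shows "k < m \<Longrightarrow> x \<in> {0..1} \<Longrightarrow> deriv01 k (F 0) x = F k x"
    and "negligible {x\<in>{0..1}. deriv01 m (F 0) x \<noteq> F m x}"
    and "F 0 \<in> sobolev m 2"
proof -
  have A: "\<forall>x\<in>{0..1}. deriv01 k (F 0) x = F k x" if "k < m" for k
    using that
  proof (induction k)
    case (Suc k)
    then show ?case unfolding deriv01_Suc
      using primitive01_deriv01(2)[OF sob_chain_primitive[OF F, of k], of "deriv01 k (F 0)"] sob_chain_continuous[OF F Suc.prems]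
      by auto
  qed (simp add: deriv01_0)
  then show "k < m \<Longrightarrow> x \<in> {0..1} \<Longrightarrow> deriv01 k (F 0) x = F k x" by blast
  obtain k where k: "m = Suc k" using m by (cases m) auto
  show N: "negligible {x\<in>{0..1}. deriv01 m (F 0) x \<noteq> F m x}"
    unfolding k deriv01_Suc using primitive01_deriv01(1)[OF sob_chain_primitive[OF F, of k], of "deriv01 k (F 0)"] A[of k] k by auto
  have "F m absolutely_integrable_on {0..1}" using sob_chain_primitive[OF F, of k] k by (simp add: primitive01_def)
  from absolutely_integrable_spike[OF this N, of "deriv01 m (F 0)"]
  have "deriv01 m (F 0) absolutely_integrable_on {0..1}" by auto
  then have meas: "deriv01 m (F 0) \<in> borel_measurable (lebesgue_on {0..1})"
    by (rule absolutely_integrable_imp_borel_measurable) auto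
  have "AE x in lebesgue_on {0..1}. deriv01 m (F 0) x = F m x"
    using N by (subst AE_restrict_space_iff) (auto simp: negligible_iff_null_sets elim!: AE_not_in[THEN eventually_mono])
  then have "AE x in lebesgue_on {0..1}. (F m x)\<^sup>2 = (deriv01 m (F 0) x)\<^sup>2" by eventually_elim simp
  moreover have "integrable (lebesgue_on {0..1}) (\<lambda>x. (F m x)\<^sup>2)" using F by (simp add: sob_chain_def sq_int_def)
  moreover have "(\<lambda>x. (deriv01 m (F 0) x)\<^sup>2) \<in> borel_measurable (lebesgue_on {0..1})" using meas by simp
  ultimately have "integrable (lebesgue_on {0..1}) (\<lambda>x. (deriv01 m (F 0) x)\<^sup>2)"
    by (rule integrable_cong_AE_imp[rotated 2])
  moreover have "absolutely_continuous_on {0..1} (deriv01 k (F 0))" if "k < m" for k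
    using absolutely_continuous_on_cong[OF primitive01_absolutely_continuous(1)[OF sob_chain_primitive[OF F that]]] A[OF that] by auto
  ultimately show "F 0 \<in> sobolev m 2" by (simp add: sobolev_def)
qed

lemma negligible_imp_AE_01:
  "negligible {x\<in>{0..1}. \<not> P x} \<Longrightarrow> AE x in lebesgue_on {0..1::real}. P x"
  by (subst AE_restrict_space_iff) (auto simp: negligible_iff_null_sets elim!: AE_not_in[THEN eventually_mono])

text \<open>Measurability of f itself comes from completeness of Lebesgue measure.\<close>

lemma l2_norm_cong_negligible:
  assumes "negligible {x\<in>{0..1}. f x \<noteq> g x}" "sq_int g"
  shows "sq_int f" "l2_norm f = l2_norm g"
proof -
  have AE: "AE x in lebesgue_on {0..1}. f x = g x" using negligible_imp_AE_01[of "\<lambda>x. f x = g x"] assms(1) by simp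
  have "g absolutely_integrable_on {0..1}" using sq_int_integrable[OF assms(2)]
    by (simp add: integrable_restrict_space set_integrable_def)
  from absolutely_integrable_spike[OF this assms(1), of f]
  have "f absolutely_integrable_on {0..1}" by auto
  then have meas: "f \<in> borel_measurable (lebesgue_on {0..1})"
    by (rule absolutely_integrable_imp_borel_measurable) auto
  show "sq_int f"
    using assms(2) meas AE by (auto simp: sq_int_def intro!: integrable_cong_AE_imp[of _ "\<lambda>x. (g x)\<^sup>2"])
  show "l2_norm f = l2_norm g"
    unfolding l2_norm_def l2_inner_def
    using meas AE assms(2) by (intro arg_cong[where f=sqrt] integral_cong_AE) (auto simp: sq_int_def)
qed

text \<open>Brings a primitive, later the square of a perturbation, into the class for which the
  quadrature condition on the design is assumed.\<close>

lemma primitive01_sobolev_1_1: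
  assumes p: "primitive01 u u'"
  shows "u \<in> sobolev 1 1" "(LINT x|lebesgue_on {0..1}. \<bar>deriv01 1 u x\<bar>) = (LINT x|lebesgue_on {0..1}. \<bar>u' x\<bar>)"
proof -
  have d: "deriv01 1 u = (\<lambda>x. vector_derivative u (at x within {0..1}))" using deriv01_Suc[of 0 u] by (simp add: deriv01_0)
  have N: "negligible {x\<in>{0..1}. deriv01 1 u x \<noteq> u' x}"
    unfolding d using primitive01_deriv01(1)[OF p, of u] by simp
  have "deriv01 1 u absolutely_integrable_on {0..1}"
    using absolutely_continuous_primitive01[OF primitive01_absolutely_continuous(1)[OF p]] unfolding d primitive01_def by simp
  then have i: "integrable (lebesgue_on {0..1}) (deriv01 1 u)" by (rule absolutely_integrable_imp_integrable) auto
  have i': "integrable (lebesgue_on {0..1}) u'" using p unfolding primitive01_def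
    by (intro absolutely_integrable_imp_integrable) auto
  have "AE x in lebesgue_on {0..1}. deriv01 1 u x = u' x" using negligible_imp_AE_01[of "\<lambda>x. deriv01 1 u x = u' x"] N by simp
  then show "(LINT x|lebesgue_on {0..1}. \<bar>deriv01 1 u x\<bar>) = (LINT x|lebesgue_on {0..1}. \<bar>u' x\<bar>)"
    using i i' by (intro integral_cong_AE) auto
  show "u \<in> sobolev 1 1"
    using i primitive01_absolutely_continuous(1)[OF p] by (simp add: sobolev_def deriv01_0)
qed

lemma primitive01_increment_bound:
  assumes "primitive01 u u'" "x \<in> {0..1}"
  shows "\<bar>u x - u 0\<bar> \<le> (LINT t|lebesgue_on {0..1}. \<bar>u' t\<bar>)"
proof -
  have x: "0 \<le> x" "x \<le> 1" using assms(2) by auto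
  note L = primitive01_LINT[OF assms(1) order_refl x]
  have i: "integrable (lebesgue_on {0..1}) u'"
    using assms(1) unfolding primitive01_def by (intro absolutely_integrable_imp_integrable) auto
  have "\<bar>u x - u 0\<bar> \<le> (LINT t|lebesgue_on {0..1}. \<bar>indicator {0..x} t * u' t\<bar>)"
    unfolding L(2)[symmetric] by (rule integral_abs_bound)
  also have "\<dots> \<le> (LINT t|lebesgue_on {0..1}. \<bar>u' t\<bar>)"
    using L(1) i by (intro integral_mono) (auto simp: indicator_def)
  finally show ?thesis .
qed

lemma LINT_01_le_bound:
  fixes u :: "real \<Rightarrow> real"
  assumes "\<And>x. x \<in> {0..1} \<Longrightarrow> u x \<le> B" "integrable (lebesgue_on {0..1}) u"
  shows "(LINT t|lebesgue_on {0..1}. u t) \<le> B"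
proof -
  interpret prob_space "lebesgue_on {0..1::real}"
    by (rule prob_spaceI) (simp add: emeasure_restrict_space space_restrict_space)
  show ?thesis using assms by (intro integral_le_const AE_I2) (auto simp: space_restrict_space)
qed

lemma sq_int_abs_integrable: "sq_int f \<Longrightarrow> f absolutely_integrable_on {0..1}"
  using sq_int_integrable by (simp add: integrable_restrict_space set_integrable_def)

section \<open>Limits of rapidly converging sequences\<close>

text \<open>Riesz-Fischer for a geometric rate. The increments are absolutely summable almost
  everywhere, which gives the limit and the integrable majorant \<open>w\<close>. Fatou's lemma then
  passes from any convergent upper bounds along a subsequence to the norm of the limit; in this form
  the bounds may involve the data term of the objective.\<close>

lemma sq_int_fast_Cauchy_limit:
  assumes sq: "\<And>k. sq_int (g k)"
    and fast: "\<And>k. l2_norm (\<lambda>x. g (Suc k) x - g k x) \<le> B * (1/2)^k"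
  shows "\<exists>u. sq_int u \<and> (\<lambda>k. LINT x|lebesgue_on {0..1}. \<bar>g k x - u x\<bar>) \<longlonglongrightarrow> 0 \<and>
    (\<forall>r c a. strict_mono r \<longrightarrow> (\<forall>k. (l2_norm (g (r k)))\<^sup>2 \<le> c k) \<longrightarrow> c \<longlonglongrightarrow> a \<longrightarrow> (l2_norm u)\<^sup>2 \<le> a)"
proof -
  let ?L = "lebesgue_on {0..1::real}"
  define d where "d = (\<lambda>k x. g (Suc k) x - g k x)"
  have dsq: "sq_int (d k)" for k using sq_int_lin[OF sq[of "Suc k"] sq[of k], of 1 "-1"] by (simp add: d_def)
  have gm[measurable]: "g k \<in> borel_measurable ?L" for k using sq[of k] by (simp add: sq_int_def)
  have dm[measurable]: "d k \<in> borel_measurable ?L" for k using dsq[of k] by (simp add: sq_int_def)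
  have dint: "integrable ?L (d k)" for k using sq_int_integrable[OF dsq] .
  have B: "0 \<le> B" using order_trans[OF l2_norm_nonneg fast[of 0]] by simp
  have l1: "(LINT x|?L. \<bar>d k x\<bar>) \<le> B * (1/2)^k" for k
    using l1_le_l2[OF dsq[of k]] fast[of k] by (simp add: d_def)
  have sgeo: "summable (\<lambda>k. B * (1/2)^k)" by (intro summable_mult summable_geometric) auto
  have suml1: "summable (\<lambda>k. LINT x|?L. \<bar>d k x\<bar>)"
    by (rule summable_comparison_test'[OF sgeo, of 0]) (use l1 in auto)
  have "(\<integral>\<^sup>+x. (\<Sum>k. ennreal \<bar>d k x\<bar>) \<partial>?L) = (\<Sum>k. \<integral>\<^sup>+x. ennreal \<bar>d k x\<bar> \<partial>?L)"
    by (intro nn_integral_suminf) auto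
  also have "\<dots> = (\<Sum>k. ennreal (LINT x|?L. \<bar>d k x\<bar>))"
    using dint by (intro suminf_cong nn_integral_eq_integral) auto
  also have "\<dots> = ennreal (\<Sum>k. LINT x|?L. \<bar>d k x\<bar>)"
    using suml1 by (intro suminf_ennreal2) auto
  finally have "AE x in ?L. (\<Sum>k. ennreal \<bar>d k x\<bar>) \<noteq> \<infinity>"
    by (intro nn_integral_PInf_AE) auto
  then have sumAE: "AE x in ?L. summable (\<lambda>k. \<bar>d k x\<bar>)"
    by eventually_elim (auto intro: summable_suminf_not_top)
  define w where "w = (\<lambda>x. \<bar>g 0 x\<bar> + (\<Sum>k. \<bar>d k x\<bar>))"
  have wint: "integrable ?L w"
    unfolding w_def using sq_int_integrable[OF sq[of 0]] dint sumAE suml1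
    by (intro Bochner_Integration.integrable_add integrable_suminf) auto
  \<comment> \<open>\<open>lim\<close> has an arbitrary value where the sequence diverges, but
    yields a measurable function.\<close>
  define u where "u = (\<lambda>x. lim (\<lambda>k. g k x))"
  have um[measurable]: "u \<in> borel_measurable ?L" unfolding u_def by measurable
  have tele: "g k x = g 0 x + (\<Sum>i<k. d i x)" for k x
    by (induction k) (auto simp: d_def)
  have convAE: "AE x in ?L. (\<lambda>k. g k x) \<longlonglongrightarrow> u x"
    using sumAE
  proof eventually_elim
    fix x assume "summable (\<lambda>k. \<bar>d k x\<bar>)"
    then have "summable (\<lambda>k. d k x)" by (rule summable_rabs_cancel)
    then have "(\<lambda>k. g 0 x + (\<Sum>i<k. d i x)) \<longlonglongrightarrow> g 0 x + (\<Sum>i. d i x)"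
      by (intro tendsto_intros summable_LIMSEQ)
    then have "(\<lambda>k. g k x) \<longlonglongrightarrow> g 0 x + (\<Sum>i. d i x)" by (simp only: tele[symmetric])
    then show "(\<lambda>k. g k x) \<longlonglongrightarrow> u x" unfolding u_def by (metis limI)
  qed
  have domAE: "AE x in ?L. \<forall>k. \<bar>g k x\<bar> \<le> w x"
    using sumAE
  proof eventually_elim
    fix x assume s: "summable (\<lambda>k. \<bar>d k x\<bar>)"
    show "\<forall>k. \<bar>g k x\<bar> \<le> w x"
    proof
      fix k
      have "\<bar>g k x\<bar> \<le> \<bar>g 0 x\<bar> + \<bar>\<Sum>i<k. d i x\<bar>" unfolding tele[of k x] by (rule abs_triangle_ineq)
      also have "\<bar>\<Sum>i<k. d i x\<bar> \<le> (\<Sum>i<k. \<bar>d i x\<bar>)" by (rule sum_abs)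
      also have "\<dots> \<le> (\<Sum>i. \<bar>d i x\<bar>)" using s by (intro sum_le_suminf) auto
      finally show "\<bar>g k x\<bar> \<le> w x" by (simp add: w_def)
    qed
  qed
  have "(\<lambda>k. LINT x|?L. \<bar>g k x - u x\<bar>) \<longlonglongrightarrow> (LINT x|?L. 0)"
  proof (rule integral_dominated_convergence[where w="\<lambda>x. 2 * w x"])
    show "AE x in ?L. (\<lambda>k. \<bar>g k x - u x\<bar>) \<longlonglongrightarrow> 0"
      using convAE by eventually_elim (auto intro: tendsto_rabs_zero LIM_zero)
    show "AE x in ?L. norm \<bar>g k x - u x\<bar> \<le> 2 * w x" for k
      using domAE convAE
    proof eventually_elim
      fix x assume "\<forall>k. \<bar>g k x\<bar> \<le> w x" "(\<lambda>k. g k x) \<longlonglongrightarrow> u x"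
      then have "\<bar>u x\<bar> \<le> w x" by (intro LIMSEQ_le_const2[OF tendsto_rabs]) auto
      then show "norm \<bar>g k x - u x\<bar> \<le> 2 * w x" using \<open>\<forall>k. \<bar>g k x\<bar> \<le> w x\<close>[rule_format, of k] by simp
    qed
  qed (use wint in auto)
  then have L1: "(\<lambda>k. LINT x|?L. \<bar>g k x - u x\<bar>) \<longlonglongrightarrow> 0" by simp
  have fatou: "integrable ?L (\<lambda>x. (u x)\<^sup>2) \<and> (LINT x|?L. (u x)\<^sup>2) \<le> a"
    if r: "strict_mono r" and c: "\<And>k. (l2_norm (g (r k)))\<^sup>2 \<le> c k" "c \<longlonglongrightarrow> a" for r :: "nat \<Rightarrow> nat" and c a
  proof -
    have a0: "0 \<le> a" using c(2) order_trans[OF zero_le_power2 c(1)] by (intro LIMSEQ_le_const[OF c(2)]) auto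
    have "(\<integral>\<^sup>+x. ennreal ((u x)\<^sup>2) \<partial>?L) = (\<integral>\<^sup>+x. liminf (\<lambda>k. ennreal ((g (r k) x)\<^sup>2)) \<partial>?L)"
    proof (rule nn_integral_cong_AE, use convAE in eventually_elim)
      fix x assume "(\<lambda>k. g k x) \<longlonglongrightarrow> u x"
      then have "(\<lambda>k. g (r k) x) \<longlonglongrightarrow> u x" using LIMSEQ_subseq_LIMSEQ[OF _ r, of "\<lambda>k. g k x"] by (simp add: o_def)
      then have "(\<lambda>k. ennreal ((g (r k) x)\<^sup>2)) \<longlonglongrightarrow> ennreal ((u x)\<^sup>2)" by (intro tendsto_ennrealI tendsto_power)
      then show "ennreal ((u x)\<^sup>2) = liminf (\<lambda>k. ennreal ((g (r k) x)\<^sup>2))"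
        using lim_imp_Liminf[of sequentially] by fastforce
    qed
    also have "\<dots> \<le> liminf (\<lambda>k. \<integral>\<^sup>+x. ennreal ((g (r k) x)\<^sup>2) \<partial>?L)"
      by (intro nn_integral_liminf) auto
    also have "\<dots> = liminf (\<lambda>k. ennreal ((l2_norm (g (r k)))\<^sup>2))"
      unfolding l2_norm_power2 using sq by (intro arg_cong[where f=liminf] ext nn_integral_eq_integral) (auto simp: sq_int_def)
    also have "\<dots> \<le> liminf (\<lambda>k. ennreal (c k))"
      using c by (intro Liminf_mono always_eventually) (auto intro: ennreal_leI)
    also have "\<dots> = ennreal a" using c(2) by (intro lim_imp_Liminf tendsto_ennrealI) auto
    finally have le: "(\<integral>\<^sup>+x. ennreal ((u x)\<^sup>2) \<partial>?L) \<le> ennreal a" .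
    then have i: "integrable ?L (\<lambda>x. (u x)\<^sup>2)"
      by (intro integrableI_nonneg) (auto intro: le_less_trans)
    then have "(\<integral>\<^sup>+x. ennreal ((u x)\<^sup>2) \<partial>?L) = ennreal (LINT x|?L. (u x)\<^sup>2)" by (intro nn_integral_eq_integral) auto
    with le a0 i show ?thesis by simp
  qed
  have geo: "(\<Sum>i<k. B * (1/2)^i) \<le> 2 * B" for k
  proof -
    have "(\<Sum>i<k. B * (1/2)^i) \<le> (\<Sum>i. B * (1/2)^i)" using sgeo B by (intro sum_le_suminf) auto
    also have "\<dots> = 2 * B" by (subst suminf_mult) (auto simp: suminf_geometric)
    finally show ?thesis .
  qed
  have bnd: "l2_norm (g k) \<le> l2_norm (g 0) + (\<Sum>i<k. B * (1/2)^i)" for k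
  proof (induction k)
    case (Suc k)
    have "g (Suc k) = (\<lambda>x. 1 * g k x + 1 * d k x)" by (simp add: d_def)
    then have "l2_norm (g (Suc k)) \<le> l2_norm (g k) + l2_norm (d k)"
      using l2_norm_lin[OF sq[of k] dsq[of k], of 1 1] by simp
    then show ?case using Suc fast[of k] by (simp add: d_def)
  qed simp
  have "(l2_norm (g k))\<^sup>2 \<le> (l2_norm (g 0) + 2 * B)\<^sup>2" for k
    using bnd[of k] geo[of k] by (intro power_mono) auto
  \<comment> \<open>The whole sequence with a constant bound already gives square integrability of
    the limit.\<close>
  from fatou[OF strict_mono_id this[unfolded id_def[symmetric]], of "(l2_norm (g 0) + 2 * B)\<^sup>2"]
  have "sq_int u" using um by (simp add: sq_int_def)
  moreover have "(l2_norm u)\<^sup>2 \<le> a" if "strict_mono r" "\<And>k. (l2_norm (g (r k)))\<^sup>2 \<le> c k" "c \<longlonglongrightarrow> a" for r c a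
    unfolding l2_norm_power2 using fatou[OF that] by blast
  ultimately show ?thesis using L1 by blast
qed

subsection \<open>Existence of smoothing splines\<close>

text \<open>The j-fold primitive whose derivatives of order below j vanish at 0. Subtracting it, for
  j = m, from a function with m-th derivative g leaves a polynomial of degree below m.\<close>

fun iterated_integral :: "nat \<Rightarrow> (real \<Rightarrow> real) \<Rightarrow> real \<Rightarrow> real" where
  "iterated_integral 0 g = g"
| "iterated_integral (Suc j) g = (\<lambda>x. integral {0..x} (iterated_integral j g))"

lemma primitive01_integral:
  assumes "g absolutely_integrable_on {0..1}"
  shows "primitive01 (\<lambda>x. integral {0..x} g) g"
  unfolding primitive01_def
proof (intro conjI allI impI)
  fix x y :: real assume xy: "0 \<le> x" "x \<le> y" "y \<le> 1"
  have gi: "g integrable_on {0..1}" using assms by (simp add: set_lebesgue_integral_eq_integral(1))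
  have "g integrable_on {0..y}" "g integrable_on {x..y}" using integrable_subinterval_real[OF gi] xy by auto
  then show "(g has_integral (integral {0..y} g - integral {0..x} g)) {x..y}"
    using Henstock_Kurzweil_Integration.integral_combine[OF xy(1,2)] by (metis add_diff_cancel_left' integrable_integral)
qed fact

lemma iterated_integral_primitive:
  assumes "sq_int g"
  shows "primitive01 (iterated_integral (Suc j) g) (iterated_integral j g)"
proof (induction j)
  case 0
  show ?case using primitive01_integral[OF sq_int_abs_integrable[OF assms]] by simp
next
  case (Suc j)
  have "iterated_integral (Suc j) g absolutely_integrable_on {0..1}"
    using primitive01_continuous[OF Suc] by (rule absolutely_integrable_continuous_real)
  then show ?case using primitive01_integral[of "iterated_integral (Suc j) g"] by simp
qed

lemma iterated_integral_chain:
  assumes "sq_int g"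
  shows "sob_chain m (\<lambda>k. iterated_integral (m - k) g)"
  unfolding sob_chain_def
proof (intro conjI allI impI)
  fix k assume "k < m"
  then have "m - k = Suc (m - Suc k)" by simp
  then show "primitive01 (iterated_integral (m - k) g) (iterated_integral (m - Suc k) g)"
    using iterated_integral_primitive[OF assms] by metis
qed (use assms in simp)

text \<open>The first integration passes from the L1 norm to a sup norm, and further integrations
  over [0, 1] do not increase sup norms. L1 convergence of the top derivatives therefore suffices
  for convergence at the design points.\<close>

lemma iterated_integral_diff_bound:
  assumes "sq_int g" "sq_int u" "x \<in> {0..1}"
  shows "\<bar>iterated_integral (Suc j) g x - iterated_integral (Suc j) u x\<bar> \<le> (LINT t|lebesgue_on {0..1}. \<bar>g t - u t\<bar>)"
  using assms(3)
proof (induction j arbitrary: x)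
  case 0
  have "primitive01 (\<lambda>x. 1 * iterated_integral (Suc 0) g x + (-1) * iterated_integral (Suc 0) u x) (\<lambda>x. 1 * iterated_integral 0 g x + (-1) * iterated_integral 0 u x)"
    by (intro primitive01_lin iterated_integral_primitive assms)
  from primitive01_increment_bound[OF this 0] show ?case by simp
next
  case (Suc j)
  let ?B = "LINT t|lebesgue_on {0..1}. \<bar>g t - u t\<bar>"
  have p: "primitive01 (\<lambda>x. 1 * iterated_integral (Suc (Suc j)) g x + (-1) * iterated_integral (Suc (Suc j)) u x) (\<lambda>x. 1 * iterated_integral (Suc j) g x + (-1) * iterated_integral (Suc j) u x)"
    by (intro primitive01_lin iterated_integral_primitive assms)
  have "continuous_on {0..1} (\<lambda>x. \<bar>iterated_integral (Suc j) g x - iterated_integral (Suc j) u x\<bar>)"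
    by (intro continuous_intros primitive01_continuous[OF iterated_integral_primitive] assms)
  then have "integrable (lebesgue_on {0..1}) (\<lambda>x. \<bar>iterated_integral (Suc j) g x - iterated_integral (Suc j) u x\<bar>)"
    by (intro sq_int_integrable sq_int_continuous)
  from LINT_01_le_bound[OF Suc.IH this] primitive01_increment_bound[OF p Suc.prems]
  show ?case by simp
qed

section \<open>Polynomials and interpolation at the design points\<close>

lemma primitive01_poly: "primitive01 (poly P) (poly (pderiv P))"
  unfolding primitive01_def
proof (intro conjI allI impI)
  show "poly (pderiv P) absolutely_integrable_on {0..1}"
    by (intro absolutely_integrable_continuous_real continuous_intros)
  fix x y :: real assume "0 \<le> x" "x \<le> y" "y \<le> 1"
  then show "(poly (pderiv P) has_integral (poly P y - poly P x)) {x..y}"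
    by (intro fundamental_theorem_of_calculus)
       (auto simp: has_real_derivative_iff_has_vector_derivative[symmetric] intro: DERIV_subset[OF poly_DERIV])
qed

text \<open>A condition on coefficients instead of \<open>degree\<close>, so that
  \<open>deg_lt 0 P\<close> means that P is zero.\<close>

definition deg_lt :: "nat \<Rightarrow> real poly \<Rightarrow> bool" where
  "deg_lt m P \<longleftrightarrow> (\<forall>i\<ge>m. coeff P i = 0)"

lemma deg_lt_pderiv: "deg_lt m P \<Longrightarrow> deg_lt (m - 1) (pderiv P)"
  by (auto simp: deg_lt_def coeff_pderiv)

lemma deg_lt_pderiv_funpow: "deg_lt m P \<Longrightarrow> deg_lt (m - k) ((pderiv ^^ k) P)"
proof (induction k)
  case (Suc k)
  then show ?case using deg_lt_pderiv[of "m - k" "(pderiv ^^ k) P"] by simp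
qed simp

lemma poly_chain:
  assumes "deg_lt m P"
  shows "sob_chain m (\<lambda>k. poly ((pderiv ^^ k) P))" "(pderiv ^^ m) P = 0"
proof -
  show "(pderiv ^^ m) P = 0" using deg_lt_pderiv_funpow[OF assms, of m] by (intro poly_eqI) (simp add: deg_lt_def)
  then show "sob_chain m (\<lambda>k. poly ((pderiv ^^ k) P))"
    unfolding sob_chain_def using primitive01_poly by (auto intro!: sq_int_continuous continuous_intros)
qed

lemma poly_antiderivative:
  fixes P :: "real poly"
  assumes "deg_lt m P"
  obtains Q where "pderiv Q = P" "deg_lt (Suc m) Q"
proof -
  define Q where "Q = (\<Sum>i<m. monom (coeff P i / real (Suc i)) (Suc i))"
  have cQ: "coeff Q j = (\<Sum>i<m. if Suc i = j then coeff P i / real (Suc i) else 0)" for j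
    unfolding Q_def by (simp add: coeff_sum del: of_nat_Suc)
  have "coeff (pderiv Q) j = coeff P j" for j
  proof -
    have "coeff (pderiv Q) j = real (Suc j) * (\<Sum>i<m. if i = j then coeff P i / real (Suc i) else 0)"
      by (simp add: coeff_pderiv cQ del: of_nat_Suc)
    also have "\<dots> = coeff P j" using assms by (cases "j < m") (auto simp: deg_lt_def)
    finally show ?thesis .
  qed
  then have "pderiv Q = P" by (rule poly_eqI)
  moreover have "deg_lt (Suc m) Q" unfolding deg_lt_def cQ by (auto intro!: sum.neutral)
  ultimately show ?thesis using that by blast
qed

text \<open>Induction on m: an antiderivative of the polynomial for the derivative, with the
  constant matched at 0.\<close>

lemma chain_zero_top_poly:
  assumes "sob_chain m p" "\<And>x. x \<in> {0..1} \<Longrightarrow> p m x = 0"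
  shows "\<exists>P. deg_lt m P \<and> (\<forall>x\<in>{0..1}. p 0 x = poly P x)"
  using assms
proof (induction m arbitrary: p)
  case 0
  then show ?case by (intro exI[of _ 0]) (auto simp: deg_lt_def)
next
  case (Suc m)
  have "sob_chain m (\<lambda>k. p (Suc k))" using Suc.prems(1) by (auto simp: sob_chain_def)
  from Suc.IH[OF this] Suc.prems(2) obtain P where P: "deg_lt m P" "\<forall>x\<in>{0..1}. p (Suc 0) x = poly P x" by auto
  obtain Q where Q: "pderiv Q = P" "deg_lt (Suc m) Q" by (rule poly_antiderivative[OF P(1)])
  have "deg_lt (Suc m) (Q + [:p 0 0 - poly Q 0:])" using Q(2) by (auto simp: deg_lt_def coeff_pCons split: nat.split)
  moreover have "p 0 x = poly (Q + [:p 0 0 - poly Q 0:]) x" if x: "x \<in> {0..1}" for x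
  proof -
    have "(p (Suc 0) has_integral (p 0 x - p 0 0)) {0..x}"
      using sob_chain_primitive[OF Suc.prems(1), of 0] x by (auto simp: primitive01_def)
    moreover have "(poly P has_integral (poly Q x - poly Q 0)) {0..x}"
      using primitive01_poly[of Q] Q(1) x by (auto simp: primitive01_def)
    then have "(p (Suc 0) has_integral (poly Q x - poly Q 0)) {0..x}"
      by (rule has_integral_eq[rotated]) (use P(2) x in auto)
    ultimately have "p 0 x - p 0 0 = poly Q x - poly Q 0" by (rule has_integral_unique)
    then show ?thesis by simp
  qed
  ultimately show ?case by blast
qed

definition lagrange_basis :: "real set \<Rightarrow> real \<Rightarrow> real poly" where
  "lagrange_basis S s = (\<Prod>u\<in>S - {s}. smult (1 / (s - u)) [:-u, 1:])"

lemma poly_lagrange_basis: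
  assumes "finite S" "s \<in> S" "x \<in> S"
  shows "poly (lagrange_basis S s) x = (if x = s then 1 else 0)"
  using assms by (auto simp: lagrange_basis_def poly_prod divide_simps intro!: prod_zero prod.neutral)

lemma deg_lt_lagrange_basis:
  assumes "finite S" "s \<in> S"
  shows "deg_lt (card S) (lagrange_basis S s)"
proof -
  have "degree (lagrange_basis S s) \<le> (\<Sum>u\<in>S - {s}. degree (smult (1 / (s - u)) [:-u, 1:]))"
    unfolding lagrange_basis_def
    using degree_prod_sum_le[of "S - {s}" "\<lambda>u. smult (1 / (s - u)) [:-u, 1:]"] assms by (simp add: o_def)
  also have "\<dots> \<le> (\<Sum>u\<in>S - {s}. 1)" by (intro sum_mono) (auto simp: degree_smult_eq)
  also have "\<dots> < card S" 
  proof -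
    have "card S > 0" using assms by (auto simp: card_gt_0_iff)
    then show ?thesis using assms by simp
  qed
  finally show ?thesis by (auto simp: deg_lt_def coeff_eq_0)
qed

lemma deg_lt_mono: "deg_lt k P \<Longrightarrow> k \<le> m \<Longrightarrow> deg_lt m P"
  by (auto simp: deg_lt_def)

lemma deg_lt_sum: "(\<And>s. s \<in> S \<Longrightarrow> deg_lt m (P s)) \<Longrightarrow> deg_lt m (\<Sum>s\<in>S. smult (v s) (P s))"
  by (auto simp: deg_lt_def coeff_sum)

lemma deg_lt_eq_if_agree:
  assumes "deg_lt (card S) P" "deg_lt (card S) Q" "finite S" "\<And>x. x \<in> S \<Longrightarrow> poly P x = poly Q x"
  shows "P = Q"
proof (rule ccontr)
  assume "P \<noteq> Q"
  then have nz: "P - Q \<noteq> 0" by simp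
  have "deg_lt (card S) (P - Q)" using assms by (auto simp: deg_lt_def)
  then have "degree (P - Q) < card S" using nz unfolding deg_lt_def by (metis leading_coeff_0_iff not_le)
  moreover have "card S \<le> card {x. poly (P - Q) x = 0}"
    using assms nz by (intro card_mono poly_roots_finite) auto
  moreover have "card {x. poly (P - Q) x = 0} \<le> degree (P - Q)" using nz by (rule card_poly_roots_bound)
  ultimately show False by linarith
qed

text \<open>If there are fewer than \<open>m\<close> distinct nodes, a polynomial of degree below \<open>m\<close> is not determined by its
  values at the nodes; the interpolation formula is then only claimed at the nodes.\<close>

lemma lagrange_nodes:
  assumes "finite T"
  obtains S where "S \<subseteq> T" "card S \<le> m"
    "\<And>P x. deg_lt m P \<Longrightarrow> x \<in> T \<Longrightarrow> poly P x = (\<Sum>s\<in>S. poly P s * poly (lagrange_basis S s) x)"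
proof (cases "card T \<le> m")
  case True
  have "poly P x = (\<Sum>s\<in>T. poly P s * poly (lagrange_basis T s) x)" if "x \<in> T" for P x
    using that assms by (simp add: poly_lagrange_basis if_distrib sum.delta' cong: if_cong)
  then show ?thesis using that[of T] True by blast
next
  case False
  \<comment> \<open>Exactly m nodes determine a polynomial of degree below m, so here the formula
    holds at every point.\<close>
  then obtain S where S: "S \<subseteq> T" "card S = m" by (meson nat_le_linear obtain_subset_with_card_n)
  have fin: "finite S" using S assms finite_subset by blast
  have "poly P x = (\<Sum>s\<in>S. poly P s * poly (lagrange_basis S s) x)" if "deg_lt m P" for P x
  proof -
    have "P = (\<Sum>s\<in>S. smult (poly P s) (lagrange_basis S s))"
    proof (rule deg_lt_eq_if_agree[of S])
      show "deg_lt (card S) (\<Sum>s\<in>S. smult (poly P s) (lagrange_basis S s))"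
        using deg_lt_lagrange_basis[OF fin] by (intro deg_lt_sum)
      show "poly P x = poly (\<Sum>s\<in>S. smult (poly P s) (lagrange_basis S s)) x" if "x \<in> S" for x
        using that fin by (simp add: poly_sum poly_lagrange_basis if_distrib sum.delta' cong: if_cong)
    qed (use that S fin in auto)
    then have "poly P x = poly (\<Sum>s\<in>S. smult (poly P s) (lagrange_basis S s)) x" by simp
    then show ?thesis by (simp add: poly_sum)
  qed
  then show ?thesis using that[of S] S by blast
qed

text \<open>Successive extraction, one index at a time; finiteness of S takes the place of a
  diagonal argument.\<close>

lemma finite_family_convergent_subseq:
  fixes v :: "nat \<Rightarrow> 'b \<Rightarrow> real"
  assumes "finite S" "\<And>s. s \<in> S \<Longrightarrow> \<exists>B. \<forall>k. \<bar>v k s\<bar> \<le> B"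
  shows "\<exists>r::nat\<Rightarrow>nat. strict_mono r \<and> (\<forall>s\<in>S. convergent (\<lambda>k. v (r k) s))"
  using assms
proof (induction S rule: finite_induct)
  case empty
  show ?case by (intro exI[of _ id]) (auto simp: strict_mono_id)
next
  case (insert a S)
  then obtain r where r: "strict_mono r" "\<forall>s\<in>S. convergent (\<lambda>k. v (r k) s)" by auto
  obtain B where B: "\<forall>k. \<bar>v k a\<bar> \<le> B" using insert.prems by auto
  have "bounded (range (\<lambda>k. v (r k) a))" using B by (auto simp: bounded_iff)
  then obtain l q where q: "strict_mono q" "((\<lambda>k. v (r k) a) \<circ> q) \<longlonglongrightarrow> l"
    using bounded_imp_convergent_subsequence by blast
  have "strict_mono (r \<circ> q)" using r(1) q(1) by (rule strict_mono_o)
  moreover have "convergent (\<lambda>k. v ((r \<circ> q) k) s)" if "s \<in> insert a S" for s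
  proof (cases "s = a")
    case True
    then show ?thesis using q(2) by (auto simp: convergent_def o_def)
  next
    case False
    then have "convergent ((\<lambda>k. v (r k) s) \<circ> q)" using r(2) that q(1) by (intro convergent_subseq_convergent) auto
    then show ?thesis by (simp add: o_def)
  qed
  ultimately show ?case by blast
qed

section \<open>Direct method for the penalised objective\<close>

text \<open>\<open>deriv01\<close> need not be linear where derivatives fail to exist. Evaluating
  the penalty on a chosen version \<open>F m\<close> makes linear combinations of chains
  exact.\<close>

definition chain_objective ::
  "nat \<Rightarrow> (real \<Rightarrow> real) \<Rightarrow> real \<Rightarrow> nat \<Rightarrow> (nat \<Rightarrow> real) \<Rightarrow> (nat \<Rightarrow> real) \<Rightarrow> (nat \<Rightarrow> real \<Rightarrow> real) \<Rightarrow> real" where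
  "chain_objective m \<rho> l n t y F = 1 / real n * (\<Sum>i=1..n. \<rho> (y i - F 0 (t i))) + l * (l2_norm (F m))\<^sup>2"

lemma m_objective_eq_chain:
  "m_objective m \<rho> l n t y f = chain_objective m \<rho> l n t y (\<lambda>k. deriv01 k f)"
  unfolding m_objective_def chain_objective_def l2_norm_power2 by (simp add: deriv01_0)

lemma m_objective_chain:
  assumes "sob_chain m F" "m \<ge> 1"
  shows "m_objective m \<rho> l n t y (F 0) = chain_objective m \<rho> l n t y F"
  unfolding m_objective_eq_chain chain_objective_def
  using l2_norm_cong_negligible(2)[OF chain_sobolev(2)[OF assms] sob_chain_sq_int[OF assms(1) order_refl]]
  by (simp add: deriv01_0)

text \<open>The parallelogram law turns near-minimality into a Cauchy property of the top
  derivatives only; what remains is an iterated integral plus a polynomial. The polynomial is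
  controlled at the design points through coercivity of \<rho>, and the data term sees it nowhere
  else.\<close>

theorem m_smoothing_spline_exists:
  assumes m: "m \<ge> 1" and n: "n \<ge> 1" and l: "l > 0" and t: "\<And>i. i \<in> {1..n} \<Longrightarrow> t i \<in> {0..1}"
    and pos: "\<And>x. \<rho> x \<ge> 0" and conv: "convex_on UNIV \<rho>" and cont: "continuous_on UNIV \<rho>"
    and coercive: "\<And>B. \<exists>R. \<forall>x. \<rho> x \<le> B \<longrightarrow> \<bar>x\<bar> \<le> R"
  shows "\<exists>f. m_smoothing_spline m \<rho> l n t y f"
proof -
  let ?J = "m_objective m \<rho> l n t y" and ?C = "chain_objective m \<rho> l n t y"
  let ?W = "sobolev m 2"
  have C0: "?C F \<ge> 0" for F unfolding chain_objective_def using l pos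
    by (intro add_nonneg_nonneg mult_nonneg_nonneg sum_nonneg) auto
  have "sob_chain m (\<lambda>k. poly ((pderiv ^^ k) 0))" by (rule poly_chain) (simp add: deg_lt_def)
  from chain_sobolev(3)[OF this m] have ne: "?W \<noteq> {}" by auto
  define I where "I = (INF f\<in>?W. ?J f)"
  have bdd: "bdd_below (?J ` ?W)" using C0 by (auto simp: m_objective_eq_chain intro!: bdd_belowI[of _ 0])
  have Ile: "I \<le> ?J f" if "f \<in> ?W" for f unfolding I_def using bdd that by (rule cINF_lower)
  \<comment> \<open>A gap of \<open>(1/4) ^ k\<close> becomes the rate \<open>(1/2) ^ k\<close>
    after taking a square root.\<close>
  have "\<forall>k. \<exists>f\<in>?W. ?J f < I + (1/4)^k"
  proof
    fix k :: nat
    have "I < I + (1/4)^k" by simp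
    then show "\<exists>f\<in>?W. ?J f < I + (1/4)^k" unfolding I_def using cINF_less_iff[OF ne bdd] by blast
  qed
  then obtain f where f: "\<And>k. f k \<in> ?W" "\<And>k. ?J (f k) < I + (1/4)^k" by metis
  define F where "F = (\<lambda>k j. deriv01 j (f k))"
  have F: "sob_chain m (F k)" for k unfolding F_def by (rule sobolev_chain[OF f(1) m])
  have CF: "?C (F k) < I + (1/4)^k" for k using f(2) by (simp add: m_objective_eq_chain F_def)
  have IC: "I \<le> ?C G" if "sob_chain m G" for G
    using Ile[OF chain_sobolev(3)[OF that m]] m_objective_chain[OF that m] by simp
  have sqF: "sq_int (F k m)" for k using F[of k] by (simp add: sob_chain_def)
  have fast: "l2_norm (\<lambda>x. F (Suc k) m x - F k m x) \<le> (2 / sqrt l) * (1/2)^k" for k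
  proof -
    \<comment> \<open>The midpoint has objective at least \<open>I\<close>, while the parallelogram
      law gains \<open>l / 4 * ?D\<^sup>2\<close>.\<close>
    define G where "G = (\<lambda>j x. (1/2) * F (Suc k) j x + (1/2) * F k j x)"
    have G: "sob_chain m G" unfolding G_def by (rule sob_chain_lin[OF F F])
    let ?S = "\<lambda>H::nat\<Rightarrow>real\<Rightarrow>real. \<Sum>i=1..n. \<rho> (y i - H 0 (t i))"
    have "?S G \<le> (\<Sum>i=1..n. (1/2) * \<rho> (y i - F (Suc k) 0 (t i)) + (1/2) * \<rho> (y i - F k 0 (t i)))"
    proof (rule sum_mono)
      fix i
      have "y i - G 0 (t i) = (1 - 1/2) *\<^sub>R (y i - F (Suc k) 0 (t i)) + (1/2) *\<^sub>R (y i - F k 0 (t i))"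
        by (simp add: G_def algebra_simps)
      then show "\<rho> (y i - G 0 (t i)) \<le> (1/2) * \<rho> (y i - F (Suc k) 0 (t i)) + (1/2) * \<rho> (y i - F k 0 (t i))"
        using convex_onD[OF conv, of "1/2" "y i - F (Suc k) 0 (t i)" "y i - F k 0 (t i)"] by simp
    qed
    also have "\<dots> = (1/2) * ?S (F (Suc k)) + (1/2) * ?S (F k)" by (simp add: sum.distrib sum_distrib_left)
    finally have S: "1 / real n * ?S G \<le> 1 / real n * ((1/2) * ?S (F (Suc k)) + (1/2) * ?S (F k))"
      by (intro mult_left_mono) auto
    let ?a = "l2_norm (F (Suc k) m)" and ?b = "l2_norm (F k m)" and ?i = "l2_inner (F (Suc k) m) (F k m)"
    let ?D = "l2_norm (\<lambda>x. F (Suc k) m x - F k m x)"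
    have nG: "(l2_norm (G m))\<^sup>2 = ?a\<^sup>2 / 4 + ?i / 2 + ?b\<^sup>2 / 4"
      unfolding G_def using l2_norm_lin_power2[OF sqF sqF, of "1/2" "Suc k" "1/2" k] by (simp add: power2_eq_square)
    have nD: "?D\<^sup>2 = ?a\<^sup>2 - 2 * ?i + ?b\<^sup>2"
      using l2_norm_lin_power2[OF sqF sqF, of 1 "Suc k" "-1" k] by simp
    have "?C G \<le> (?C (F (Suc k)) + ?C (F k)) / 2 - l / 4 * ?D\<^sup>2"
    proof -
      have "1 / real n * ?S G \<le> (1 / real n * ?S (F (Suc k)) + 1 / real n * ?S (F k)) / 2"
        using S by (simp add: algebra_simps)
      moreover have "l * (?a\<^sup>2 / 4 + ?i / 2 + ?b\<^sup>2 / 4) = (l * ?a\<^sup>2 + l * ?b\<^sup>2) / 2 - l / 4 * (?a\<^sup>2 - 2 * ?i + ?b\<^sup>2)"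
        by (simp add: field_simps)
      moreover have "sg + q \<le> ((s1 + a) + (s2 + b)) / 2 - d" if "sg \<le> (s1 + s2) / 2" "q = (a + b) / 2 - d"
        for sg q s1 s2 a b d :: real using that by (simp add: field_simps)
      ultimately show ?thesis unfolding chain_objective_def nG nD by blast
    qed
    moreover have "d \<le> (e1 + e2) / 2" if "g \<le> (c1 + c2) / 2 - d" "I \<le> g" "c1 < I + e1" "c2 < I + e2"
      for g c1 c2 d e1 e2 :: real using that by (simp add: field_simps)
    ultimately have "l / 4 * ?D\<^sup>2 \<le> ((1/4)^Suc k + (1/4)^k) / 2"
      using IC[OF G] CF[of "Suc k"] CF[of k] by blast
    also have "\<dots> \<le> (1/4)^k" by simp
    finally have "?D\<^sup>2 \<le> 4 / l * (1/4)^k" using l by (simp add: field_simps)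
    also have "\<dots> = ((2 / sqrt l) * (1/2)^k)\<^sup>2"
      using l by (simp add: power_mult_distrib power_divide power_even_eq[symmetric] power_mult[symmetric] mult.commute[of k 2]) (simp add: power_mult)
    finally show ?thesis by (rule power2_le_imp_le) (use l in simp)
  qed
  obtain u where u: "sq_int u" "(\<lambda>k. LINT x|lebesgue_on {0..1}. \<bar>F k m x - u x\<bar>) \<longlonglongrightarrow> 0"
    and fatou: "\<And>r c a. strict_mono r \<Longrightarrow> (\<And>k. (l2_norm (F (r k) m))\<^sup>2 \<le> c k) \<Longrightarrow> c \<longlonglongrightarrow> a \<Longrightarrow> (l2_norm u)\<^sup>2 \<le> a"
    using sq_int_fast_Cauchy_limit[of "\<lambda>k. F k m", OF sqF fast] by blast
  \<comment> \<open>Same top derivative as \<open>F k\<close>, with vanishing initial values; the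
    difference is a polynomial by \<open>chain_zero_top_poly\<close>.\<close>
  define R where "R = (\<lambda>k j. iterated_integral (m - j) (F k m))"
  define R' where "R' = (\<lambda>j. iterated_integral (m - j) u)"
  have R: "sob_chain m (R k)" "sob_chain m R'" for k
    unfolding R_def R'_def using iterated_integral_chain sqF u(1) by auto
  have Rlim: "(\<lambda>k. R k 0 x) \<longlonglongrightarrow> R' 0 x" if "x \<in> {0..1}" for x
  proof -
    obtain p where p: "m = Suc p" using m by (cases m) auto
    have "\<bar>R k 0 x - R' 0 x\<bar> \<le> (LINT x|lebesgue_on {0..1}. \<bar>F k m x - u x\<bar>)" for k
      unfolding R_def R'_def p using iterated_integral_diff_bound[OF sqF[of k, unfolded p] u(1) that, of p] by simp
    then have "(\<lambda>k. R k 0 x - R' 0 x) \<longlonglongrightarrow> 0" by (intro Lim_null_comparison[OF _ u(2)]) auto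
    then show ?thesis by (rule LIM_zero_cancel)
  qed
  have "\<exists>P. deg_lt m P \<and> (\<forall>x\<in>{0..1}. F k 0 x - R k 0 x = poly P x)" for k
    using chain_zero_top_poly[OF sob_chain_lin[OF F[of k] R(1)[of k], of 1 "-1"]] by (simp add: R_def)
  then obtain P where P: "\<And>k. deg_lt m (P k)" "\<And>k x. x \<in> {0..1} \<Longrightarrow> F k 0 x - R k 0 x = poly (P k) x" by metis
  define T where "T = t ` {1..n}"
  have T: "finite T" "T \<subseteq> {0..1}" using t by (auto simp: T_def)
  obtain S where S: "S \<subseteq> T" "card S \<le> m"
    and interp: "\<And>P x. deg_lt m P \<Longrightarrow> x \<in> T \<Longrightarrow> poly P x = (\<Sum>s\<in>S. poly P s * poly (lagrange_basis S s) x)"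
    by (rule lagrange_nodes[OF T(1)]) blast
  have finS: "finite S" using S T finite_subset by blast
  have Fbd: "\<exists>B. \<forall>k. \<bar>F k 0 x\<bar> \<le> B" if "x \<in> T" for x
  proof -
    obtain i where i: "i \<in> {1..n}" "x = t i" using \<open>x \<in> T\<close> by (auto simp: T_def)
    \<comment> \<open>Each summand of the data term is at most n times the objective, which is at
      most \<open>I + 1\<close> along the sequence.\<close>
    obtain Q where Q: "\<And>z. \<rho> z \<le> real n * (I + 1) \<Longrightarrow> \<bar>z\<bar> \<le> Q" using coercive by blast
    have "\<bar>F k 0 x\<bar> \<le> \<bar>y i\<bar> + Q" for k
    proof -
      have "\<rho> (y i - F k 0 (t i)) \<le> (\<Sum>i=1..n. \<rho> (y i - F k 0 (t i)))"
        using i pos by (intro member_le_sum) auto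
      also have "\<dots> = real n * (1 / real n * (\<Sum>i=1..n. \<rho> (y i - F k 0 (t i))))" using n by simp
      also have "\<dots> \<le> real n * ?C (F k)" unfolding chain_objective_def using l by (intro mult_left_mono) auto
      also have "\<dots> \<le> real n * (I + 1)"
      proof (rule mult_left_mono)
        have "(1/4::real)^k \<le> 1" by (simp add: power_le_one)
        then show "?C (F k) \<le> I + 1" using CF[of k] by linarith
      qed simp
      finally have "\<bar>y i - F k 0 (t i)\<bar> \<le> Q" by (rule Q)
      then show ?thesis unfolding i(2) by linarith
    qed
    then show ?thesis by blast
  qed
  have "\<exists>B. \<forall>k. \<bar>poly (P k) s\<bar> \<le> B" if "s \<in> S" for s
  proof -
    have s: "s \<in> T" "s \<in> {0..1}" using that S T by auto
    obtain B where B: "\<forall>k. \<bar>F k 0 s\<bar> \<le> B" using Fbd[OF s(1)] by blast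
    have "Bseq (\<lambda>k. R k 0 s)" using Rlim[OF s(2)] by (intro convergent_imp_Bseq) (auto simp: convergent_def)
    then obtain B' where B': "\<And>k. \<bar>R k 0 s\<bar> \<le> B'" by (auto simp: Bseq_def)
    have "\<bar>poly (P k) s\<bar> \<le> B + B'" for k
      using B[rule_format, of k] B'[of k] P(2)[OF s(2), of k] by linarith
    then show ?thesis by blast
  qed
  from finite_family_convergent_subseq[OF finS, of "\<lambda>k s. poly (P k) s", OF this]
  obtain r where r: "strict_mono r" "\<forall>s\<in>S. convergent (\<lambda>k. poly (P (r k)) s)" by blast
  then obtain v where v: "\<And>s. s \<in> S \<Longrightarrow> (\<lambda>k. poly (P (r k)) s) \<longlonglongrightarrow> v s" unfolding convergent_def by metis
  \<comment> \<open>Limit polynomial built from the limits at the nodes. With fewer than m distinct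
    design points it is one of several with these values.\<close>
  define Pl where "Pl = (\<Sum>s\<in>S. smult (v s) (lagrange_basis S s))"
  have Pl: "deg_lt m Pl" unfolding Pl_def using deg_lt_mono[OF deg_lt_lagrange_basis[OF finS] S(2)] by (intro deg_lt_sum)
  define H where "H = (\<lambda>j x. 1 * poly ((pderiv ^^ j) Pl) x + 1 * R' j x)"
  have H: "sob_chain m H" unfolding H_def by (rule sob_chain_lin[OF poly_chain(1)[OF Pl] R(2)])
  have Hm: "H m = u" unfolding H_def poly_chain(2)[OF Pl] by (simp add: R'_def)
  have lim: "(\<lambda>k. F (r k) 0 x) \<longlonglongrightarrow> H 0 x" if "x \<in> T" for x
  proof -
    have x: "x \<in> {0..1}" using that T by auto
    have "(\<lambda>k. (\<Sum>s\<in>S. poly (P (r k)) s * poly (lagrange_basis S s) x) + R (r k) 0 x) \<longlonglongrightarrow>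
        (\<Sum>s\<in>S. v s * poly (lagrange_basis S s) x) + R' 0 x"
      using LIMSEQ_subseq_LIMSEQ[OF Rlim[OF x] r(1)] v by (intro tendsto_intros) (auto simp: o_def)
    moreover have "F (r k) 0 x = (\<Sum>s\<in>S. poly (P (r k)) s * poly (lagrange_basis S s) x) + R (r k) 0 x" for k
      using P(2)[OF x, of "r k"] interp[OF P(1) that, of "r k"] by simp
    moreover have "H 0 x = (\<Sum>s\<in>S. v s * poly (lagrange_basis S s) x) + R' 0 x"
      by (simp add: H_def Pl_def poly_sum)
    ultimately show ?thesis by simp
  qed
  define A where "A = (\<lambda>k. 1 / real n * (\<Sum>i=1..n. \<rho> (y i - F (r k) 0 (t i))))"
  define A' where "A' = 1 / real n * (\<Sum>i=1..n. \<rho> (y i - H 0 (t i)))"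
  have rho_lim: "(\<lambda>k. \<rho> (z k)) \<longlonglongrightarrow> \<rho> z'" if "z \<longlonglongrightarrow> z'" for z z'
    using cont that by (intro isCont_tendsto_compose[of z' \<rho>]) (auto simp: continuous_on_eq_continuous_at)
  have Alim: "A \<longlonglongrightarrow> A'" unfolding A_def A'_def using lim
    by (intro tendsto_intros rho_lim) (auto simp: T_def)
  \<comment> \<open>The penalty is bounded by what the data term leaves of the nearly minimal
    objective; semicontinuity of the penalty and continuity of the data term combine in this single
    limit.\<close>
  have "(\<lambda>k. (I + (1/4)^(r k) - A k) / l) \<longlonglongrightarrow> (I + 0 - A') / l"
  proof (intro tendsto_intros Alim)
    have "(\<lambda>k. (1/4::real)^k) \<longlonglongrightarrow> 0" by (rule LIMSEQ_power_zero) simp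
    from LIMSEQ_subseq_LIMSEQ[OF this r(1)] show "(\<lambda>k. (1/4::real)^(r k)) \<longlonglongrightarrow> 0" by (simp add: o_def)
  qed (use l in simp)
  moreover have "(l2_norm (F (r k) m))\<^sup>2 \<le> (I + (1/4)^(r k) - A k) / l" for k
    using CF[of "r k"] l unfolding chain_objective_def A_def by (simp add: field_simps)
  ultimately have "(l2_norm u)\<^sup>2 \<le> (I + 0 - A') / l" 
    using fatou[OF r(1), of "\<lambda>k. (I + (1/4)^(r k) - A k) / l"] by blast
  then have "?C H \<le> I" unfolding chain_objective_def Hm A'_def[symmetric] using l by (simp add: field_simps)
  then have "?J (H 0) \<le> I" by (simp add: m_objective_chain[OF H m])
  then have "is_arg_min ?J (\<lambda>g. g \<in> ?W) (H 0)"
    unfolding is_arg_min_def using chain_sobolev(3)[OF H m] Ile by (meson leD order_trans)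
  then show ?thesis unfolding m_smoothing_spline_def by blast
qed

subsection \<open>Moments, chaining and subgradients\<close>

lemma (in prob_space) bounded_power_integrable:
  fixes X :: "'a \<Rightarrow> real"
  assumes "random_variable borel X" "\<And>\<omega>. \<omega> \<in> space M \<Longrightarrow> \<bar>X \<omega>\<bar> \<le> c"
  shows "integrable M (\<lambda>\<omega>. (X \<omega>)^p)"
proof (rule integrable_const_bound[where B="c^p"])
  show "AE \<omega> in M. norm ((X \<omega>)^p) \<le> c^p"
    using assms(2) by (intro AE_I2) (auto simp: power_abs intro!: power_mono)
qed (use assms in auto)

text \<open>Induction on the index set, expanding powers of the new variable plus the old sum. By
  independence and zero means all terms with a first power vanish; the mixed term of squares, with
  factor 6, fits into the growth of \<open>3 * (real (card I) * v)^2\<close>. Boundedness supplies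
  integrability of all powers.\<close>

lemma (in prob_space) moments_of_independent_sum:
  fixes X :: "'i \<Rightarrow> 'a \<Rightarrow> real"
  assumes "finite I" "indep_vars (\<lambda>_. borel) X I"
    and bd: "\<And>i \<omega>. i \<in> I \<Longrightarrow> \<omega> \<in> space M \<Longrightarrow> \<bar>X i \<omega>\<bar> \<le> c"
    and mean: "\<And>i. i \<in> I \<Longrightarrow> expectation (X i) = 0"
    and second: "\<And>i. i \<in> I \<Longrightarrow> expectation (\<lambda>\<omega>. (X i \<omega>)^2) \<le> v"
    and fourth: "\<And>i. i \<in> I \<Longrightarrow> expectation (\<lambda>\<omega>. (X i \<omega>)^4) \<le> w"
    and v: "0 \<le> v"
  shows "expectation (\<lambda>\<omega>. (\<Sum>i\<in>I. X i \<omega>)^2) \<le> real (card I) * v \<and>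
    expectation (\<lambda>\<omega>. (\<Sum>i\<in>I. X i \<omega>)^4) \<le> 3 * (real (card I) * v)^2 + real (card I) * w"
  using assms
proof (induction I rule: finite_induct)
  case empty
  show ?case by simp
next
  case (insert i I)
  let ?S = "\<lambda>\<omega>. \<Sum>i\<in>I. X i \<omega>" and ?X = "X i"
  have indI: "indep_vars (\<lambda>_. borel) X I" using insert.prems(1) by (rule indep_vars_subset) auto
  have IH: "expectation (\<lambda>\<omega>. (?S \<omega>)^2) \<le> real (card I) * v"
    "expectation (\<lambda>\<omega>. (?S \<omega>)^4) \<le> 3 * (real (card I) * v)^2 + real (card I) * w"
    using insert.IH[OF indI] insert.prems by auto
  have rv: "random_variable borel (X j)" if "j \<in> insert i I" for j
    using insert.prems(1) that unfolding indep_vars_def by blast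
  have Srv: "random_variable borel ?S" using rv by auto
  have Sbd: "\<bar>?S \<omega>\<bar> \<le> real (card I) * c" if "\<omega> \<in> space M" for \<omega>
  proof -
    have "\<bar>?S \<omega>\<bar> \<le> (\<Sum>i\<in>I. \<bar>X i \<omega>\<bar>)" by (rule sum_abs)
    also have "\<dots> \<le> (\<Sum>i\<in>I. c)" using insert.prems(2) that by (intro sum_mono) auto
    finally show ?thesis by simp
  qed
  have Xint: "integrable M (\<lambda>\<omega>. (?X \<omega>)^p)" for p
    using insert.prems(2) rv by (intro bounded_power_integrable) auto
  have Sint: "integrable M (\<lambda>\<omega>. (?S \<omega>)^p)" for p
    by (rule bounded_power_integrable[OF Srv Sbd])
  have ind: "indep_var borel ?X borel ?S" by (rule indep_vars_sum[OF insert.hyps insert.prems(1)])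
  have indp: "indep_var borel (\<lambda>\<omega>. (?X \<omega>)^p) borel (\<lambda>\<omega>. (?S \<omega>)^q)" for p q
    using indep_var_compose[OF ind, of "\<lambda>x. x^p" borel "\<lambda>x. x^q" borel] by (simp add: o_def)
  have E: "expectation (\<lambda>\<omega>. (?X \<omega>)^p * (?S \<omega>)^q) = expectation (\<lambda>\<omega>. (?X \<omega>)^p) * expectation (\<lambda>\<omega>. (?S \<omega>)^q)"
    and I: "integrable M (\<lambda>\<omega>. (?X \<omega>)^p * (?S \<omega>)^q)" for p q
    using indep_var_lebesgue_integral[OF indp[of p q] Xint Sint] indep_var_integrable[OF indp[of p q] Xint Sint] by auto
  have X1: "expectation (\<lambda>\<omega>. (?X \<omega>)^1) = 0" using insert.prems(3)[of i] by simp
  have S1: "expectation (\<lambda>\<omega>. (?S \<omega>)^1) = 0"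
  proof -
    have "integrable M (X j)" if "j \<in> I" for j
      using bounded_power_integrable[OF rv insert.prems(2), of j 1] that by auto
    then show ?thesis using insert.prems(3) by simp
  qed
  have card: "real (card (insert i I)) = real (card I) + 1" using insert.hyps by simp
  have S2nn: "0 \<le> expectation (\<lambda>\<omega>. (?S \<omega>)^2)" "0 \<le> expectation (\<lambda>\<omega>. (?X \<omega>)^2)" by simp_all
  have eq2: "(\<lambda>\<omega>. (\<Sum>j\<in>insert i I. X j \<omega>)^2) =
      (\<lambda>\<omega>. (?X \<omega>)^2 * (?S \<omega>)^0 + 2 * ((?X \<omega>)^1 * (?S \<omega>)^1) + (?X \<omega>)^0 * (?S \<omega>)^2)"
    using insert.hyps by (simp add: power2_eq_square algebra_simps)
  have "expectation (\<lambda>\<omega>. (\<Sum>j\<in>insert i I. X j \<omega>)^2) = expectation (\<lambda>\<omega>. (?X \<omega>)^2) + expectation (\<lambda>\<omega>. (?S \<omega>)^2)"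
    unfolding eq2 using I[of 2 0] I[of 1 1] I[of 0 2] E[of 2 0] E[of 1 1] E[of 0 2] X1 by (simp add: prob_space)
  also have "\<dots> \<le> v + real (card I) * v" using IH(1) insert.prems(4)[of i] by auto
  finally have 2: "expectation (\<lambda>\<omega>. (\<Sum>j\<in>insert i I. X j \<omega>)^2) \<le> real (card (insert i I)) * v"
    unfolding card by (simp add: algebra_simps)
  have eq4: "(\<lambda>\<omega>. (\<Sum>j\<in>insert i I. X j \<omega>)^4) =
      (\<lambda>\<omega>. (?X \<omega>)^4 * (?S \<omega>)^0 + 4 * ((?X \<omega>)^3 * (?S \<omega>)^1) + 6 * ((?X \<omega>)^2 * (?S \<omega>)^2)
        + 4 * ((?X \<omega>)^1 * (?S \<omega>)^3) + (?X \<omega>)^0 * (?S \<omega>)^4)"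
    using insert.hyps by (simp add: power4_eq_xxxx power3_eq_cube power2_eq_square algebra_simps)
  have "expectation (\<lambda>\<omega>. (\<Sum>j\<in>insert i I. X j \<omega>)^4) =
      expectation (\<lambda>\<omega>. (?X \<omega>)^4) + 6 * (expectation (\<lambda>\<omega>. (?X \<omega>)^2) * expectation (\<lambda>\<omega>. (?S \<omega>)^2)) + expectation (\<lambda>\<omega>. (?S \<omega>)^4)"
    unfolding eq4 using I[of 4 0] I[of 3 1] I[of 2 2] I[of 1 3] I[of 0 4] E[of 4 0] E[of 3 1] E[of 2 2] E[of 1 3] E[of 0 4] X1 S1
    by (simp add: prob_space)
  also have "\<dots> \<le> w + 6 * (v * (real (card I) * v)) + (3 * (real (card I) * v)^2 + real (card I) * w)"
    using IH insert.prems(4,5)[of i] S2nn v by (intro add_mono mult_left_mono mult_mono) auto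
  also have "\<dots> \<le> 3 * (real (card (insert i I)) * v)^2 + real (card (insert i I)) * w"
    unfolding card by (simp add: power2_eq_square algebra_simps)
  finally show ?case using 2 by blast
qed

text \<open>Off the diagonal, independence and zero means give expectation 0. Only square
  integrability is available here, since the scores themselves need not be bounded.\<close>

lemma (in prob_space) quadratic_form_expectation:
  fixes X :: "'i \<Rightarrow> 'a \<Rightarrow> real"
  assumes I: "finite I" "indep_vars (\<lambda>_. borel) X I"
    and int: "\<And>i. i \<in> I \<Longrightarrow> integrable M (X i)" "\<And>i. i \<in> I \<Longrightarrow> integrable M (\<lambda>\<omega>. (X i \<omega>)\<^sup>2)"
    and mean: "\<And>i. i \<in> I \<Longrightarrow> expectation (X i) = 0"
    and second: "\<And>i. i \<in> I \<Longrightarrow> expectation (\<lambda>\<omega>. (X i \<omega>)\<^sup>2) \<le> v"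
    and c: "\<And>i. i \<in> I \<Longrightarrow> 0 \<le> c i i" "\<And>i. i \<in> I \<Longrightarrow> c i i \<le> C" and v: "0 \<le> v"
  shows "integrable M (\<lambda>\<omega>. \<Sum>i\<in>I. \<Sum>j\<in>I. X i \<omega> * X j \<omega> * c i j)"
    "expectation (\<lambda>\<omega>. \<Sum>i\<in>I. \<Sum>j\<in>I. X i \<omega> * X j \<omega> * c i j) \<le> real (card I) * (v * C)"
proof -
  have prod: "integrable M (\<lambda>\<omega>. X i \<omega> * X j \<omega>) \<and> expectation (\<lambda>\<omega>. X i \<omega> * X j \<omega>) = 0"
    if ij: "i \<in> I" "j \<in> I" "i \<noteq> j" for i j
  proof -
    have ind: "indep_vars (\<lambda>_. borel) X {i,j}" using I(2) by (rule indep_vars_subset) (use ij in auto)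
    show ?thesis
      using indep_vars_lebesgue_integral[OF _ ind] indep_vars_integrable[OF _ ind] int mean ij by auto
  qed
  have ii: "integrable M (\<lambda>\<omega>. X i \<omega> * X j \<omega> * c i j)" if "i \<in> I" "j \<in> I" for i j
    using prod[OF that] int(2)[OF that(1)] by (cases "i = j") (auto simp: power2_eq_square)
  then show "integrable M (\<lambda>\<omega>. \<Sum>i\<in>I. \<Sum>j\<in>I. X i \<omega> * X j \<omega> * c i j)" by auto
  have "expectation (\<lambda>\<omega>. \<Sum>i\<in>I. \<Sum>j\<in>I. X i \<omega> * X j \<omega> * c i j) = (\<Sum>i\<in>I. \<Sum>j\<in>I. expectation (\<lambda>\<omega>. X i \<omega> * X j \<omega> * c i j))"
    using ii by simp
  also have "\<dots> = (\<Sum>i\<in>I. \<Sum>j\<in>I. if j = i then expectation (\<lambda>\<omega>. (X i \<omega>)\<^sup>2) * c i i else 0)"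
    using prod by (intro sum.cong refl) (auto simp: power2_eq_square)
  also have "\<dots> = (\<Sum>i\<in>I. expectation (\<lambda>\<omega>. (X i \<omega>)\<^sup>2) * c i i)" using I(1) by simp
  also have "\<dots> \<le> (\<Sum>i\<in>I. v * C)"
    using second c v by (intro sum_mono mult_mono) auto
  finally show "expectation (\<lambda>\<omega>. \<Sum>i\<in>I. \<Sum>j\<in>I. X i \<omega> * X j \<omega> * c i j) \<le> real (card I) * (v * C)" by simp
qed

section \<open>Chaining along dyadic blocks\<close>

lemma bounded_borel_integrable_on:
  fixes q :: "real \<Rightarrow> real"
  assumes "q \<in> borel_measurable borel" "\<And>s. s \<in> {a..b} \<Longrightarrow> \<bar>q s\<bar> \<le> B"
  shows "q integrable_on {a..b}"
proof (rule measurable_bounded_by_integrable_imp_integrable_real[where g="\<lambda>_. B"])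
  show "q \<in> borel_measurable (lebesgue_on {a..b})"
    using assms(1) by (intro measurable_restrict_space1 measurable_completion) simp
qed (use assms in auto)

text \<open>The base point -a lies left of all arguments, so that
  \<open>prim a q u - prim a q 0\<close> is the oriented integral from 0 to u for either sign of
  u.\<close>

definition prim :: "real \<Rightarrow> (real \<Rightarrow> real) \<Rightarrow> real \<Rightarrow> real" where
  "prim a q u = integral {-a..u} q"

lemma prim_diff:
  assumes "q \<in> borel_measurable borel" "\<And>s. s \<in> {-a..a} \<Longrightarrow> \<bar>q s\<bar> \<le> B" "-a \<le> v" "v \<le> u" "u \<le> a"
  shows "prim a q u - prim a q v = integral {v..u} q"
proof -
  have "q integrable_on {-a..u}" using assms by (intro bounded_borel_integrable_on[where B=B]) auto
  from Henstock_Kurzweil_Integration.integral_combine[OF assms(3,4) this] show ?thesis by (simp add: prim_def)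
qed

lemma prim_add:
  assumes q: "q \<in> borel_measurable borel" "\<And>s. s \<in> {-a..a} \<Longrightarrow> \<bar>q s\<bar> \<le> B"
    and r: "r \<in> borel_measurable borel" "\<And>s. s \<in> {-a..a} \<Longrightarrow> \<bar>r s\<bar> \<le> B'" and u: "u \<le> a"
  shows "prim a (\<lambda>s. q s + r s) u = prim a q u + prim a r u"
  unfolding prim_def using assms
  by (intro Henstock_Kurzweil_Integration.integral_add bounded_borel_integrable_on[where B=B] bounded_borel_integrable_on[where B=B']) auto

text \<open>Splits at |x| = \<theta>. In the chaining the constant part is paid for by total
  variation and the quartic part by moments.\<close>

lemma abs_le_fourth_power:
  fixes x \<theta> :: real assumes "\<theta> > 0" shows "\<bar>x\<bar> \<le> \<theta> + x^4 / \<theta>^3"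
proof (cases "\<bar>x\<bar> \<le> \<theta>")
  case True
  then show ?thesis using assms by (simp add: add_increasing2)
next
  case False
  then have "\<theta>^3 \<le> \<bar>x\<bar>^3" using assms by (intro power_mono) auto
  then have "\<bar>x\<bar> * \<theta>^3 \<le> \<bar>x\<bar> * \<bar>x\<bar>^3" by (intro mult_left_mono) auto
  also have "\<dots> = x^4" by (simp add: power4_eq_xxxx power3_eq_cube abs_mult[symmetric])
  finally have "\<bar>x\<bar> \<le> x^4 / \<theta>^3" using assms by (simp add: pos_le_divide_eq)
  then show ?thesis using assms by simp
qed

text \<open>The quartic term is integrated over the whole range, so it does not depend on u and v;
  this makes the chaining uniform over all perturbations.\<close>

lemma prim_diff_bound:
  assumes q: "q \<in> borel_measurable borel" "\<And>s. s \<in> {-a..a} \<Longrightarrow> \<bar>q s\<bar> \<le> B"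
    and uv: "u \<in> {-a..a}" "v \<in> {-a..a}" and \<theta>: "\<theta> > 0"
  shows "\<bar>prim a q u - prim a q v\<bar> \<le> \<theta> * \<bar>u - v\<bar> + integral {-a..a} (\<lambda>s. (q s)^4) / \<theta>^3"
proof -
  have q4: "(\<lambda>s. (q s)^4) integrable_on {c..d}" if "-a \<le> c" "d \<le> a" for c d
  proof (rule bounded_borel_integrable_on[where B="B^4"])
    fix s assume "s \<in> {c..d}"
    then have "\<bar>q s\<bar> \<le> B" using q(2) that by auto
    then show "\<bar>(q s)^4\<bar> \<le> B^4" unfolding power_abs by (intro power_mono) auto
  qed (use q(1) in simp)
  have main: "\<bar>prim a q u - prim a q v\<bar> \<le> \<theta> * \<bar>u - v\<bar> + integral {-a..a} (\<lambda>s. (q s)^4) / \<theta>^3"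
    if "-a \<le> v" "v \<le> u" "u \<le> a" for u v
  proof -
    have "norm (integral {v..u} q) \<le> integral {v..u} (\<lambda>s. \<theta> + (q s)^4 / \<theta>^3)"
    proof (rule integral_norm_bound_integral)
      show "q integrable_on {v..u}" using q that by (intro bounded_borel_integrable_on[where B=B]) auto
      show "(\<lambda>s. \<theta> + (q s)^4 / \<theta>^3) integrable_on {v..u}"
        using q4[OF that(1,3)] by (intro integrable_add integrable_on_divide) auto
      show "norm (q s) \<le> \<theta> + (q s)^4 / \<theta>^3" for s using abs_le_fourth_power[OF \<theta>] by simp
    qed
    also have "\<dots> = \<theta> * (u - v) + integral {v..u} (\<lambda>s. (q s)^4) / \<theta>^3"
      using q4[OF that(1,3)] that by (subst Henstock_Kurzweil_Integration.integral_add) (auto intro!: integrable_on_divide)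
    also have "integral {v..u} (\<lambda>s. (q s)^4) \<le> integral {-a..a} (\<lambda>s. (q s)^4)"
      using q4[OF that(1,3)] q4[OF order_refl order_refl] that by (intro integral_subset_le) auto
    finally have "\<bar>integral {v..u} q\<bar> \<le> \<theta> * (u - v) + integral {-a..a} (\<lambda>s. (q s)^4) / \<theta>^3"
      using \<theta> by (simp add: divide_right_mono)
    moreover have "prim a q u - prim a q v = integral {v..u} q" by (rule prim_diff[OF q that])
    moreover have "\<bar>u - v\<bar> = u - v" using that by simp
    ultimately show ?thesis by (simp only:)
  qed
  show ?thesis
  proof (cases "v \<le> u")
    case True
    then show ?thesis using main[of v u] uv by auto
  next
    case False
    then show ?thesis using main[of u v] uv by (auto simp: abs_minus_commute)
  qed
qed

lemma sum_even_odd: "(\<Sum>j<2 * (n::nat). f j) = (\<Sum>j<n. f (2 * j) + (f (2 * j + 1) :: real))"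
  by (induction n) (auto simp: algebra_simps)

lemma sum_disjoint_increments_le:
  fixes G :: "nat \<Rightarrow> real"
  assumes "mono G" shows "(\<Sum>j<n. G ((2 * j + 1) * p) - G (2 * j * p)) \<le> G (2 * n * p) - G 0"
proof (induction n)
  case (Suc n)
  have "G ((2 * n + 1) * p) \<le> G (2 * Suc n * p)" using assms by (intro monoD[OF assms] mult_right_mono) auto
  then show ?case using Suc by simp
qed simp

text \<open>The functions are split along the dyadic tree of blocks of consecutive indices. At each level the
  increment of \<open>x\<close> between neighbouring block representatives is charged to the total variation, and the
  block sum is controlled by its fourth power, which is integrated over the whole range of \<open>x\<close>:
  the resulting bound does not depend on \<open>x\<close> except through \<open>V\<close> and the coarsest level.\<close>

lemma dyadic_chaining:
  fixes z :: "nat \<Rightarrow> real \<Rightarrow> real" and x G :: "nat \<Rightarrow> real"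
  assumes z: "\<And>i. z i \<in> borel_measurable borel" "\<And>i s. s \<in> {-a..a} \<Longrightarrow> \<bar>z i s\<bar> \<le> B"
    and x: "\<And>i. x i \<in> {-a..a}" and G: "mono G" "\<And>i. 0 \<le> G i" "\<And>i. G i \<le> V"
    and xG: "\<And>i j. i \<le> j \<Longrightarrow> \<bar>x i - x j\<bar> \<le> G j - G i" and \<theta>: "\<theta> > 0" and a: "a > 0"
  defines "S \<equiv> \<lambda>k j s. \<Sum>i\<in>{j * 2^k..<Suc j * 2^k}. z i s"
  shows "\<bar>\<Sum>i<J * 2^K. prim a (z i) (x i) - prim a (z i) 0\<bar> \<le>
    \<theta> * (real K * V + (\<Sum>j<J. \<bar>x (j * 2^K)\<bar>)) +
    (\<Sum>k\<le>K. \<Sum>j<J * 2^(K - k). integral {-a..a} (\<lambda>s. (S k j s)^4)) / \<theta>^3"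
proof -
  \<comment> \<open>Level-k approximation: every block is evaluated at the value of x at its first
    index. \<open>A 0\<close> is the sum to be bounded and \<open>A K\<close> the coarsest
    one.\<close>
  define A where "A = (\<lambda>k. \<Sum>j<J * 2^(K - k). prim a (S k j) (x (j * 2^k)) - prim a (S k j) 0)"
  define X where "X = (\<lambda>k. \<Sum>j<J * 2^(K - k). integral {-a..a} (\<lambda>s. (S k j s)^4))"
  have Sm: "S k j \<in> borel_measurable borel" for k j unfolding S_def using z(1) by measurable
  have SB: "\<bar>S k j s\<bar> \<le> real (2^k) * B" if "s \<in> {-a..a}" for k j s
  proof -
    have "\<bar>S k j s\<bar> \<le> (\<Sum>i\<in>{j * 2^k..<Suc j * 2^k}. \<bar>z i s\<bar>)" unfolding S_def by (rule sum_abs)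
    also have "\<dots> \<le> (\<Sum>i\<in>{j * 2^k..<Suc j * 2^k}. B)" using z(2)[OF that] by (intro sum_mono) auto
    finally show ?thesis by simp
  qed
  have S4: "0 \<le> integral {-a..a} (\<lambda>s. (S k j s)^4)" for k j
    by (cases "(\<lambda>s. (S k j s)^4) integrable_on {-a..a}") (auto intro: integral_nonneg simp: not_integrable_integral)
  have S0: "S 0 j = z j" for j by (auto simp: S_def)
  have SS: "S (Suc k) j = (\<lambda>s. S k (2 * j) s + S k (2 * j + 1) s)" for k j
  proof
    fix s
    have 1: "2 * j * 2^k = j * 2^Suc k" "Suc (2 * j + 1) * 2^k = Suc j * 2^Suc k"
      "Suc (2 * j) * 2 ^ k = (2 * j + 1) * 2 ^ k" by simp_all
    have "2 * j * 2^k \<le> (2 * j + 1) * 2^k" "(2 * j + 1) * 2^k \<le> Suc (2 * j + 1) * 2^k" by simp_all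
    from sum.atLeastLessThan_concat[OF this, of "\<lambda>i. z i s"]
    show "S (Suc k) j s = S k (2 * j) s + S k (2 * j + 1) s" unfolding S_def 1 by simp
  qed
  have zero: "(0::real) \<in> {-a..a}" using a by simp
  have step: "\<bar>A k - A (Suc k)\<bar> \<le> \<theta> * V + X k / \<theta>^3" if "k < K" for k
  proof -
    define N where "N = J * 2^(K - Suc k)"
    have N2: "J * 2^(K - k) = 2 * N" using that by (simp add: N_def Suc_diff_Suc[symmetric])
    have "A k = (\<Sum>j<N. (prim a (S k (2*j)) (x (2*j * 2^k)) - prim a (S k (2*j)) 0) +
        (prim a (S k (2*j+1)) (x ((2*j+1) * 2^k)) - prim a (S k (2*j+1)) 0))"
      unfolding A_def N2 sum_even_odd ..
    moreover have "A (Suc k) = (\<Sum>j<N. (prim a (S k (2*j)) (x (2*j * 2^k)) - prim a (S k (2*j)) 0) +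
        (prim a (S k (2*j+1)) (x (2*j * 2^k)) - prim a (S k (2*j+1)) 0))"
      unfolding A_def N_def[symmetric]
    proof (intro sum.cong refl)
      fix j
      have e: "prim a (S (Suc k) j) u = prim a (S k (2*j)) u + prim a (S k (2*j+1)) u" if "u \<in> {-a..a}" for u
        unfolding SS using prim_add[OF Sm SB Sm SB] that by simp
      have eq: "j * 2 ^ Suc k = 2 * j * 2^k" by simp
      show "prim a (S (Suc k) j) (x (j * 2 ^ Suc k)) - prim a (S (Suc k) j) 0 =
         prim a (S k (2 * j)) (x (2 * j * 2 ^ k)) - prim a (S k (2 * j)) 0 +
         (prim a (S k (2 * j + 1)) (x (2 * j * 2 ^ k)) - prim a (S k (2 * j + 1)) 0)"
        unfolding eq e[OF zero] e[OF x] by simp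
    qed
    \<comment> \<open>The even child begins at the same index as its parent, so only the odd
      children contribute.\<close>
    ultimately have diff: "A k - A (Suc k)
      = (\<Sum>j<N. prim a (S k (2*j+1)) (x ((2*j+1) * 2^k)) - prim a (S k (2*j+1)) (x (2*j * 2^k)))"
      by (simp add: sum_subtractf[symmetric])
    have "\<bar>A k - A (Suc k)\<bar> \<le> (\<Sum>j<N. \<bar>prim a (S k (2*j+1)) (x ((2*j+1) * 2^k)) - prim a (S k (2*j+1)) (x (2*j * 2^k))\<bar>)"
      unfolding diff by (rule sum_abs)
    also have "\<dots> \<le> (\<Sum>j<N. \<theta> * (G ((2*j+1) * 2^k) - G (2*j * 2^k)) + integral {-a..a} (\<lambda>s. (S k (2*j+1) s)^4) / \<theta>^3)"
    proof (rule sum_mono)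
      fix j
      have "\<bar>x ((2*j+1) * 2^k) - x (2*j * 2^k)\<bar> \<le> G ((2*j+1) * 2^k) - G (2*j * 2^k)"
        by (subst abs_minus_commute) (intro xG mult_right_mono, auto)
      then have "\<theta> * \<bar>x ((2*j+1) * 2^k) - x (2*j * 2^k)\<bar> \<le> \<theta> * (G ((2*j+1) * 2^k) - G (2*j * 2^k))"
        using \<theta> by (intro mult_left_mono) auto
      then show "\<bar>prim a (S k (2*j+1)) (x ((2*j+1) * 2^k)) - prim a (S k (2*j+1)) (x (2*j * 2^k))\<bar> \<le>
         \<theta> * (G ((2*j+1) * 2^k) - G (2*j * 2^k)) + integral {-a..a} (\<lambda>s. (S k (2*j+1) s)^4) / \<theta>^3"
        using prim_diff_bound[OF Sm[where k=k and j="2*j+1"] SB[where k=k and j="2*j+1"] x[of "(2*j+1) * 2^k"] x[of "2*j * 2^k"] \<theta>]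
        by linarith
    qed
    also have "\<dots> = \<theta> * (\<Sum>j<N. G ((2*j+1) * 2^k) - G (2*j * 2^k)) + (\<Sum>j<N. integral {-a..a} (\<lambda>s. (S k (2*j+1) s)^4)) / \<theta>^3"
      by (simp add: sum.distrib sum_distrib_left sum_divide_distrib)
    also have "\<dots> \<le> \<theta> * V + X k / \<theta>^3"
    proof (intro add_mono mult_left_mono divide_right_mono)
      \<comment> \<open>The index ranges are disjoint, so one level costs V in total, not V per
        block.\<close>
      show "(\<Sum>j<N. G ((2*j+1) * 2^k) - G (2*j * 2^k)) \<le> V"
        using sum_disjoint_increments_le[OF G(1), where n=N and p="2^k"] G(2)[of 0] G(3)[of "2 * N * 2^k"] by linarith
      show "(\<Sum>j<N. integral {-a..a} (\<lambda>s. (S k (2*j+1) s)^4)) \<le> X k"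
        unfolding X_def N2 sum_even_odd using S4 by (intro sum_mono) auto
    qed (use \<theta> in auto)
    finally show ?thesis .
  qed
  have tel: "\<bar>A 0 - A k\<bar> \<le> (\<Sum>i<k. \<theta> * V + X i / \<theta>^3)" if "k \<le> K" for k
    using that
  proof (induction k)
    case (Suc k)
    then show ?case using step[of k] by simp
  qed simp
  have "\<bar>A K\<bar> \<le> (\<Sum>j<J. \<bar>prim a (S K j) (x (j * 2^K)) - prim a (S K j) 0\<bar>)"
    unfolding A_def by (simp add: sum_abs)
  also have "\<dots> \<le> (\<Sum>j<J. \<theta> * \<bar>x (j * 2^K)\<bar> + integral {-a..a} (\<lambda>s. (S K j s)^4) / \<theta>^3)"
    using prim_diff_bound[OF Sm SB x zero \<theta>] by (intro sum_mono) simp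
  also have "\<dots> = \<theta> * (\<Sum>j<J. \<bar>x (j * 2^K)\<bar>) + X K / \<theta>^3"
    by (simp add: X_def sum.distrib sum_distrib_left sum_divide_distrib)
  finally have AK: "\<bar>A K\<bar> \<le> \<theta> * (\<Sum>j<J. \<bar>x (j * 2^K)\<bar>) + X K / \<theta>^3" .
  have "A 0 = (\<Sum>i<J * 2^K. prim a (z i) (x i) - prim a (z i) 0)" unfolding A_def S0 by simp
  moreover have "(\<Sum>i<K. \<theta> * V + X i / \<theta>^3) = \<theta> * (real K * V) + (\<Sum>i<K. X i) / \<theta>^3"
    by (simp add: sum.distrib sum_divide_distrib)
  moreover have "(\<Sum>k\<le>K. X k) = (\<Sum>i<K. X i) + X K" by (simp add: lessThan_Suc_atMost[symmetric])
  ultimately show ?thesis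
    using tel[OF order_refl] AK unfolding X_def by (simp add: algebra_simps add_divide_distrib)
qed

text \<open>Within a block x varies by at most the increment of G, so the absolute value of the
  representative exceeds the block average by no more than that; the increments telescope.\<close>

lemma block_representatives_le_average:
  fixes x G :: "nat \<Rightarrow> real"
  assumes G: "mono G" "\<And>i. 0 \<le> G i" "\<And>i. G i \<le> V"
    and xG: "\<And>i j. i \<le> j \<Longrightarrow> \<bar>x i - x j\<bar> \<le> G j - G i" and p: "p > 0"
  shows "(\<Sum>j<J. \<bar>x (j * p)\<bar>) \<le> (\<Sum>i<J * p. \<bar>x i\<bar>) / real p + V"
proof -
  have blk: "\<bar>x (j * p)\<bar> \<le> (\<Sum>i\<in>{j * p..<j * p + p}. \<bar>x i\<bar>) / real p + (G (Suc j * p) - G (j * p))" for j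
  proof -
    have "real p * \<bar>x (j * p)\<bar> = (\<Sum>i\<in>{j * p..<j * p + p}. \<bar>x (j * p)\<bar>)" by simp
    also have "\<dots> \<le> (\<Sum>i\<in>{j * p..<j * p + p}. \<bar>x i\<bar> + (G (Suc j * p) - G (j * p)))"
    proof (rule sum_mono)
      fix i assume i: "i \<in> {j * p..<j * p + p}"
      then have "\<bar>x (j * p) - x i\<bar> \<le> G i - G (j * p)" by (intro xG) auto
      moreover have "G i \<le> G (Suc j * p)" using i by (intro monoD[OF G(1)]) auto
      ultimately show "\<bar>x (j * p)\<bar> \<le> \<bar>x i\<bar> + (G (Suc j * p) - G (j * p))" by linarith
    qed
    also have "\<dots> = (\<Sum>i\<in>{j * p..<j * p + p}. \<bar>x i\<bar>) + real p * (G (Suc j * p) - G (j * p))"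
      by (simp add: sum.distrib)
    finally show ?thesis using p by (simp add: field_simps)
  qed
  have "(\<Sum>j<J. \<bar>x (j * p)\<bar>) \<le> (\<Sum>j<J. (\<Sum>i\<in>{j * p..<j * p + p}. \<bar>x i\<bar>) / real p + (G (Suc j * p) - G (j * p)))"
    by (intro sum_mono blk)
  also have "\<dots> = (\<Sum>i<J * p. \<bar>x i\<bar>) / real p + (\<Sum>j<J. G (Suc j * p) - G (j * p))"
    by (simp add: sum.distrib sum_divide_distrib[symmetric] sum.nat_group del: mult_Suc)
  also have "(\<Sum>j<J. G (Suc j * p) - G (j * p)) = G (J * p) - G 0"
    using sum_lessThan_telescope[of "\<lambda>j. G (j * p)" J] by simp
  also have "\<dots> \<le> V" using G(2)[of 0] G(3)[of "J * p"] by linarith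
  finally show ?thesis by simp
qed

section \<open>Subgradients of convex functions\<close>

lemma subgradient_selection_mono:
  assumes "subgradient_selection \<rho> \<psi>" shows "mono \<psi>"
proof (rule monoI)
  fix x y :: real assume "x \<le> y"
  have "\<rho> y \<ge> \<rho> x + \<psi> x * (y - x)" "\<rho> x \<ge> \<rho> y + \<psi> y * (x - y)"
    using assms unfolding subgradient_selection_def by blast+
  then have "0 \<le> (\<psi> y - \<psi> x) * (y - x)" by (simp add: algebra_simps)
  then show "\<psi> x \<le> \<psi> y" using \<open>x \<le> y\<close> by (cases "x = y") (auto simp: zero_le_mult_iff)
qed

lemma subgradient_selection_bounds:
  assumes "subgradient_selection \<rho> \<psi>"
  shows "\<psi> x * (y - x) \<le> \<rho> y - \<rho> x" "\<rho> y - \<rho> x \<le> \<psi> y * (y - x)"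
proof -
  have "\<rho> y \<ge> \<rho> x + \<psi> x * (y - x)" "\<rho> x \<ge> \<rho> y + \<psi> y * (x - y)"
    using assms unfolding subgradient_selection_def by blast+
  then show "\<psi> x * (y - x) \<le> \<rho> y - \<rho> x" "\<rho> y - \<rho> x \<le> \<psi> y * (y - x)" by (auto simp: algebra_simps)
qed

text \<open>\<rho> is Lipschitz on [a, b] and differentiable with derivative \<psi> wherever \<psi>
  is continuous. A monotone function has countably many discontinuities, so the choice of the
  subgradient does not affect the integral.\<close>

lemma subgradient_has_integral:
  assumes sub: "subgradient_selection \<rho> \<psi>" and "a \<le> b"
  shows "(\<psi> has_integral (\<rho> b - \<rho> a)) {a..b}"
proof (cases "a = b")
  case False
  then have ab: "a < b" using assms by simp
  have mono: "mono \<psi>" by (rule subgradient_selection_mono[OF sub])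
  \<comment> \<open>By monotonicity the end point values bound \<psi> on [a, b]; the added 1 makes
    \<open>L\<close> positive.\<close>
  define L where "L = \<bar>\<psi> a\<bar> + \<bar>\<psi> b\<bar> + 1"
  have lip: "\<bar>\<rho> v - \<rho> u\<bar> \<le> L * (v - u)" if "a \<le> u" "u \<le> v" "v \<le> b" for u v
  proof -
    have "\<psi> a \<le> \<psi> u" "\<psi> v \<le> \<psi> b" using that mono by (auto simp: mono_def)
    then have "- L \<le> \<psi> u" "\<psi> v \<le> L" by (auto simp: L_def)
    then have "- L * (v - u) \<le> \<psi> u * (v - u)" "\<psi> v * (v - u) \<le> L * (v - u)"
      using that mult_right_mono[of "- L" "\<psi> u" "v - u"] mult_right_mono[of "\<psi> v" L "v - u"] by auto
    then show ?thesis
      using subgradient_selection_bounds(1)[OF sub, of u v] subgradient_selection_bounds(2)[OF sub, where x=u and y=v] by auto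
  qed
  have L: "L > 0" by (simp add: L_def)
  have "absolutely_continuous_on {a..b} \<rho>"
    unfolding absolutely_continuous_on_nonoverlapping
  proof (intro allI impI)
    fix e :: real assume "e > 0"
    show "\<exists>d>0. \<forall>P. nonoverlapping a b P \<longrightarrow> (\<Sum>p\<in>P. snd p - fst p) < d \<longrightarrow> increments \<rho> P < e"
    proof (intro exI[of _ "e / L"] conjI allI impI)
      fix P assume P: "nonoverlapping a b P" "(\<Sum>p\<in>P. snd p - fst p) < e / L"
      have "increments \<rho> P \<le> (\<Sum>p\<in>P. L * (snd p - fst p))"
        unfolding increments_def using P(1) by (intro sum_mono lip) (auto simp: nonoverlapping_def less_imp_le)
      also have "\<dots> = L * (\<Sum>p\<in>P. snd p - fst p)" by (simp add: sum_distrib_left)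
      also have "\<dots> < e" using P(2) L by (simp add: field_simps)
      finally show "increments \<rho> P < e" .
    qed (use L \<open>e > 0\<close> in simp)
  qed
  from absolutely_continuous_on_FTC(2)[OF this ab order_refl assms(2) order_refl]
  have I: "((\<lambda>x. vector_derivative \<rho> (at x within {a..b})) has_integral (\<rho> b - \<rho> a)) {a..b}" .
  let ?N = "{x. \<not> isCont \<psi> x}"
  have N: "negligible ?N" 
    using countable_imp_null_set_lborel[OF mono_ctble_discont[OF mono]]
    by (simp add: negligible_iff_null_sets null_sets_completionI)
  show ?thesis
  proof (rule has_integral_spike[OF N _ I])
    fix x assume x: "x \<in> {a..b} - ?N"
    have "(\<rho> has_vector_derivative \<psi> x) (at x within {a..b})"
      unfolding has_vector_derivative_def has_derivative_within_alt
    proof (intro conjI allI impI)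
      show "bounded_linear (\<lambda>h. h *\<^sub>R \<psi> x)" by (rule bounded_linear_scaleR_left)
      fix e :: real assume "e > 0"
      then obtain d where d: "d > 0" "\<And>y. \<bar>y - x\<bar> < d \<Longrightarrow> \<bar>\<psi> y - \<psi> x\<bar> < e"
        using x by (auto simp: continuous_at_eps_delta dist_real_def)
      show "\<exists>d>0. \<forall>y\<in>{a..b}. norm (y - x) < d \<longrightarrow> norm (\<rho> y - \<rho> x - (y - x) *\<^sub>R \<psi> x) \<le> e * norm (y - x)"
      proof (intro exI[of _ d] conjI ballI impI)
        fix y assume "norm (y - x) < d"
        then have "\<bar>\<psi> y - \<psi> x\<bar> \<le> e" using d(2)[of y] by simp
        then have "\<bar>\<psi> y - \<psi> x\<bar> * \<bar>y - x\<bar> \<le> e * \<bar>y - x\<bar>" by (intro mult_right_mono) auto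
        moreover have "0 \<le> \<rho> y - \<rho> x - (y - x) * \<psi> x" "\<rho> y - \<rho> x - (y - x) * \<psi> x \<le> (\<psi> y - \<psi> x) * (y - x)"
          using subgradient_selection_bounds(1)[OF sub, of x y] subgradient_selection_bounds(2)[OF sub, where x=x and y=y]
          by (auto simp: algebra_simps)
        ultimately show "norm (\<rho> y - \<rho> x - (y - x) *\<^sub>R \<psi> x) \<le> e * norm (y - x)"
          using abs_ge_self[of "(\<psi> y - \<psi> x) * (y - x)"] by (simp add: abs_mult)
      qed fact
    qed
    then show "\<psi> x = vector_derivative \<rho> (at x within {a..b})"
      using vector_derivative_within_cbox[OF ab, of x \<rho> "\<psi> x"] x by simp
  qed
qed (use has_integral_refl(1)[of \<psi> b] in simp)

text \<open>For fixed e, the function \<open>\<rho> (e - s) + \<psi> e * s\<close> of s is convex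
  with subgradient \<open>\<psi> e - \<psi> (e - s)\<close>, so the integral formula for
  subgradients applies to it.\<close>

lemma bregman_eq_prim:
  assumes sub: "subgradient_selection \<rho> \<psi>" and u: "u \<in> {-a..a}"
  shows "\<rho> (e - u) - \<rho> e + \<psi> e * u = prim a (\<lambda>s. \<psi> e - \<psi> (e - s)) u - prim a (\<lambda>s. \<psi> e - \<psi> (e - s)) 0"
proof -
  have "subgradient_selection (\<lambda>s. \<rho> (e - s) + \<psi> e * s) (\<lambda>s. \<psi> e - \<psi> (e - s))"
    unfolding subgradient_selection_def
  proof (intro allI)
    fix x y
    have "\<rho> (e - x) + \<psi> (e - x) * ((e - y) - (e - x)) \<le> \<rho> (e - y)"
      using sub unfolding subgradient_selection_def by blast
    then show "\<rho> (e - x) + \<psi> e * x + (\<psi> e - \<psi> (e - x)) * (y - x) \<le> \<rho> (e - y) + \<psi> e * y"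
      by (simp add: algebra_simps)
  qed
  note I = subgradient_has_integral[OF this]
  have "prim a (\<lambda>s. \<psi> e - \<psi> (e - s)) w = \<rho> (e - w) + \<psi> e * w - (\<rho> (e - (-a)) + \<psi> e * (-a))" if "-a \<le> w" for w
    unfolding prim_def using I[OF that] by (rule integral_unique)
  from this[of u] this[of 0] u show ?thesis by simp
qed

text \<open>Supporting lines at p and q with slopes of opposite sign force growth in both
  directions.\<close>

lemma subgradient_coercive:
  assumes sub: "subgradient_selection \<rho> \<psi>" and p: "\<psi> p > 0" and q: "\<psi> q < 0"
  shows "\<exists>R. \<forall>x. \<rho> x \<le> B \<longrightarrow> \<bar>x\<bar> \<le> R"
proof (intro exI[of _ "\<bar>p\<bar> + \<bar>q\<bar> + (B - \<rho> p) / \<psi> p + (B - \<rho> q) / (- \<psi> q) + \<bar>(B - \<rho> p) / \<psi> p\<bar> + \<bar>(B - \<rho> q) / (- \<psi> q)\<bar>"] allI impI)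
  fix x assume "\<rho> x \<le> B"
  then have "\<psi> p * (x - p) \<le> B - \<rho> p" "(- \<psi> q) * (q - x) \<le> B - \<rho> q"
    using subgradient_selection_bounds(1)[OF sub, of p x] subgradient_selection_bounds(1)[OF sub, of q x]
      by (auto simp: algebra_simps)
  moreover have "- \<psi> q > 0" using q by simp
  ultimately have "x - p \<le> (B - \<rho> p) / \<psi> p" "q - x \<le> (B - \<rho> q) / (- \<psi> q)"
    unfolding pos_le_divide_eq[OF p] pos_le_divide_eq[OF \<open>- \<psi> q > 0\<close>] by (simp_all add: mult.commute)
  then show "\<bar>x\<bar> \<le> \<bar>p\<bar> + \<bar>q\<bar> + (B - \<rho> p) / \<psi> p + (B - \<rho> q) / (- \<psi> q) + \<bar>(B - \<rho> p) / \<psi> p\<bar> + \<bar>(B - \<rho> q) / (- \<psi> q)\<bar>"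
    by linarith
qed

subsection \<open>Stochastic bounds for the scores\<close>

lemma sq_int_sum:
  "finite I \<Longrightarrow> (\<And>i. i \<in> I \<Longrightarrow> sq_int (f i)) \<Longrightarrow> sq_int (\<lambda>x. \<Sum>i\<in>I. c i * f i x)"
proof (induction I rule: finite_induct)
  case empty
  show ?case using sq_int_continuous[of "\<lambda>_. 0"] by simp
next
  case (insert i I)
  then show ?case using sq_int_lin[of "f i" "\<lambda>x. \<Sum>i\<in>I. c i * f i x" "c i" 1] by simp
qed

lemma l2_inner_sum_left:
  assumes "finite I" "\<And>i. i \<in> I \<Longrightarrow> sq_int (f i)" "sq_int g"
  shows "l2_inner (\<lambda>x. \<Sum>i\<in>I. c i * f i x) g = (\<Sum>i\<in>I. c i * l2_inner (f i) g)"
  using assms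
proof (induction I rule: finite_induct)
  case empty
  show ?case by (simp add: l2_inner_def)
next
  case (insert i I)
  then show ?case
    using l2_inner_lin[of "f i" "\<lambda>x. \<Sum>i\<in>I. c i * f i x" g "c i" 1] sq_int_sum[of I f c] by simp
qed

lemma l2_norm_sum_power2:
  assumes "finite I" "\<And>i. i \<in> I \<Longrightarrow> sq_int (f i)"
  shows "(l2_norm (\<lambda>x. \<Sum>i\<in>I. c i * f i x))\<^sup>2 = (\<Sum>i\<in>I. \<Sum>j\<in>I. c i * c j * l2_inner (f i) (f j))"
proof -
  let ?s = "\<lambda>x. \<Sum>i\<in>I. c i * f i x"
  have s: "sq_int ?s" using sq_int_sum[OF assms] by simp
  have "(l2_norm ?s)\<^sup>2 = l2_inner ?s ?s" unfolding l2_norm_power2 l2_inner_def by (simp add: power2_eq_square)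
  also have "\<dots> = (\<Sum>i\<in>I. c i * l2_inner (f i) ?s)" by (rule l2_inner_sum_left[OF assms s])
  also have "\<dots> = (\<Sum>i\<in>I. c i * (\<Sum>j\<in>I. c j * l2_inner (f i) (f j)))"
  proof (intro sum.cong refl)
    fix i assume i: "i \<in> I"
    have "l2_inner (f i) ?s = l2_inner ?s (f i)" by (rule l2_inner_commute)
    also have "\<dots> = (\<Sum>j\<in>I. c j * l2_inner (f j) (f i))" by (rule l2_inner_sum_left[OF assms]) (use assms i in auto)
    finally show "c i * l2_inner (f i) ?s = c i * (\<Sum>j\<in>I. c j * l2_inner (f i) (f j))"
      by (simp add: l2_inner_commute)
  qed
  finally show ?thesis by (simp add: sum_distrib_left mult.assoc)
qed

lemma nn_integral_interval_eq_integral: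
  fixes f :: "real \<Rightarrow> real"
  assumes "f \<in> borel_measurable borel" "\<And>s. 0 \<le> f s" "f integrable_on {a..b}"
  shows "(\<integral>\<^sup>+s. ennreal (f s) * indicator {a..b} s \<partial>lborel) = ennreal (integral {a..b} f)"
proof -
  have "((\<lambda>s. if s \<in> {a..b} then f s else 0) has_integral (integral {a..b} f)) UNIV"
    using assms(3) by (simp only: has_integral_restrict_UNIV integrable_integral)
  then have "(\<integral>\<^sup>+s. ennreal (if s \<in> {a..b} then f s else 0) \<partial>lborel) = ennreal (integral {a..b} f)"
    using assms by (intro nn_integral_has_integral_lborel) auto
  moreover have "(\<lambda>s. ennreal (if s \<in> {a..b} then f s else 0)) = (\<lambda>s. ennreal (f s) * indicator {a..b} s)"
    by (auto simp: indicator_def)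
  ultimately show ?thesis by simp
qed

text \<open>Of the convexity of \<rho>, the stochastic bounds use only the monotonicity of \<psi>.
  The second-moment modulus and the linearity of the mean score hold near 0 only, and are therefore
  passed to the lemmas as local hypotheses.\<close>

locale score_errors = prob_space M for M :: "'a measure" +
  fixes \<psi> :: "real \<Rightarrow> real" and \<epsilon> :: "nat \<Rightarrow> 'a \<Rightarrow> real" and \<kappa> M1 :: real
  assumes mono_psi: "mono \<psi>"
    and indep: "indep_vars (\<lambda>_. borel) \<epsilon> {1..}"
    and ident: "\<And>i. i \<ge> 1 \<Longrightarrow> distr M borel (\<epsilon> i) = distr M borel (\<epsilon> 1)"
    and kappa: "0 < \<kappa>" and incr: "\<And>x y. \<bar>y\<bar> < \<kappa> \<Longrightarrow> \<bar>\<psi> (x + y) - \<psi> x\<bar> \<le> M1"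
    and sq: "integrable M (\<lambda>\<omega>. (\<psi> (\<epsilon> 1 \<omega>))\<^sup>2)" and mean: "expectation (\<lambda>\<omega>. \<psi> (\<epsilon> 1 \<omega>)) = 0"
begin

lemma psi_borel[measurable]: "\<psi> \<in> borel_measurable borel"
  using mono_psi by (rule borel_measurable_mono)

lemma eps_measurable: "i \<ge> 1 \<Longrightarrow> \<epsilon> i \<in> borel_measurable M"
  using indep unfolding indep_vars_def by auto

lemma eps_transfer:
  assumes i: "i \<ge> 1" and f: "f \<in> borel_measurable borel"
  shows "expectation (\<lambda>\<omega>. f (\<epsilon> i \<omega>)) = expectation (\<lambda>\<omega>. (f (\<epsilon> 1 \<omega>) :: real))"
    "integrable M (\<lambda>\<omega>. f (\<epsilon> i \<omega>)) \<longleftrightarrow> integrable M (\<lambda>\<omega>. f (\<epsilon> 1 \<omega>))"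
  using integral_distr[OF eps_measurable[OF i] f] integral_distr[OF eps_measurable[of 1] f]
    integrable_distr_eq[OF eps_measurable[OF i] f] integrable_distr_eq[OF eps_measurable[of 1] f] ident[OF i] by auto

lemma psi_integrable: "integrable M (\<lambda>\<omega>. \<psi> (\<epsilon> 1 \<omega>))"
proof (rule square_integrable_imp_integrable)
  have [measurable]: "\<epsilon> 1 \<in> borel_measurable M" by (rule eps_measurable) simp
  show "(\<lambda>\<omega>. \<psi> (\<epsilon> 1 \<omega>)) \<in> borel_measurable M" by measurable
qed (rule sq)

text \<open>As the score has mean zero this is, for small s, minus the mean of
  \<open>\<psi> (\<epsilon> 1 \<omega> - s)\<close>, hence nearly \<xi> times s under (A4). In
  difference form the integrand is bounded for \<open>\<bar>s\<bar> < \<kappa>\<close>.\<close>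

definition mu :: "real \<Rightarrow> real" where
  "mu s = expectation (\<lambda>\<omega>. \<psi> (\<epsilon> 1 \<omega>) - \<psi> (\<epsilon> 1 \<omega> - s))"

text \<open>The centred integrand of the Bregman remainder \<open>\<rho> (e - u) - \<rho> e + \<psi> e * u\<close> at \<open>e = \<epsilon>\<^sub>i\<close>.\<close>

definition z :: "nat \<Rightarrow> 'a \<Rightarrow> real \<Rightarrow> real" where
  "z i \<omega> s = \<psi> (\<epsilon> i \<omega>) - \<psi> (\<epsilon> i \<omega> - s) - mu s"

lemma mu_borel[measurable]: "mu \<in> borel_measurable borel"
proof -
  have [measurable]: "\<epsilon> 1 \<in> borel_measurable M" by (rule eps_measurable) simp
  have "(\<lambda>s. \<integral>\<omega>. \<psi> (\<epsilon> 1 \<omega>) - \<psi> (\<epsilon> 1 \<omega> - s) \<partial>M) \<in> borel_measurable borel"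
    by (rule borel_measurable_lebesgue_integral) measurable
  then show ?thesis by (simp add: mu_def[abs_def])
qed

lemma M1_nonneg: "0 \<le> M1" using incr[of 0 0] kappa by simp

lemma increment_bound: "\<bar>s\<bar> < \<kappa> \<Longrightarrow> \<bar>\<psi> e - \<psi> (e - s)\<bar> \<le> M1"
  using incr[of "-s" e] by (simp add: abs_minus_commute)

lemma increment_integrable:
  assumes "i \<ge> 1" "\<bar>s\<bar> < \<kappa>"
  shows "integrable M (\<lambda>\<omega>. (\<psi> (\<epsilon> i \<omega>) - \<psi> (\<epsilon> i \<omega> - s))^p)"
proof -
  have [measurable]: "\<epsilon> i \<in> borel_measurable M" using assms by (intro eps_measurable)
  show ?thesis by (rule bounded_power_integrable[where c=M1]) (auto intro: increment_bound assms)
qed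

lemma mu_bound: assumes "\<bar>s\<bar> < \<kappa>" shows "\<bar>mu s\<bar> \<le> M1"
proof -
  have "\<bar>mu s\<bar> \<le> expectation (\<lambda>\<omega>. \<bar>\<psi> (\<epsilon> 1 \<omega>) - \<psi> (\<epsilon> 1 \<omega> - s)\<bar>)"
    unfolding mu_def by (rule integral_abs_bound)
  also have "\<dots> \<le> M1"
    using increment_integrable[of 1 s 1] assms by (intro integral_le_const) (auto intro: increment_bound)
  finally show ?thesis .
qed

lemma z_bound: assumes "\<bar>s\<bar> < \<kappa>" shows "\<bar>z i \<omega> s\<bar> \<le> 2 * M1"
  using increment_bound[OF assms, of "\<epsilon> i \<omega>"] mu_bound[OF assms] unfolding z_def by linarith

lemma z_borel: "z i \<omega> \<in> borel_measurable borel"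
proof -
  have "(\<lambda>s. \<psi> (\<epsilon> i \<omega>) - \<psi> (\<epsilon> i \<omega> - s) - mu s) \<in> borel_measurable borel" by measurable
  then show ?thesis by (simp add: z_def[abs_def])
qed

text \<open>Centring only decreases the second moment, and the fourth is reduced to the second by
  the uniform bound \<open>2 * M1\<close>.\<close>

lemma z_moments:
  assumes i: "i \<ge> 1" and s: "\<bar>s\<bar> < \<kappa>"
    and v: "expectation (\<lambda>\<omega>. (\<psi> (\<epsilon> 1 \<omega> - s) - \<psi> (\<epsilon> 1 \<omega>))\<^sup>2) \<le> v"
  shows "expectation (\<lambda>\<omega>. z i \<omega> s) = 0" "expectation (\<lambda>\<omega>. (z i \<omega> s)^2) \<le> v"
    "expectation (\<lambda>\<omega>. (z i \<omega> s)^4) \<le> 4 * M1\<^sup>2 * v"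
proof -
  have [measurable]: "\<epsilon> i \<in> borel_measurable M" using i by (intro eps_measurable)
  let ?q = "\<lambda>\<omega>. \<psi> (\<epsilon> i \<omega>) - \<psi> (\<epsilon> i \<omega> - s)"
  have q1: "integrable M ?q" and q2: "integrable M (\<lambda>\<omega>. (?q \<omega>)\<^sup>2)"
    using increment_integrable[OF i s, of 1] increment_integrable[OF i s, of 2] by auto
  have Eq: "expectation ?q = mu s" unfolding mu_def
    by (rule eps_transfer(1)[OF i, of "\<lambda>e. \<psi> e - \<psi> (e - s)"]) measurable
  then show "expectation (\<lambda>\<omega>. z i \<omega> s) = 0" unfolding z_def using q1 by (simp add: prob_space)
  have Eq2: "expectation (\<lambda>\<omega>. (?q \<omega>)\<^sup>2) \<le> v"
    using eps_transfer(1)[OF i, of "\<lambda>e. (\<psi> e - \<psi> (e - s))\<^sup>2"] v by (simp add: power2_commute)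
  have eq: "(\<lambda>\<omega>. (z i \<omega> s)^2) = (\<lambda>\<omega>. (?q \<omega>)\<^sup>2 - 2 * mu s * ?q \<omega> + (mu s)\<^sup>2)"
    unfolding z_def by (simp add: power2_eq_square algebra_simps)
  have "expectation (\<lambda>\<omega>. (z i \<omega> s)^2) = expectation (\<lambda>\<omega>. (?q \<omega>)\<^sup>2) - 2 * mu s * expectation ?q + (mu s)\<^sup>2"
    unfolding eq using q1 q2 by (simp add: prob_space del: Bochner_Integration.integral_diff) (simp add: prob_space)
  then show z2: "expectation (\<lambda>\<omega>. (z i \<omega> s)^2) \<le> v"
  proof -
    assume "expectation (\<lambda>\<omega>. (z i \<omega> s)^2) = expectation (\<lambda>\<omega>. (?q \<omega>)\<^sup>2) - 2 * mu s * expectation ?q + (mu s)\<^sup>2"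
    then have "expectation (\<lambda>\<omega>. (z i \<omega> s)^2) = expectation (\<lambda>\<omega>. (?q \<omega>)\<^sup>2) - (mu s)\<^sup>2"
      unfolding Eq by (simp only: power2_eq_square)
    then show ?thesis using Eq2 zero_le_power2[of "mu s"] by linarith
  qed
  have zint: "integrable M (\<lambda>\<omega>. (z i \<omega> s)^p)" for p
  proof (rule bounded_power_integrable[where c="2 * M1"])
    show "(\<lambda>\<omega>. z i \<omega> s) \<in> borel_measurable M" unfolding z_def by measurable
  qed (rule z_bound[OF s])
  have "expectation (\<lambda>\<omega>. (z i \<omega> s)^4) \<le> expectation (\<lambda>\<omega>. (2 * M1)\<^sup>2 * (z i \<omega> s)^2)"
  proof (rule integral_mono)
    fix \<omega>
    have "(z i \<omega> s)\<^sup>2 \<le> (2 * M1)\<^sup>2" using z_bound[OF s, of i \<omega>] by (metis abs_ge_zero power2_abs power_mono)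
    then have "(z i \<omega> s)\<^sup>2 * (z i \<omega> s)\<^sup>2 \<le> (2 * M1)\<^sup>2 * (z i \<omega> s)\<^sup>2" by (intro mult_right_mono) auto
    then show "(z i \<omega> s)^4 \<le> (2 * M1)\<^sup>2 * (z i \<omega> s)^2" by (simp add: power4_eq_xxxx power2_eq_square mult.assoc)
  qed (use zint in auto)
  also have "\<dots> = 4 * M1\<^sup>2 * expectation (\<lambda>\<omega>. (z i \<omega> s)^2)" by (simp add: power_mult_distrib)
  also have "\<dots> \<le> 4 * M1\<^sup>2 * v" using z2 by (intro mult_left_mono) auto
  finally show "expectation (\<lambda>\<omega>. (z i \<omega> s)^4) \<le> 4 * M1\<^sup>2 * v" .
qed

section \<open>Random bounds valid for all perturbations at once\<close>

text \<open>By the kernel representation the noise sum is the inner product of g with one random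
  function plus that of g' with another. \<open>X1\<close> and \<open>X2\<close> are their squared
  norms, which do not involve g; the expectations come from the diagonal terms \<open>1/h\<close>
  and at most \<open>h\<close>.\<close>

lemma noise_control:
  assumes h: "0 < h" "h \<le> 1/2" and t: "\<And>i. i \<in> {1..n} \<Longrightarrow> t i \<in> {0..1}"
  defines "\<sigma> \<equiv> expectation (\<lambda>\<omega>. (\<psi> (\<epsilon> 1 \<omega>))\<^sup>2)"
  obtains X1 X2 :: "'a \<Rightarrow> real" where
    "integrable M X1" "integrable M X2" "\<And>\<omega>. 0 \<le> X1 \<omega>" "\<And>\<omega>. 0 \<le> X2 \<omega>"
    "expectation X1 \<le> real n * \<sigma> / h" "expectation X2 \<le> real n * \<sigma> * h"
    "\<And>\<omega> g g'. primitive01 g g' \<Longrightarrow> sq_int g' \<Longrightarrow>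
      \<bar>\<Sum>i=1..n. \<psi> (\<epsilon> i \<omega>) * g (t i)\<bar> \<le> l2_norm g * sqrt (X1 \<omega>) + l2_norm g' * sqrt (X2 \<omega>)"
proof -
  let ?p = "\<lambda>i \<omega>. \<psi> (\<epsilon> i \<omega>)" and ?I = "{1..n}"
  let ?A = "\<lambda>i. average_kernel h (t i)" and ?K = "\<lambda>i. remainder_kernel h (t i)"
  have A: "sq_int (?A i)" "l2_inner (?A i) (?A i) = 1 / h" and K: "sq_int (?K i)" "l2_inner (?K i) (?K i) \<le> h"
    "0 \<le> l2_inner (?K i) (?K i)"
    if "i \<in> ?I" for i
    using kernels_sq_int[OF h t[OF that]] unfolding l2_norm_power2 l2_inner_def by (auto simp: power2_eq_square)
  have ind: "indep_vars (\<lambda>_. borel) ?p ?I"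
    by (rule indep_vars_compose2[OF indep_vars_subset[OF indep], of ?I "\<lambda>_. \<psi>"]) auto
  have mom: "integrable M (?p i)" "integrable M (\<lambda>\<omega>. (?p i \<omega>)\<^sup>2)" "expectation (?p i) = 0" "expectation (\<lambda>\<omega>. (?p i \<omega>)\<^sup>2) \<le> \<sigma>"
    if "i \<in> ?I" for i
    using eps_transfer[of i \<psi>] eps_transfer[of i "\<lambda>e. (\<psi> e)\<^sup>2"] that psi_integrable sq mean by (auto simp: \<sigma>_def)
  have s0: "0 \<le> \<sigma>" by (simp add: \<sigma>_def)
  define X1 where "X1 = (\<lambda>\<omega>. \<Sum>i\<in>?I. \<Sum>j\<in>?I. ?p i \<omega> * ?p j \<omega> * l2_inner (?A i) (?A j))"
  define X2 where "X2 = (\<lambda>\<omega>. \<Sum>i\<in>?I. \<Sum>j\<in>?I. ?p i \<omega> * ?p j \<omega> * l2_inner (?K i) (?K j))"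
  have X1n: "X1 \<omega> = (l2_norm (\<lambda>x. \<Sum>i\<in>?I. ?p i \<omega> * ?A i x))\<^sup>2" for \<omega>
    unfolding X1_def using l2_norm_sum_power2[of ?I ?A "\<lambda>i. ?p i \<omega>"] A by simp
  have X2n: "X2 \<omega> = (l2_norm (\<lambda>x. \<Sum>i\<in>?I. ?p i \<omega> * ?K i x))\<^sup>2" for \<omega>
    unfolding X2_def using l2_norm_sum_power2[of ?I ?K "\<lambda>i. ?p i \<omega>"] K by simp
  note Q1 = quadratic_form_expectation[OF finite_atLeastAtMost ind mom, of "\<lambda>i j. l2_inner (?A i) (?A j)" "1/h", folded X1_def]
  note Q2 = quadratic_form_expectation[OF finite_atLeastAtMost ind mom, of "\<lambda>i j. l2_inner (?K i) (?K j)" h, folded X2_def]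
  show ?thesis
  proof (rule that[of X1 X2])
    show "integrable M X1" using A h s0 by (intro Q1) auto
    show "integrable M X2" using K h s0 by (intro Q2) auto
    have "expectation X1 \<le> real (card ?I) * (\<sigma> * (1/h))" using A h s0 by (intro Q1) auto
    then show "expectation X1 \<le> real n * \<sigma> / h" by simp
    have "expectation X2 \<le> real (card ?I) * (\<sigma> * h)" using K h s0 by (intro Q2) auto
    then show "expectation X2 \<le> real n * \<sigma> * h" by (simp add: mult.assoc)
    show "0 \<le> X1 \<omega>" "0 \<le> X2 \<omega>" for \<omega> unfolding X1n X2n by simp_all
    fix \<omega> and g g' :: "real \<Rightarrow> real" assume g: "primitive01 g g'" "sq_int g'"
    have gs: "sq_int g" using g(1) primitive01_continuous sq_int_continuous by blast
    have "(\<Sum>i=1..n. ?p i \<omega> * g (t i)) = (\<Sum>i\<in>?I. ?p i \<omega> * l2_inner (?A i) g) + (\<Sum>i\<in>?I. ?p i \<omega> * l2_inner (?K i) g')"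
      unfolding sum.distrib[symmetric]
      by (intro sum.cong refl) (use kernel_representation[OF g h t] in \<open>simp add: distrib_left\<close>)
    also have "\<dots> = l2_inner (\<lambda>x. \<Sum>i\<in>?I. ?p i \<omega> * ?A i x) g + l2_inner (\<lambda>x. \<Sum>i\<in>?I. ?p i \<omega> * ?K i x) g'"
      using l2_inner_sum_left[of ?I ?A g "\<lambda>i. ?p i \<omega>"] l2_inner_sum_left[of ?I ?K g' "\<lambda>i. ?p i \<omega>"] A K gs g by simp
    finally have eq: "(\<Sum>i=1..n. ?p i \<omega> * g (t i))
      = l2_inner (\<lambda>x. \<Sum>i\<in>?I. ?p i \<omega> * ?A i x) g + l2_inner (\<lambda>x. \<Sum>i\<in>?I. ?p i \<omega> * ?K i x) g'" .
    have "\<bar>l2_inner (\<lambda>x. \<Sum>i\<in>?I. ?p i \<omega> * ?A i x) g\<bar> \<le> sqrt (X1 \<omega>) * l2_norm g"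
      unfolding X1n using l2_Cauchy_Schwarz[OF sq_int_sum[of ?I ?A "\<lambda>i. ?p i \<omega>"] gs] A by simp
    moreover have "\<bar>l2_inner (\<lambda>x. \<Sum>i\<in>?I. ?p i \<omega> * ?K i x) g'\<bar> \<le> sqrt (X2 \<omega>) * l2_norm g'"
      unfolding X2n using l2_Cauchy_Schwarz[OF sq_int_sum[of ?I ?K "\<lambda>i. ?p i \<omega>"] g(2)] K by simp
    ultimately show "\<bar>\<Sum>i=1..n. ?p i \<omega> * g (t i)\<bar> \<le> l2_norm g * sqrt (X1 \<omega>) + l2_norm g' * sqrt (X2 \<omega>)"
      unfolding eq by (simp add: mult.commute)
  qed
qed

text \<open>At level k a block has at most \<open>2 ^ k\<close> summands and the block sizes add up
  to n, so one level contributes at most n times \<open>3 * 2 ^ k * v\<^sup>2 + w\<close>, times the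
  length of the range. The geometric sum over the levels yields the factor 6. Nonnegative integrals
  permit exchanging the two integrations without integrability proofs.\<close>

lemma fourth_moment_control:
  fixes \<pi> :: "nat \<Rightarrow> nat"
  assumes a: "0 < a" "a < \<kappa>" and \<pi>: "inj_on \<pi> {..<n}" "\<pi> ` {..<n} \<subseteq> {1..}"
    and v: "\<And>s. s \<in> {-a..a} \<Longrightarrow> expectation (\<lambda>\<omega>. (\<psi> (\<epsilon> 1 \<omega> - s) - \<psi> (\<epsilon> 1 \<omega>))\<^sup>2) \<le> v"
    and J: "n \<le> J * 2^K"
  defines "S \<equiv> \<lambda>\<omega> k j s. \<Sum>i\<in>{j * 2^k..<Suc j * 2^k}. if i < n then z (\<pi> i) \<omega> s else 0"
  defines "X \<equiv> \<lambda>\<omega>. \<Sum>k\<le>K. \<Sum>j<J * 2^(K - k). \<integral>\<^sup>+s. ennreal ((S \<omega> k j s)^4) * indicator {-a..a} s \<partial>lborel"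
  shows "X \<in> borel_measurable M"
    "(\<integral>\<^sup>+\<omega>. X \<omega> \<partial>M) \<le> ennreal (2 * a * real n * (6 * 2^K * v\<^sup>2 + (real K + 1) * (4 * M1\<^sup>2 * v)))"
proof -
  have [measurable]: "(\<lambda>\<omega>. \<epsilon> (\<pi> i) \<omega>) \<in> borel_measurable M" if "i < n" for i
    using \<pi>(2) that by (intro eps_measurable) auto
  have zm: "(\<lambda>(\<omega>, s). if i < n then z (\<pi> i) \<omega> s else 0) \<in> borel_measurable (M \<Otimes>\<^sub>M lborel)" for i
    unfolding z_def by (cases "i < n") (simp_all, measurable)
  have Sm[measurable]: "(\<lambda>(\<omega>, s). S \<omega> k j s) \<in> borel_measurable (M \<Otimes>\<^sub>M lborel)" for k j
    unfolding S_def case_prod_beta' using zm[unfolded case_prod_beta'] by (intro borel_measurable_sum)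
  have Sm4[measurable]: "(\<lambda>(\<omega>, s). ennreal ((S \<omega> k j s)^4) * indicator {-a..a} s) \<in> borel_measurable (M \<Otimes>\<^sub>M lborel)" for k j
    using Sm[of k j] unfolding case_prod_beta' by measurable
  have inm: "(\<lambda>\<omega>. \<integral>\<^sup>+s. ennreal ((S \<omega> k j s)^4) * indicator {-a..a} s \<partial>lborel) \<in> borel_measurable M" for k j
    by (rule lborel.borel_measurable_nn_integral[OF Sm4])
  then show "X \<in> borel_measurable M" unfolding X_def by (intro borel_measurable_sum)
  have v0: "0 \<le> v" using v[of 0] a by (simp add: order_trans[rotated])
  define w where "w = 4 * M1\<^sup>2 * v"
  have w0: "0 \<le> w" using v0 by (simp add: w_def)
  \<comment> \<open>Counts genuine indices only: those from n on are padding with value 0.\<close>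
  define c where "c = (\<lambda>k j. card ({j * 2^k..<Suc j * 2^k} \<inter> {..<n}))"
  have ck: "c k j \<le> 2^k" for k j
  proof -
    have "c k j \<le> card {j * 2^k..<Suc j * 2^k}" unfolding c_def by (intro card_mono) auto
    then show ?thesis by simp
  qed
  have csum: "(\<Sum>j<J * 2^(K - k). c k j) = n" if "k \<le> K" for k
  proof -
    have "(\<Sum>j<J * 2^(K - k). c k j) = (\<Sum>j<J * 2^(K - k). \<Sum>i\<in>{j * 2^k..<j * 2^k + 2^k}. if i < n then 1 else 0)"
      unfolding c_def by (intro sum.cong refl) (simp add: sum.If_cases Int_def conj_commute add.commute)
    also have "\<dots> = (\<Sum>i<J * 2^(K - k) * 2^k. if i < n then 1 else 0)" by (rule sum.nat_group)
    also have "J * 2^(K - k) * 2^k = J * 2^K" using that by (simp add: power_add[symmetric])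
    also have "(\<Sum>i<J * 2^K. if i < n then 1 else 0) = card ({..<J * 2^K} \<inter> {..<n})"
      by (simp add: sum.If_cases Int_def)
    also have "{..<J * 2^K} \<inter> {..<n} = {..<n}" using J by auto
    finally show ?thesis by simp
  qed
  have ES: "(\<integral>\<^sup>+\<omega>. ennreal ((S \<omega> k j s)^4) \<partial>M) \<le> ennreal (real (c k j) * (3 * 2^k * v\<^sup>2 + w))" if s: "s \<in> {-a..a}" for k j s
  proof -
    have sk: "\<bar>s\<bar> < \<kappa>" using s a by auto
    let ?I = "{j * 2^k..<Suc j * 2^k} \<inter> {..<n}"
    \<comment> \<open>Independence is indexed by the original errors, so the block is transported
      through the injective enumeration \<pi>.\<close>
    let ?P = "\<pi> ` ?I"
    have injI: "inj_on \<pi> ?I" using \<pi>(1) by (rule inj_on_subset) auto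
    have cP: "card ?P = card ?I" using injI by (rule card_image)
    have S: "S \<omega> k j s = (\<Sum>l\<in>?P. z l \<omega> s)" for \<omega>
      unfolding S_def sum.reindex[OF injI] by (simp add: sum.If_cases Int_def)
    have "indep_vars (\<lambda>_. borel) \<epsilon> ?P" using indep by (rule indep_vars_subset) (use \<pi>(2) in auto)
    then have ind: "indep_vars (\<lambda>_. borel) (\<lambda>l \<omega>. z l \<omega> s) ?P"
      unfolding z_def by (rule indep_vars_compose2[where Y="\<lambda>_ e. \<psi> e - \<psi> (e - s) - mu s"]) measurable
    have pi1: "l \<ge> 1" if "l \<in> ?P" for l using \<pi>(2) that by auto
    note mom = z_moments[OF pi1 sk v[OF s], folded w_def]
    have zb: "\<bar>z l \<omega> s\<bar> \<le> 2 * M1" for l \<omega> by (rule z_bound[OF sk])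
    have finP: "finite ?P" by simp
    have "expectation (\<lambda>\<omega>. (\<Sum>l\<in>?P. z l \<omega> s)^4) \<le> 3 * (real (card ?I) * v)^2 + real (card ?I) * w"
      using moments_of_independent_sum[OF finP ind zb mom v0] unfolding cP by blast
    also have "\<dots> = real (c k j) * (3 * real (c k j) * v\<^sup>2 + w)"
      by (simp add: c_def power2_eq_square algebra_simps)
    also have "\<dots> \<le> real (c k j) * (3 * 2^k * v\<^sup>2 + w)"
    proof (intro mult_left_mono add_right_mono mult_right_mono)
      show "real (c k j) \<le> 2^k" using ck[of k j] by (metis of_nat_le_iff of_nat_numeral of_nat_power)
    qed auto
    finally have E4: "expectation (\<lambda>\<omega>. (S \<omega> k j s)^4) \<le> real (c k j) * (3 * 2^k * v\<^sup>2 + w)" unfolding S .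
    have "integrable M (\<lambda>\<omega>. (\<Sum>l\<in>?P. z l \<omega> s)^4)"
    proof (rule bounded_power_integrable)
      have "(\<lambda>\<omega>. z l \<omega> s) \<in> borel_measurable M" if "l \<in> ?P" for l
        using ind that unfolding indep_vars_def by blast
      then show "(\<lambda>\<omega>. \<Sum>l\<in>?P. z l \<omega> s) \<in> borel_measurable M" by (intro borel_measurable_sum)
      show "\<bar>\<Sum>l\<in>?P. z l \<omega> s\<bar> \<le> (\<Sum>l\<in>?P. 2 * M1)" for \<omega>
        using zb by (intro order_trans[OF sum_abs] sum_mono)
    qed
    then have "(\<integral>\<^sup>+\<omega>. ennreal ((S \<omega> k j s)^4) \<partial>M) = ennreal (expectation (\<lambda>\<omega>. (S \<omega> k j s)^4))"
      unfolding S by (intro nn_integral_eq_integral) auto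
    then show ?thesis using E4 by (simp add: ennreal_leI)
  qed
  have blk: "(\<integral>\<^sup>+\<omega>. (\<integral>\<^sup>+s. ennreal ((S \<omega> k j s)^4) * indicator {-a..a} s \<partial>lborel) \<partial>M)
      \<le> ennreal (2 * a * (real (c k j) * (3 * 2^k * v\<^sup>2 + w)))" for k j
  proof -
    interpret P: pair_sigma_finite M lborel
      by (intro pair_sigma_finite.intro sigma_finite_measure_axioms sigma_finite_lborel)
    have "(\<integral>\<^sup>+\<omega>. (\<integral>\<^sup>+s. ennreal ((S \<omega> k j s)^4) * indicator {-a..a} s \<partial>lborel) \<partial>M)
        = (\<integral>\<^sup>+s. (\<integral>\<^sup>+\<omega>. ennreal ((S \<omega> k j s)^4) * indicator {-a..a} s \<partial>M) \<partial>lborel)"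
      using P.Fubini'[OF Sm4] by simp
    also have "\<dots> \<le> (\<integral>\<^sup>+s. ennreal (real (c k j) * (3 * 2^k * v\<^sup>2 + w)) * indicator {-a..a} s \<partial>lborel)"
      using ES by (intro nn_integral_mono) (auto simp: indicator_def)
    also have "\<dots> = ennreal (real (c k j) * (3 * 2^k * v\<^sup>2 + w)) * ennreal (2 * a)"
      using a by (subst nn_integral_cmult_indicator) auto
    also have "\<dots> = ennreal (2 * a * (real (c k j) * (3 * 2^k * v\<^sup>2 + w)))"
      using a v0 w0 by (subst ennreal_mult[symmetric]) (auto simp: mult.commute)
    finally show ?thesis .
  qed
  have "(\<integral>\<^sup>+\<omega>. X \<omega> \<partial>M) = (\<Sum>k\<le>K. \<Sum>j<J * 2^(K - k). \<integral>\<^sup>+\<omega>. (\<integral>\<^sup>+s. ennreal ((S \<omega> k j s)^4) * indicator {-a..a} s \<partial>lborel) \<partial>M)"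
    unfolding X_def using inm by (simp add: nn_integral_sum)
  also have "\<dots> \<le> (\<Sum>k\<le>K. \<Sum>j<J * 2^(K - k). ennreal (2 * a * (real (c k j) * (3 * 2^k * v\<^sup>2 + w))))"
    by (intro sum_mono blk)
  also have "\<dots> = ennreal (\<Sum>k\<le>K. \<Sum>j<J * 2^(K - k). 2 * a * (real (c k j) * (3 * 2^k * v\<^sup>2 + w)))"
    using a v0 w0 by (simp add: sum_ennreal sum_nonneg)
  also have "(\<Sum>k\<le>K. \<Sum>j<J * 2^(K - k). 2 * a * (real (c k j) * (3 * 2^k * v\<^sup>2 + w))) =
      (\<Sum>k\<le>K. 2 * a * (real n * (3 * 2^k * v\<^sup>2 + w)))"
  proof (intro sum.cong refl)
    fix k assume "k \<in> {..K}"
    then have "real (\<Sum>j<J * 2^(K - k). c k j) = real n" using csum[of k] by simp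
    then show "(\<Sum>j<J * 2^(K - k). 2 * a * (real (c k j) * (3 * 2^k * v\<^sup>2 + w))) = 2 * a * (real n * (3 * 2^k * v\<^sup>2 + w))"
      by (simp add: sum_distrib_left[symmetric] sum_distrib_right[symmetric])
  qed
  also have "\<dots> = 2 * a * real n * (3 * (\<Sum>k\<le>K. 2^k) * v\<^sup>2 + (real K + 1) * w)"
    by (simp add: sum_distrib_left[symmetric] sum.distrib sum_distrib_right[symmetric] algebra_simps)
  also have "ennreal \<dots> \<le> ennreal (2 * a * real n * (6 * 2^K * v\<^sup>2 + (real K + 1) * w))"
  proof (intro ennreal_leI mult_left_mono add_right_mono mult_right_mono)
    have "(\<Sum>k\<le>K. 2^k :: real) = 2^Suc K - 1" by (induction K) auto
    then show "3 * (\<Sum>k\<le>K. 2^k) \<le> (6 * 2^K :: real)" by simp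
  qed (use a in auto)
  finally show "(\<integral>\<^sup>+\<omega>. X \<omega> \<partial>M) \<le> ennreal (2 * a * real n * (6 * 2^K * v\<^sup>2 + (real K + 1) * (4 * M1\<^sup>2 * v)))"
    by (simp add: w_def)
qed

text \<open>Along the sorted design points the values of g have total variation at most the L1 norm
  of g', hence at most \<open>l2_norm g'\<close>. The coarsest level contributes the averaged
  absolute values of g, and \<open>X\<close> is fixed before g, r and \<theta>.\<close>

lemma fluctuation_control:
  assumes a: "0 < a" "a < \<kappa>" and n: "n \<ge> 1" and t: "\<And>i. i \<in> {1..n} \<Longrightarrow> t i \<in> {0..1}"
    and v: "\<And>s. s \<in> {-a..a} \<Longrightarrow> expectation (\<lambda>\<omega>. (\<psi> (\<epsilon> 1 \<omega> - s) - \<psi> (\<epsilon> 1 \<omega>))\<^sup>2) \<le> v"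
  shows "\<exists>X. X \<in> borel_measurable M \<and>
    (\<integral>\<^sup>+\<omega>. X \<omega> \<partial>M) \<le> ennreal (2 * a * real n * (6 * 2^K * v\<^sup>2 + (real K + 1) * (4 * M1\<^sup>2 * v))) \<and>
    (\<forall>\<omega> g g' r \<theta>. primitive01 g g' \<longrightarrow> sq_int g' \<longrightarrow> (\<forall>i\<in>{1..n}. \<bar>g (t i)\<bar> \<le> a) \<longrightarrow> X \<omega> \<le> ennreal r \<longrightarrow> 0 \<le> r \<longrightarrow> \<theta> > 0 \<longrightarrow>
      \<bar>\<Sum>i=1..n. prim a (z i \<omega>) (g (t i)) - prim a (z i \<omega>) 0\<bar> \<le>
        \<theta> * ((real K + 1) * l2_norm g' + (\<Sum>i=1..n. \<bar>g (t i)\<bar>) / 2^K + a) + r / \<theta>^3)"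
proof -
  define xs where "xs = sort_key t [1..<Suc n]"
  define \<pi> where "\<pi> = (\<lambda>i. xs ! i)"
  have xs: "length xs = n" "set xs = {1..n}" "distinct xs" "sorted (map t xs)"
    by (auto simp: xs_def)
  have bij: "bij_betw \<pi> {..<n} {1..n}"
    unfolding \<pi>_def using bij_betw_nth[OF xs(3), of "{..<n}" "{1..n}"] xs by simp
  have tm: "t (\<pi> i) \<le> t (\<pi> j)" if "i \<le> j" "j < n" for i j
    using sorted_nth_mono[OF xs(4), of i j] that xs(1) by (simp add: \<pi>_def)
  have \<pi>in: "\<pi> i \<in> {1..n}" if "i < n" for i using bij that by (auto simp: bij_betw_def)
  \<comment> \<open>One more block than \<open>n div 2 ^ K\<close>, so that all n indices are
    covered; at most \<open>2 ^ K\<close> padding indices arise, and they produce the summand a in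
    the bound.\<close>
  define J where "J = n div 2^K + 1"
  have J: "n \<le> J * 2^K" "J * 2^K \<le> n + 2^K"
  proof -
    have "n = n div 2^K * 2^K + n mod 2^K" by (rule div_mult_mod_eq[symmetric])
    moreover have "n mod 2^K < 2^K" by simp
    ultimately have "n \<le> n div 2^K * 2^K + 2^K" by linarith
    then show "n \<le> J * 2^K" by (simp only: J_def add_mult_distrib mult_1)
    show "J * 2^K \<le> n + 2^K" unfolding J_def by (simp add: algebra_simps)
  qed
  define S where "S = (\<lambda>\<omega> k j s. \<Sum>i\<in>{j * 2^k..<Suc j * 2^k}. if i < n then z (\<pi> i) \<omega> s else 0)"
  define X where "X = (\<lambda>\<omega>. \<Sum>k\<le>K. \<Sum>j<J * 2^(K - k). \<integral>\<^sup>+s. ennreal ((S \<omega> k j s)^4) * indicator {-a..a} s \<partial>lborel)"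
  have inj: "inj_on \<pi> {..<n}" "\<pi> ` {..<n} \<subseteq> {1..}" using bij by (auto simp: bij_betw_def)
  note FM = fourth_moment_control[OF a inj v J(1)]
  show ?thesis
  proof (intro exI[of _ X] conjI allI impI)
    show "X \<in> borel_measurable M" unfolding X_def S_def by (rule FM(1))
    show "(\<integral>\<^sup>+\<omega>. X \<omega> \<partial>M) \<le> ennreal (2 * a * real n * (6 * 2^K * v\<^sup>2 + (real K + 1) * (4 * M1\<^sup>2 * v)))"
      unfolding X_def S_def by (rule FM(2))
    fix \<omega> g g' r \<theta>
    assume g: "primitive01 g g'" and sg: "sq_int g'" and ga: "\<forall>i\<in>{1..n}. \<bar>g (t i)\<bar> \<le> a"
      and r: "X \<omega> \<le> ennreal r" "0 \<le> r" and \<theta>: "(\<theta>::real) > 0"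
    \<comment> \<open>Indices from n on repeat the largest design point, which keeps \<tau> monotone
      and adds no variation.\<close>
    define \<tau> where "\<tau> = (\<lambda>i. t (\<pi> (min i (n - 1))))"
    have mn: "min i (n - 1) < n" for i using n by auto
    have \<tau>01: "\<tau> i \<in> {0..1}" for i unfolding \<tau>_def using t \<pi>in[OF mn] by blast
    have \<tau>m: "\<tau> i \<le> \<tau> j" if "i \<le> j" for i j unfolding \<tau>_def using that mn by (intro tm) auto
    define x where "x = (\<lambda>i. g (\<tau> i))"
    define G where "G = (\<lambda>i. integral {0..\<tau> i} (\<lambda>s. \<bar>g' s\<bar>))"
    define V where "V = l2_norm g'"
    have ai: "g' absolutely_integrable_on {0..1}" using g by (simp add: primitive01_def)
    then have ag: "(\<lambda>s. \<bar>g' s\<bar>) integrable_on {0..1}" by (simp add: absolutely_integrable_on_def)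
    have ag': "(\<lambda>s. \<bar>g' s\<bar>) integrable_on {c..d}" if "0 \<le> c" "d \<le> 1" for c d
      using integrable_subinterval_real[OF ag] that by auto
    have Gd: "G j - G i = integral {\<tau> i..\<tau> j} (\<lambda>s. \<bar>g' s\<bar>)" if "i \<le> j" for i j
    proof -
      have "integral {0..\<tau> i} (\<lambda>s. \<bar>g' s\<bar>) + integral {\<tau> i..\<tau> j} (\<lambda>s. \<bar>g' s\<bar>) = integral {0..\<tau> j} (\<lambda>s. \<bar>g' s\<bar>)"
        using \<tau>01[of i] \<tau>01[of j] \<tau>m[OF that] by (intro Henstock_Kurzweil_Integration.integral_combine ag') auto
      then show ?thesis by (simp add: G_def)
    qed
    have Gmono: "mono G"
    proof (rule monoI)
      fix i j :: nat assume "i \<le> j"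
      moreover have "0 \<le> integral {\<tau> i..\<tau> j} (\<lambda>s. \<bar>g' s\<bar>)"
        using \<tau>01[of i] \<tau>01[of j] by (intro integral_nonneg ag') auto
      ultimately show "G i \<le> G j" using Gd by fastforce
    qed
    have G0: "0 \<le> G i" for i unfolding G_def using \<tau>01[of i] by (intro integral_nonneg ag') auto
    have GV: "G i \<le> V" for i
    proof -
      have "G i \<le> integral {0..1} (\<lambda>s. \<bar>g' s\<bar>)"
        unfolding G_def using \<tau>01[of i] by (intro integral_subset_le ag') auto
      also have "\<dots> = (LINT s|lebesgue_on {0..1}. \<bar>g' s\<bar>)"
        using sq_int_integrable[OF sg] by (intro lebesgue_integral_eq_integral[symmetric]) auto
      also have "\<dots> \<le> V" unfolding V_def by (rule l1_le_l2[OF sg])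
      finally show ?thesis .
    qed
    have xG: "\<bar>x i - x j\<bar> \<le> G j - G i" if "i \<le> j" for i j
    proof -
      have "(g' has_integral (x j - x i)) {\<tau> i..\<tau> j}"
        using g \<tau>01[of i] \<tau>01[of j] \<tau>m[OF that] unfolding primitive01_def x_def by auto
      then have e: "integral {\<tau> i..\<tau> j} g' = x j - x i" "g' integrable_on {\<tau> i..\<tau> j}"
        by (auto simp: integral_unique has_integral_integrable)
      have "norm (integral {\<tau> i..\<tau> j} g') \<le> integral {\<tau> i..\<tau> j} (\<lambda>s. \<bar>g' s\<bar>)"
        using \<tau>01[of i] \<tau>01[of j] by (intro integral_norm_bound_integral e(2) ag') auto
      then show ?thesis unfolding e(1) Gd[OF that] by (simp add: abs_minus_commute)
    qed
    have xa: "x i \<in> {-a..a}" for i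
    proof -
      have "\<bar>x i\<bar> \<le> a" using ga \<pi>in[OF mn, of i] unfolding x_def \<tau>_def by blast
      then show ?thesis by auto
    qed
    define z' where "z' = (\<lambda>i s. if i < n then z (\<pi> i) \<omega> s else 0)"
    have z'm: "z' i \<in> borel_measurable borel" for i unfolding z'_def using z_borel by (cases "i < n") auto
    have z'b: "\<bar>z' i s\<bar> \<le> 2 * M1" if "s \<in> {-a..a}" for i s
      using z_bound[of s "\<pi> i" \<omega>] that a M1_nonneg unfolding z'_def by auto
    have Seq: "S \<omega> k j = (\<lambda>s. \<Sum>i\<in>{j * 2^k..<Suc j * 2^k}. z' i s)" for k j unfolding S_def z'_def ..
    have ch: "\<bar>\<Sum>i<J * 2^K. prim a (z' i) (x i) - prim a (z' i) 0\<bar> \<le>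
        \<theta> * (real K * V + (\<Sum>j<J. \<bar>x (j * 2^K)\<bar>)) +
        (\<Sum>k\<le>K. \<Sum>j<J * 2^(K - k). integral {-a..a} (\<lambda>s. (S \<omega> k j s)^4)) / \<theta>^3"
      unfolding Seq by (rule dyadic_chaining[OF z'm z'b xa Gmono G0 GV xG \<theta> a(1)])
    have lhs: "(\<Sum>i<J * 2^K. prim a (z' i) (x i) - prim a (z' i) 0) = (\<Sum>i=1..n. prim a (z i \<omega>) (g (t i)) - prim a (z i \<omega>) 0)"
    proof -
      have "(\<Sum>i<J * 2^K. prim a (z' i) (x i) - prim a (z' i) 0) = (\<Sum>i<n. prim a (z' i) (x i) - prim a (z' i) 0)"
        using J(1) by (intro sum.mono_neutral_right) (auto simp: z'_def prim_def)
      also have "\<dots> = (\<Sum>i<n. prim a (z (\<pi> i) \<omega>) (g (t (\<pi> i))) - prim a (z (\<pi> i) \<omega>) 0)"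
        by (intro sum.cong refl) (auto simp: z'_def x_def \<tau>_def min_def cong: if_cong)
      also have "\<dots> = (\<Sum>i=1..n. prim a (z i \<omega>) (g (t i)) - prim a (z i \<omega>) 0)"
        by (rule sum.reindex_bij_betw[OF bij])
      finally show ?thesis .
    qed
    have Sb: "S \<omega> k j \<in> borel_measurable borel" for k j unfolding Seq using z'm by measurable
    have Sint: "(\<lambda>s. (S \<omega> k j s)^4) integrable_on {-a..a}" for k j
    proof (rule bounded_borel_integrable_on)
      show "(\<lambda>s. (S \<omega> k j s)^4) \<in> borel_measurable borel" using Sb by measurable
      fix s assume s: "s \<in> {-a..a}"
      have "\<bar>S \<omega> k j s\<bar> \<le> (\<Sum>i\<in>{j * 2^k..<Suc j * 2^k}. 2 * M1)"
        unfolding Seq using z'b[OF s] by (intro order_trans[OF sum_abs] sum_mono)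
      then show "\<bar>(S \<omega> k j s)^4\<bar> \<le> (\<Sum>i\<in>{j * 2^k..<Suc j * 2^k}. 2 * M1)^4"
        unfolding power_abs by (intro power_mono) auto
    qed
    have "X \<omega> = (\<Sum>k\<le>K. \<Sum>j<J * 2^(K - k). ennreal (integral {-a..a} (\<lambda>s. (S \<omega> k j s)^4)))"
      unfolding X_def using Sb Sint by (intro sum.cong refl nn_integral_interval_eq_integral) auto
    also have "\<dots> = ennreal (\<Sum>k\<le>K. \<Sum>j<J * 2^(K - k). integral {-a..a} (\<lambda>s. (S \<omega> k j s)^4))"
      using Sint by (simp add: sum_ennreal sum_nonneg integral_nonneg)
    finally have Xr: "(\<Sum>k\<le>K. \<Sum>j<J * 2^(K - k). integral {-a..a} (\<lambda>s. (S \<omega> k j s)^4)) \<le> r"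
      using r by (simp add: ennreal_le_iff)
    have "(\<Sum>j<J. \<bar>x (j * 2^K)\<bar>) \<le> (\<Sum>i<J * 2^K. \<bar>x i\<bar>) / real (2^K) + V"
      by (rule block_representatives_le_average[OF Gmono G0 GV xG]) auto
    also have "(\<Sum>i<J * 2^K. \<bar>x i\<bar>) \<le> (\<Sum>i=1..n. \<bar>g (t i)\<bar>) + 2^K * a"
    proof -
      have "(\<Sum>i<J * 2^K. \<bar>x i\<bar>) = (\<Sum>i<n. \<bar>x i\<bar>) + (\<Sum>i\<in>{n..<J * 2^K}. \<bar>x i\<bar>)"
        using J(1) sum.atLeastLessThan_concat[of 0 n "J * 2^K" "\<lambda>i. \<bar>x i\<bar>"] by (simp add: atLeast0LessThan)
      also have "(\<Sum>i\<in>{n..<J * 2^K}. \<bar>x i\<bar>) \<le> (\<Sum>i\<in>{n..<J * 2^K}. a)"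
        using xa by (intro sum_mono) (simp add: abs_le_iff minus_le_iff)
      also have "\<dots> = real (J * 2^K - n) * a" by simp
      also have "\<dots> \<le> real (2^K) * a" using J(2) a by (intro mult_right_mono) linarith+
      also have "(\<Sum>i<n. \<bar>x i\<bar>) = (\<Sum>i<n. \<bar>g (t (\<pi> i))\<bar>)"
        by (intro sum.cong refl) (auto simp: x_def \<tau>_def min_def)
      also have "\<dots> = (\<Sum>i=1..n. \<bar>g (t i)\<bar>)" by (rule sum.reindex_bij_betw[OF bij])
      finally show ?thesis by simp
    qed
    finally have xsum: "(\<Sum>j<J. \<bar>x (j * 2^K)\<bar>) \<le> (\<Sum>i=1..n. \<bar>g (t i)\<bar>) / 2^K + a + V"
      by (simp add: divide_right_mono add_divide_distrib)
    have "\<bar>\<Sum>i=1..n. prim a (z i \<omega>) (g (t i)) - prim a (z i \<omega>) 0\<bar> \<le>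
        \<theta> * (real K * V + (\<Sum>j<J. \<bar>x (j * 2^K)\<bar>)) + (\<Sum>k\<le>K. \<Sum>j<J * 2^(K - k). integral {-a..a} (\<lambda>s. (S \<omega> k j s)^4)) / \<theta>^3"
      using ch unfolding lhs .
    also have "\<dots> \<le> \<theta> * ((real K + 1) * l2_norm g' + (\<Sum>i=1..n. \<bar>g (t i)\<bar>) / 2^K + a) + r / \<theta>^3"
    proof (rule add_mono[OF mult_left_mono divide_right_mono[OF Xr]])
      show "real K * V + (\<Sum>j<J. \<bar>x (j * 2^K)\<bar>) \<le> (real K + 1) * l2_norm g' + (\<Sum>i=1..n. \<bar>g (t i)\<bar>) / 2^K + a"
        using xsum by (simp add: V_def algebra_simps)
    qed (use \<theta> in auto)
    finally show "\<bar>\<Sum>i=1..n. prim a (z i \<omega>) (g (t i)) - prim a (z i \<omega>) 0\<bar> \<le>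
        \<theta> * ((real K + 1) * l2_norm g' + (\<Sum>i=1..n. \<bar>g (t i)\<bar>) / 2^K + a) + r / \<theta>^3" .
  qed
qed

end

subsection \<open>Rates of convergence\<close>

text \<open>The data term is convex through \<rho>; for the penalty, the triangle inequality and
  convexity of the square suffice.\<close>

lemma chain_objective_convex:
  assumes conv: "convex_on UNIV \<rho>" and l: "0 \<le> l" and F: "sob_chain m F" and G: "sob_chain m G"
    and \<theta>: "0 \<le> \<theta>" "\<theta> \<le> 1"
  shows "chain_objective m \<rho> l n t y (\<lambda>k x. (1 - \<theta>) * F k x + \<theta> * G k x) \<le>
    (1 - \<theta>) * chain_objective m \<rho> l n t y F + \<theta> * chain_objective m \<rho> l n t y G"
proof -
  let ?S = "\<lambda>H::nat\<Rightarrow>real\<Rightarrow>real. \<Sum>i=1..n. \<rho> (y i - H 0 (t i))"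
  let ?E = "\<lambda>k x. (1 - \<theta>) * F k x + \<theta> * G k x"
  have "?S ?E \<le> (\<Sum>i=1..n. (1 - \<theta>) * \<rho> (y i - F 0 (t i)) + \<theta> * \<rho> (y i - G 0 (t i)))"
  proof (rule sum_mono)
    fix i
    have "y i - ?E 0 (t i) = (1 - \<theta>) *\<^sub>R (y i - F 0 (t i)) + \<theta> *\<^sub>R (y i - G 0 (t i))"
      by (simp add: algebra_simps)
    then show "\<rho> (y i - ?E 0 (t i)) \<le> (1 - \<theta>) * \<rho> (y i - F 0 (t i)) + \<theta> * \<rho> (y i - G 0 (t i))"
      using convex_onD[OF conv \<theta>, of "y i - F 0 (t i)" "y i - G 0 (t i)"] by simp
  qed
  also have "\<dots> = (1 - \<theta>) * ?S F + \<theta> * ?S G" by (simp add: sum.distrib sum_distrib_left)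
  finally have S: "1 / real n * ?S ?E \<le> 1 / real n * ((1 - \<theta>) * ?S F + \<theta> * ?S G)" by (intro mult_left_mono) auto
  let ?a = "l2_norm (F m)" and ?b = "l2_norm (G m)"
  have "l2_norm (?E m) \<le> (1 - \<theta>) * ?a + \<theta> * ?b"
    using l2_norm_lin[OF sob_chain_sq_int[OF F order_refl] sob_chain_sq_int[OF G order_refl], of "1 - \<theta>" \<theta>] \<theta> by simp
  then have "(l2_norm (?E m))\<^sup>2 \<le> ((1 - \<theta>) * ?a + \<theta> * ?b)\<^sup>2" by (intro power_mono) auto
  also have "\<dots> = (1 - \<theta>) * ?a\<^sup>2 + \<theta> * ?b\<^sup>2 - \<theta> * (1 - \<theta>) * (?a - ?b)\<^sup>2"
    by (simp add: power2_eq_square algebra_simps)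
  also have "\<dots> \<le> (1 - \<theta>) * ?a\<^sup>2 + \<theta> * ?b\<^sup>2" using \<theta> by simp
  finally have "l * (l2_norm (?E m))\<^sup>2 \<le> l * ((1 - \<theta>) * ?a\<^sup>2 + \<theta> * ?b\<^sup>2)" using l by (intro mult_left_mono)
  moreover have "c * sE + q \<le> (1 - \<theta>) * (c * sF + l * u) + \<theta> * (c * sG + l * v)"
    if "c * sE \<le> c * ((1 - \<theta>) * sF + \<theta> * sG)" "q \<le> l * ((1 - \<theta>) * u + \<theta> * v)" for c sE sF sG q u v :: real
    using that by (simp add: algebra_simps)
  ultimately show ?thesis unfolding chain_objective_def using S by blast
qed

text \<open>Otherwise the segment from F to Fh crosses the sphere at parameter
  \<open>\<theta> = r / N\<close>, where convexity keeps the objective at or below its value at F.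
  The argument rests on the comparison \<open>le\<close> alone, so it covers every
  minimizer.\<close>

lemma minimizer_in_ball:
  assumes conv: "convex_on UNIV \<rho>" and l: "0 \<le> l" and F: "sob_chain m F" and Fh: "sob_chain m Fh"
    and le: "chain_objective m \<rho> l n t y Fh \<le> chain_objective m \<rho> l n t y F" and r: "r > 0"
    and sphere: "\<And>G. sob_chain m G \<Longrightarrow> (l2_norm (G 0))\<^sup>2 + l * (l2_norm (G m))\<^sup>2 = r\<^sup>2 \<Longrightarrow>
      chain_objective m \<rho> l n t y F < chain_objective m \<rho> l n t y (\<lambda>k x. 1 * F k x + 1 * G k x)"
  shows "(l2_norm (\<lambda>x. Fh 0 x - F 0 x))\<^sup>2 + l * (l2_norm (\<lambda>x. Fh m x - F m x))\<^sup>2 \<le> r\<^sup>2"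
proof (rule ccontr)
  define D where "D = (\<lambda>k x. Fh k x - F k x)"
  define N where "N = sqrt ((l2_norm (D 0))\<^sup>2 + l * (l2_norm (D m))\<^sup>2)"
  assume "\<not> ?thesis"
  then have gt: "r\<^sup>2 < (l2_norm (D 0))\<^sup>2 + l * (l2_norm (D m))\<^sup>2" by (simp add: D_def)
  have N2: "N\<^sup>2 = (l2_norm (D 0))\<^sup>2 + l * (l2_norm (D m))\<^sup>2" unfolding N_def using l by simp
  have rN: "r < N" using gt N2 r by (metis N_def real_less_rsqrt)
  define \<theta> where "\<theta> = r / N"
  have \<theta>: "0 \<le> \<theta>" "\<theta> \<le> 1" "0 < \<theta>" using rN r by (auto simp: \<theta>_def)
  have D: "sob_chain m D" using sob_chain_lin[OF Fh F, of 1 "-1"] by (simp add: D_def)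
  \<comment> \<open>The zero term only fits the shape of \<open>sob_chain_lin\<close>.\<close>
  define G where "G = (\<lambda>k x. \<theta> * D k x + 0 * D k x)"
  have G: "sob_chain m G" unfolding G_def by (rule sob_chain_lin[OF D D])
  have nG: "(l2_norm (G k))\<^sup>2 = \<theta>\<^sup>2 * (l2_norm (D k))\<^sup>2" for k
    unfolding G_def using l2_norm_scale[of \<theta> "D k"] by (simp add: power_mult_distrib)
  have "(l2_norm (G 0))\<^sup>2 + l * (l2_norm (G m))\<^sup>2 = \<theta>\<^sup>2 * N\<^sup>2"
    unfolding nG N2 by (simp add: algebra_simps)
  also have "\<dots> = r\<^sup>2" using rN r by (simp add: \<theta>_def power_divide)
  finally have "chain_objective m \<rho> l n t y F < chain_objective m \<rho> l n t y (\<lambda>k x. 1 * F k x + 1 * G k x)"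
    by (rule sphere[OF G])
  also have "(\<lambda>k x. 1 * F k x + 1 * G k x) = (\<lambda>k x. (1 - \<theta>) * F k x + \<theta> * Fh k x)"
    by (auto simp: G_def D_def algebra_simps)
  also have "chain_objective m \<rho> l n t y (\<lambda>k x. (1 - \<theta>) * F k x + \<theta> * Fh k x) \<le>
    (1 - \<theta>) * chain_objective m \<rho> l n t y F + \<theta> * chain_objective m \<rho> l n t y Fh"
    by (rule chain_objective_convex[OF conv l F Fh \<theta>(1,2)])
  also have "\<dots> \<le> (1 - \<theta>) * chain_objective m \<rho> l n t y F + \<theta> * chain_objective m \<rho> l n t y F"
    using le \<theta> by (intro add_left_mono mult_left_mono) auto
  also have "\<dots> = chain_objective m \<rho> l n t y F" by (simp add: algebra_simps)
  finally show False by simp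
qed

text \<open>The square of g has derivative \<open>2 * g * g'\<close>, whose L1 norm is bounded by
  Cauchy-Schwarz; the quadrature condition applies to it directly.\<close>

lemma design_quadrature_squares:
  assumes A5: "\<And>f. f \<in> sobolev 1 1 \<Longrightarrow> \<bar>1 / real n * (\<Sum>i=1..n. f (t i)) - (LINT x|lebesgue_on {0..1}. f x)\<bar>
                 \<le> M3 / real n * (LINT x|lebesgue_on {0..1}. \<bar>deriv01 1 f x\<bar>)"
    and M3: "0 \<le> M3" and g: "primitive01 g g'" and sq: "sq_int g'"
  shows "\<bar>1 / real n * (\<Sum>i=1..n. (g (t i))\<^sup>2) - (l2_norm g)\<^sup>2\<bar> \<le> 2 * M3 / real n * (l2_norm g * l2_norm g')"
proof -
  have gs: "sq_int g" using primitive01_continuous[OF g] by (rule sq_int_continuous)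
  note p = primitive01_mult[OF g g]
  have "(LINT x|lebesgue_on {0..1}. \<bar>g' x * g x + g x * g' x\<bar>) = 2 * l2_inner (\<lambda>x. \<bar>g x\<bar>) (\<lambda>x. \<bar>g' x\<bar>)"
  proof -
    have "(\<lambda>x. \<bar>g' x * g x + g x * g' x\<bar>) = (\<lambda>x. 2 * (\<bar>g x\<bar> * \<bar>g' x\<bar>))" by (rule ext) (simp add: abs_mult[symmetric])
    then show ?thesis unfolding l2_inner_def by simp
  qed
  also have "l2_inner (\<lambda>x. \<bar>g x\<bar>) (\<lambda>x. \<bar>g' x\<bar>) \<le> l2_norm (\<lambda>x. \<bar>g x\<bar>) * l2_norm (\<lambda>x. \<bar>g' x\<bar>)"
    using l2_Cauchy_Schwarz[of "\<lambda>x. \<bar>g x\<bar>" "\<lambda>x. \<bar>g' x\<bar>"] gs sq by (auto simp: sq_int_def)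
  also have "\<dots> = l2_norm g * l2_norm g'" unfolding l2_norm_def l2_inner_def by simp
  finally have I: "(LINT x|lebesgue_on {0..1}. \<bar>g' x * g x + g x * g' x\<bar>) \<le> 2 * (l2_norm g * l2_norm g')" by simp
  have "\<bar>1 / real n * (\<Sum>i=1..n. g (t i) * g (t i)) - (LINT x|lebesgue_on {0..1}. g x * g x)\<bar>
      \<le> M3 / real n * (LINT x|lebesgue_on {0..1}. \<bar>g' x * g x + g x * g' x\<bar>)"
    using A5[OF primitive01_sobolev_1_1(1)[OF p]] unfolding primitive01_sobolev_1_1(2)[OF p] .
  also have "\<dots> \<le> M3 / real n * (2 * (l2_norm g * l2_norm g'))" using I M3 by (intro mult_left_mono) auto
  finally show ?thesis unfolding l2_norm_power2 by (simp add: power2_eq_square algebra_simps)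
qed

context score_errors
begin

text \<open>Integrates the linear bounds on \<open>mu\<close> from 0 to u. For negative u both the
  orientation and the inequality are reversed.\<close>

lemma mu_prim_lower:
  assumes a: "0 < a" "a < \<kappa>"
    and low: "\<And>s. 0 \<le> s \<Longrightarrow> s \<le> a \<Longrightarrow> \<xi> / 2 * s \<le> mu s" "\<And>s. -a \<le> s \<Longrightarrow> s \<le> 0 \<Longrightarrow> mu s \<le> \<xi> / 2 * s"
    and u: "u \<in> {-a..a}"
  shows "\<xi> / 4 * u\<^sup>2 \<le> prim a mu u - prim a mu 0"
proof -
  have mb: "\<bar>mu s\<bar> \<le> M1" if "s \<in> {-a..a}" for s using that a by (intro mu_bound) auto
  have mi: "mu integrable_on {c..d}" if "-a \<le> c" "d \<le> a" for c d
    using mb that by (intro bounded_borel_integrable_on[OF mu_borel, where B=M1]) auto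
  have lin: "((\<lambda>s. \<xi> / 2 * s) has_integral (\<xi> / 4 * d\<^sup>2 - \<xi> / 4 * c\<^sup>2)) {c..d}" if "c \<le> d" for c d
    by (rule fundamental_theorem_of_calculus[OF that])
       (auto intro!: derivative_eq_intros simp: has_real_derivative_iff_has_vector_derivative[symmetric] power2_eq_square)
  show ?thesis
  proof (cases "0 \<le> u")
    case True
    have "integral {0..u} (\<lambda>s. \<xi> / 2 * s) \<le> integral {0..u} mu"
      using u a low(1) lin[OF True] by (intro integral_le mi) auto
    then show ?thesis using lin[OF True] u a prim_diff[OF mu_borel mb, of a 0 u] True
      by (auto simp: integral_unique)
  next
    case False
    then have u0: "u \<le> 0" by simp
    have "integral {u..0} mu \<le> integral {u..0} (\<lambda>s. \<xi> / 2 * s)"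
      using u a low(2) lin[OF u0] by (intro integral_le mi) auto
    then show ?thesis using lin[OF u0] u a prim_diff[OF mu_borel mb, of a u 0] u0
      by (auto simp: integral_unique)
  qed
qed

text \<open>Each observation contributes its linear score term and a Bregman remainder; the
  remainder is the integral of \<open>mu\<close>, bounded below by a quadratic, plus the integral of
  the centred \<open>z\<close>. The penalty is expanded exactly, with Cauchy-Schwarz for the cross
  term.\<close>

lemma objective_expansion:
  assumes sub: "subgradient_selection \<rho> \<psi>" and F: "sob_chain m F" and G: "sob_chain m G"
    and n: "n \<ge> 1" and l: "0 \<le> l" and a: "0 < a" "a < \<kappa>"
    and Gt: "\<And>i. i \<in> {1..n} \<Longrightarrow> \<bar>G 0 (t i)\<bar> \<le> a"
    and y: "\<And>i. i \<in> {1..n} \<Longrightarrow> y i = F 0 (t i) + \<epsilon> i \<omega>"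
    and low: "\<And>s. 0 \<le> s \<Longrightarrow> s \<le> a \<Longrightarrow> \<xi> / 2 * s \<le> mu s" "\<And>s. -a \<le> s \<Longrightarrow> s \<le> 0 \<Longrightarrow> mu s \<le> \<xi> / 2 * s"
  shows "chain_objective m \<rho> l n t y (\<lambda>k x. 1 * F k x + 1 * G k x) - chain_objective m \<rho> l n t y F \<ge>
    \<xi> / 4 * (1 / real n * (\<Sum>i=1..n. (G 0 (t i))\<^sup>2)) + l * (l2_norm (G m))\<^sup>2 - 2 * l * (l2_norm (F m) * l2_norm (G m))
    - 1 / real n * \<bar>\<Sum>i=1..n. \<psi> (\<epsilon> i \<omega>) * G 0 (t i)\<bar>
    - 1 / real n * \<bar>\<Sum>i=1..n. prim a (z i \<omega>) (G 0 (t i)) - prim a (z i \<omega>) 0\<bar>"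
proof -
  let ?u = "\<lambda>i. G 0 (t i)"
  let ?W = "\<Sum>i=1..n. prim a (z i \<omega>) (?u i) - prim a (z i \<omega>) 0" and ?N = "\<Sum>i=1..n. \<psi> (\<epsilon> i \<omega>) * ?u i"
  let ?Q = "\<Sum>i=1..n. (?u i)\<^sup>2"
  have summand: "\<rho> (y i - (1 * F 0 (t i) + 1 * G 0 (t i))) - \<rho> (y i - F 0 (t i)) \<ge>
      \<xi> / 4 * (?u i)\<^sup>2 - \<psi> (\<epsilon> i \<omega>) * ?u i + (prim a (z i \<omega>) (?u i) - prim a (z i \<omega>) 0)"
    if i: "i \<in> {1..n}" for i
  proof -
    have ua: "?u i \<in> {-a..a}" using Gt[OF i] by (auto simp: abs_le_iff)
    have zero: "0 \<in> {-a..a}" using a by simp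
    have mb: "\<bar>mu s\<bar> \<le> M1" if "s \<in> {-a..a}" for s using that a by (intro mu_bound) auto
    have zb: "\<bar>z i \<omega> s\<bar> \<le> 2 * M1" if "s \<in> {-a..a}" for s using that a by (intro z_bound) auto
    have split: "prim a (\<lambda>s. \<psi> (\<epsilon> i \<omega>) - \<psi> (\<epsilon> i \<omega> - s)) w = prim a (z i \<omega>) w + prim a mu w" if "w \<le> a" for w
      using prim_add[OF z_borel zb mu_borel mb that] by (simp add: z_def[abs_def])
    have "\<rho> (\<epsilon> i \<omega> - ?u i) - \<rho> (\<epsilon> i \<omega>) + \<psi> (\<epsilon> i \<omega>) * ?u i =
        (prim a (z i \<omega>) (?u i) - prim a (z i \<omega>) 0) + (prim a mu (?u i) - prim a mu 0)"
      unfolding bregman_eq_prim[OF sub ua] using ua zero by (simp add: split)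
    then show ?thesis using mu_prim_lower[OF a low ua] y[OF i] by simp
  qed
  have "(\<Sum>i=1..n. \<rho> (y i - (1 * F 0 (t i) + 1 * G 0 (t i))) - \<rho> (y i - F 0 (t i))) \<ge>
      (\<Sum>i=1..n. \<xi> / 4 * (?u i)\<^sup>2 - \<psi> (\<epsilon> i \<omega>) * ?u i + (prim a (z i \<omega>) (?u i) - prim a (z i \<omega>) 0))"
    by (intro sum_mono summand)
  also have "(\<Sum>i=1..n. \<xi> / 4 * (?u i)\<^sup>2 - \<psi> (\<epsilon> i \<omega>) * ?u i + (prim a (z i \<omega>) (?u i) - prim a (z i \<omega>) 0)) = \<xi> / 4 * ?Q - ?N + ?W"
    by (simp add: sum.distrib sum_subtractf sum_distrib_left)
  finally have S: "(\<Sum>i=1..n. \<rho> (y i - (1 * F 0 (t i) + 1 * G 0 (t i)))) - (\<Sum>i=1..n. \<rho> (y i - F 0 (t i)))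
    \<ge> \<xi> / 4 * ?Q - \<bar>?N\<bar> - \<bar>?W\<bar>"
    unfolding sum_subtractf by linarith
  have "1 / real n * ((\<Sum>i=1..n. \<rho> (y i - (1 * F 0 (t i) + 1 * G 0 (t i)))) - (\<Sum>i=1..n. \<rho> (y i - F 0 (t i)))) \<ge>
      1 / real n * (\<xi> / 4 * ?Q - \<bar>?N\<bar> - \<bar>?W\<bar>)"
    using S by (intro mult_left_mono) auto
  then have 1: "1 / real n * (\<Sum>i=1..n. \<rho> (y i - (1 * F 0 (t i) + 1 * G 0 (t i)))) - 1 / real n * (\<Sum>i=1..n. \<rho> (y i - F 0 (t i))) \<ge>
      \<xi> / 4 * (1 / real n * ?Q) - 1 / real n * \<bar>?N\<bar> - 1 / real n * \<bar>?W\<bar>"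
    by (simp add: algebra_simps)
  have sF: "sq_int (F m)" and sG: "sq_int (G m)" using F G by (auto simp: sob_chain_def)
  have "(l2_norm (\<lambda>x. 1 * F m x + 1 * G m x))\<^sup>2 - (l2_norm (F m))\<^sup>2 \<ge> (l2_norm (G m))\<^sup>2 - 2 * (l2_norm (F m) * l2_norm (G m))"
    unfolding l2_norm_lin_power2[OF sF sG] using l2_Cauchy_Schwarz[OF sF sG] by simp
  then have "l * ((l2_norm (\<lambda>x. 1 * F m x + 1 * G m x))\<^sup>2 - (l2_norm (F m))\<^sup>2)
    \<ge> l * ((l2_norm (G m))\<^sup>2 - 2 * (l2_norm (F m) * l2_norm (G m)))"
    using l by (intro mult_left_mono)
  then have 2: "l * (l2_norm (\<lambda>x. 1 * F m x + 1 * G m x))\<^sup>2 - l * (l2_norm (F m))\<^sup>2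
    \<ge> l * (l2_norm (G m))\<^sup>2 - 2 * l * (l2_norm (F m) * l2_norm (G m))"
    by (simp add: algebra_simps)
  from 1 2 show ?thesis unfolding chain_objective_def by linarith
qed

end

lemma (in prob_space) Markov_ennreal:
  assumes X: "X \<in> borel_measurable M" and E: "(\<integral>\<^sup>+\<omega>. X \<omega> \<partial>M) \<le> ennreal e" and r: "r > 0" "e \<le> r * d" "0 \<le> d"
  shows "{\<omega> \<in> space M. \<not> X \<omega> \<le> ennreal r} \<in> sets M" "emeasure M {\<omega> \<in> space M. \<not> X \<omega> \<le> ennreal r} \<le> ennreal d"
proof -
  show m: "{\<omega> \<in> space M. \<not> X \<omega> \<le> ennreal r} \<in> sets M" using X by measurable
  have "ennreal r * emeasure M {\<omega> \<in> space M. \<not> X \<omega> \<le> ennreal r}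
    = (\<integral>\<^sup>+\<omega>. ennreal r * indicator {\<omega> \<in> space M. \<not> X \<omega> \<le> ennreal r} \<omega> \<partial>M)"
    using m by (simp add: nn_integral_cmult_indicator)
  also have "\<dots> \<le> (\<integral>\<^sup>+\<omega>. X \<omega> \<partial>M)"
    by (intro nn_integral_mono) (auto simp: indicator_def)
  also have "\<dots> \<le> ennreal (r * d)" using E r(2) by (meson ennreal_leI order_trans)
  also have "\<dots> = ennreal r * ennreal d" using r by (simp add: ennreal_mult)
  finally show "emeasure M {\<omega> \<in> space M. \<not> X \<omega> \<le> ennreal r} \<le> ennreal d"
    using r(1) by (subst (asm) ennreal_mult_le_mult_iff) auto
qed

context score_errors
begin

text \<open>Interpolation bounds the first derivative by \<open>C1 * D * H / h\<close> and the sup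
  norm by a, after which the terms are measured in units of \<open>H\<^sup>2\<close>. The positive
  term is quadratic in D while the noise and cross terms are linear, so a large D wins; the
  remaining terms will carry extra small factors.\<close>

lemma sphere_positive:
  fixes h H c1 c2 Ci D a \<xi> M3 B X1 X2 \<theta> R l :: real
  assumes sub: "subgradient_selection \<rho> \<psi>" and F: "sob_chain m F" and m: "m \<ge> 1" and n: "n \<ge> 1"
    and h: "0 < h" "h \<le> 1/2" and H: "H = h ^ m" and nh: "real n * h * H\<^sup>2 = 1"
    and l: "c1 * H\<^sup>2 \<le> l" "l \<le> c2 * H\<^sup>2" "0 < c1" "0 < c2"
    and interp: "\<And>G j. sob_chain m G \<Longrightarrow> j \<le> m \<Longrightarrow> h ^ j * l2_norm (G j) \<le> Ci * (l2_norm (G 0) + h ^ m * l2_norm (G m))" "0 < Ci"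
    and C1: "C1 = Ci * (1 + 1 / sqrt c1)"
    and t: "\<And>i. i \<in> {1..n} \<Longrightarrow> t i \<in> {0..1}"
    and quad: "\<And>g g'. primitive01 g g' \<Longrightarrow> sq_int g' \<Longrightarrow>
      \<bar>1 / real n * (\<Sum>i=1..n. (g (t i))\<^sup>2) - (l2_norm g)\<^sup>2\<bar> \<le> 2 * M3 / real n * (l2_norm g * l2_norm g')" "0 \<le> M3"
    and D: "0 < D" and a: "a = (1 + C1) * D * H / sqrt h" "a < \<kappa>"
    and low: "\<And>s. 0 \<le> s \<Longrightarrow> s \<le> a \<Longrightarrow> \<xi> / 2 * s \<le> mu s" "\<And>s. -a \<le> s \<Longrightarrow> s \<le> 0 \<Longrightarrow> mu s \<le> \<xi> / 2 * s"
    and xi: "0 < \<xi>"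
    and y: "\<And>i. i \<in> {1..n} \<Longrightarrow> y i = F 0 (t i) + \<epsilon> i \<omega>"
    and noise: "\<And>g g'. primitive01 g g' \<Longrightarrow> sq_int g' \<Longrightarrow>
      \<bar>\<Sum>i=1..n. \<psi> (\<epsilon> i \<omega>) * g (t i)\<bar> \<le> l2_norm g * sqrt X1 + l2_norm g' * sqrt X2"
    and X: "X1 \<le> B * real n / h" "X2 \<le> B * real n * h" "0 < B"
    and fluct: "\<And>g g'. primitive01 g g' \<Longrightarrow> sq_int g' \<Longrightarrow> (\<forall>i\<in>{1..n}. \<bar>g (t i)\<bar> \<le> a) \<Longrightarrow>
      \<bar>\<Sum>i=1..n. prim a (z i \<omega>) (g (t i)) - prim a (z i \<omega>) 0\<bar> \<le>
        \<theta> * ((real K + 1) * l2_norm g' + (\<Sum>i=1..n. \<bar>g (t i)\<bar>) / 2^K + a) + R"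
    and K: "real n * h \<le> 2 * 2^K" and \<theta>: "0 < \<theta>"
    and G: "sob_chain m G" and sph: "(l2_norm (G 0))\<^sup>2 + l * (l2_norm (G m))\<^sup>2 = (D * H)\<^sup>2"
  shows "chain_objective m \<rho> l n t y (\<lambda>k x. 1 * F k x + 1 * G k x) - chain_objective m \<rho> l n t y F \<ge>
    H\<^sup>2 * (min (\<xi> / 4) 1 * D\<^sup>2 - D * ((1 + C1) * sqrt B + 2 * sqrt c2 * l2_norm (F m)))
    - \<xi> / 2 * M3 * C1 * D\<^sup>2 * H^4 - H\<^sup>2 * (\<theta> * H * (real K + 1) * (C1 + 2 * (1 + M3 * C1) + (1 + C1)) * D) - R / real n"
proof -
  let ?g0 = "l2_norm (G 0)" and ?g1 = "l2_norm (G 1)" and ?gm = "l2_norm (G m)"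
  have Hpos: "0 < H" "H \<le> 1" using h by (auto simp: H power_le_one)
  have npos: "0 < real n" using n by simp
  have inv_n: "1 / real n = h * H\<^sup>2" using nh npos by (simp add: field_simps)
  have lpos: "0 < l" using l Hpos by (smt (verit) mult_pos_pos zero_less_power)
  have C1pos: "0 < C1" using interp(2) l by (simp add: C1 add_pos_pos)
  have g0: "?g0 \<le> D * H"
  proof (rule power2_le_imp_le)
    have "0 \<le> l * ?gm\<^sup>2" using lpos by simp
    then show "?g0\<^sup>2 \<le> (D * H)\<^sup>2" using sph by linarith
  qed (use D Hpos in simp)
  have lgm: "l * ?gm\<^sup>2 \<le> (D * H)\<^sup>2" using sph by (smt (verit) zero_le_power2)
  have gm: "H * ?gm \<le> D * H / sqrt c1"
  proof -
    have "c1 * H\<^sup>2 * ?gm\<^sup>2 \<le> l * ?gm\<^sup>2" using l by (intro mult_right_mono) auto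
    then have "(sqrt c1 * (H * ?gm))\<^sup>2 \<le> (D * H)\<^sup>2" using lgm l by (simp add: power_mult_distrib mult.assoc)
    then have "sqrt c1 * (H * ?gm) \<le> D * H" by (rule power2_le_imp_le) (use D Hpos in auto)
    then show ?thesis using l by (simp add: field_simps)
  qed
  have g1: "h * ?g1 \<le> C1 * D * H"
  proof -
    have "h * ?g1 \<le> Ci * (?g0 + H * ?gm)" using interp(1)[OF G, of 1] m by (simp add: H)
    also have "\<dots> \<le> Ci * (D * H + D * H / sqrt c1)" using g0 gm interp(2) by (intro mult_left_mono add_mono) auto
    also have "\<dots> = C1 * D * H" by (simp add: C1 algebra_simps)
    finally show ?thesis .
  qed
  then have g1': "?g1 \<le> C1 * D * H / h" using h by (simp add: field_simps)
  have pr: "primitive01 (G 0) (G 1)" "sq_int (G 1)"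
    using sob_chain_primitive[OF G, of 0] sob_chain_sq_int[OF G, of 1] m by auto
  have apos: "0 < a" using C1pos D Hpos h by (simp add: a)
  have Gt: "\<bar>G 0 (t i)\<bar> \<le> a" if "i \<in> {1..n}" for i
  proof -
    have "\<bar>G 0 (t i)\<bar> \<le> ?g0 / sqrt h + sqrt h * ?g1" by (rule primitive01_sup_bound[OF pr h t[OF that]])
    also have "\<dots> = (?g0 + h * ?g1) / sqrt h" using h by (simp add: field_simps)
    also have "\<dots> \<le> (D * H + C1 * D * H) / sqrt h" using g0 g1 h by (intro divide_right_mono add_mono) auto
    also have "\<dots> = a" by (simp add: a algebra_simps)
    finally show ?thesis .
  qed
  let ?N = "\<bar>\<Sum>i=1..n. \<psi> (\<epsilon> i \<omega>) * G 0 (t i)\<bar>"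
  let ?W = "\<bar>\<Sum>i=1..n. prim a (z i \<omega>) (G 0 (t i)) - prim a (z i \<omega>) 0\<bar>"
  let ?Q = "1 / real n * (\<Sum>i=1..n. (G 0 (t i))\<^sup>2)"
  have N: "1 / real n * ?N \<le> H\<^sup>2 * (D * ((1 + C1) * sqrt B))"
  proof -
    have n_eq: "real n = 1 / (h * H\<^sup>2)" using nh h Hpos by (simp add: field_simps)
    have "B * real n / h = B / (h * H)\<^sup>2" unfolding n_eq using h Hpos by (simp add: power2_eq_square field_simps)
    then have s1: "sqrt X1 \<le> sqrt B / (h * H)"
      using X h Hpos real_sqrt_le_mono[OF X(1)] by (simp add: real_sqrt_divide)
    have "B * real n * h = B / H\<^sup>2" unfolding n_eq using h Hpos by (simp add: field_simps)
    then have s2: "sqrt X2 \<le> sqrt B / H"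
      using X h Hpos real_sqrt_le_mono[OF X(2)] by (simp add: real_sqrt_divide)
    have "?N \<le> ?g0 * sqrt X1 + ?g1 * sqrt X2" by (rule noise[OF pr])
    also have "\<dots> \<le> ?g0 * (sqrt B / (h * H)) + ?g1 * (sqrt B / H)"
      using s1 s2 by (intro add_mono mult_left_mono) auto
    also have "\<dots> \<le> D * H * (sqrt B / (h * H)) + C1 * D * H / h * (sqrt B / H)"
      using g0 g1' X h Hpos by (intro add_mono mult_right_mono) auto
    also have "\<dots> = (1 + C1) * D * sqrt B / h" using h Hpos by (simp add: field_simps)
    finally have "1 / real n * ?N \<le> 1 / real n * ((1 + C1) * D * sqrt B / h)" by (intro mult_left_mono) auto
    also have "\<dots> = H\<^sup>2 * (D * ((1 + C1) * sqrt B))" unfolding inv_n using h by simp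
    finally show ?thesis .
  qed
  have qerr: "\<bar>?Q - ?g0\<^sup>2\<bar> \<le> 2 * M3 * C1 * D\<^sup>2 * H^4"
  proof -
    have "\<bar>?Q - ?g0\<^sup>2\<bar> \<le> 2 * M3 / real n * (?g0 * ?g1)" by (rule quad(1)[OF pr])
    also have "\<dots> \<le> 2 * M3 / real n * (D * H * (C1 * D * H / h))"
      using g0 g1' quad(2) D Hpos by (intro mult_left_mono mult_mono) auto
    also have "\<dots> = 2 * M3 * (1 / real n) * (D * H * (C1 * D * H / h))" by simp
    also have "\<dots> = 2 * M3 * C1 * D\<^sup>2 * H^4" unfolding inv_n using h by (simp add: power2_eq_square power4_eq_xxxx)
    finally show ?thesis .
  qed
  \<comment> \<open>Bounded through \<open>2 * u * d \<le> u\<^sup>2 + d\<^sup>2\<close> with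
    \<open>d = D * H\<close>, since the quadrature estimate is available for squares.\<close>
  have su: "(\<Sum>i=1..n. \<bar>G 0 (t i)\<bar>) \<le> real n * (D * H * (1 + M3 * C1))"
  proof -
    have DH: "0 < D * H" using D Hpos by simp
    have "(\<Sum>i=1..n. \<bar>G 0 (t i)\<bar>) \<le> (\<Sum>i=1..n. ((G 0 (t i))\<^sup>2 / (D * H) + D * H) / 2)"
    proof (rule sum_mono)
      fix i
      have "2 * (\<bar>G 0 (t i)\<bar> * (D * H)) \<le> \<bar>G 0 (t i)\<bar>\<^sup>2 + (D * H)\<^sup>2" using sum_squares_bound[of "\<bar>G 0 (t i)\<bar>" "D * H"] by simp
      moreover have "u \<le> (q / d + d) / 2" if "2 * (u * d) \<le> q + d\<^sup>2" "0 < d" for u q d :: real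
      proof -
        have "(q / d + d) / 2 = (q + d\<^sup>2) / (2 * d)" using that by (simp add: field_simps power2_eq_square)
        then show ?thesis using that by (simp add: pos_le_divide_eq algebra_simps)
      qed
      ultimately show "\<bar>G 0 (t i)\<bar> \<le> ((G 0 (t i))\<^sup>2 / (D * H) + D * H) / 2"
        using DH by (simp only: power2_abs)
    qed
    also have "\<dots> = real n / 2 * (?Q / (D * H) + D * H)"
      using npos by (simp add: sum.distrib sum_divide_distrib[symmetric] field_simps)
    also have "\<dots> \<le> real n / 2 * ((D * H)\<^sup>2 * (1 + 2 * M3 * C1) / (D * H) + D * H)"
    proof -
      have "H^4 \<le> H^2" using Hpos by (intro power_decreasing) auto
      then have "2 * M3 * C1 * D\<^sup>2 * H^4 \<le> 2 * M3 * C1 * D\<^sup>2 * H^2" using quad(2) C1pos by (intro mult_left_mono) auto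
      moreover have "?g0\<^sup>2 \<le> (D * H)\<^sup>2" using g0 by (intro power_mono) auto
      ultimately have "?Q \<le> (D * H)\<^sup>2 * (1 + 2 * M3 * C1)" using qerr by (simp add: power_mult_distrib algebra_simps)
      then show ?thesis using DH npos by (intro mult_left_mono add_right_mono divide_right_mono) auto
    qed
    also have "\<dots> = real n * (D * H * (1 + M3 * C1))"
    proof -
      have "r / 2 * (d\<^sup>2 * (1 + 2 * c) / d + d) = r * (d * (1 + c))" if "0 < d" for r d c :: real
        using that by (simp add: field_simps power2_eq_square)
      from this[OF DH, of "real n" "M3 * C1"] show ?thesis by (simp only: mult.assoc)
    qed
    finally show ?thesis .
  qed
  have W: "1 / real n * ?W \<le> H\<^sup>2 * (\<theta> * H * (real K + 1) * (C1 + 2 * (1 + M3 * C1) + (1 + C1)) * D) + R / real n"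
  proof -
    have DHh: "0 \<le> D * H / h" using D Hpos h by simp
    \<comment> \<open>Blocks of about \<open>real n * h\<close> indices turn the size
      \<open>D * H\<close> of g into \<open>D * H / h\<close>, the scale of g'; this is what
      determines \<open>K\<close>.\<close>
    have "(\<Sum>i=1..n. \<bar>G 0 (t i)\<bar>) / 2^K \<le> real n * (D * H * (1 + M3 * C1)) / 2^K" using su by (intro divide_right_mono) auto
    also have "\<dots> \<le> 2 * (1 + M3 * C1) * (D * H / h)"
    proof -
      have "real n * h * (D * H * (1 + M3 * C1)) \<le> 2 * 2^K * (D * H * (1 + M3 * C1))"
        using K D Hpos quad(2) C1pos by (intro mult_right_mono) auto
      then show ?thesis using h by (simp add: field_simps)
    qed
    finally have b2: "(\<Sum>i=1..n. \<bar>G 0 (t i)\<bar>) / 2^K \<le> 2 * (1 + M3 * C1) * (D * H / h)" .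
    \<comment> \<open>Lets the sup bound a be absorbed into the common scale
      \<open>D * H / h\<close>.\<close>
    have "h \<le> sqrt h" using h by (intro real_le_rsqrt) (auto simp: power2_eq_square mult_le_one mult_left_le)
    then have "(1 + C1) * D * H / sqrt h \<le> (1 + C1) * D * H / h" using h C1pos D Hpos by (intro divide_left_mono) auto
    then have b3: "a \<le> (1 + C1) * (D * H / h)" by (simp add: a)
    have b1: "(real K + 1) * ?g1 \<le> (real K + 1) * (C1 * (D * H / h))" using g1' by (intro mult_left_mono) (auto simp: mult.assoc)
    have "(real K + 1) * ?g1 + (\<Sum>i=1..n. \<bar>G 0 (t i)\<bar>) / 2^K + a \<le>
        (real K + 1) * (C1 * (D * H / h)) + 2 * (1 + M3 * C1) * (D * H / h) + (1 + C1) * (D * H / h)"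
      using b1 b2 b3 by linarith
    also have "\<dots> \<le> (real K + 1) * (C1 * (D * H / h)) + (real K + 1) * (2 * (1 + M3 * C1) * (D * H / h))
      + (real K + 1) * ((1 + C1) * (D * H / h))"
    proof (intro add_mono order_refl)
      have *: "x \<le> (real K + 1) * x" if "0 \<le> x" for x using that by (simp add: algebra_simps)
      show "2 * (1 + M3 * C1) * (D * H / h) \<le> (real K + 1) * (2 * (1 + M3 * C1) * (D * H / h))"
        using DHh quad(2) C1pos by (intro * mult_nonneg_nonneg add_nonneg_nonneg) auto
      show "(1 + C1) * (D * H / h) \<le> (real K + 1) * ((1 + C1) * (D * H / h))"
        using DHh C1pos by (intro * mult_nonneg_nonneg) auto
    qed
    also have "\<dots> = (real K + 1) * (C1 + 2 * (1 + M3 * C1) + (1 + C1)) * (D * H / h)"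
    proof -
      have "k * (c * q) + k * (x * q) + k * (y * q) = k * (c + x + y) * q" for k c x y q :: real by algebra
      then show ?thesis .
    qed
    finally have inner: "(real K + 1) * ?g1 + (\<Sum>i=1..n. \<bar>G 0 (t i)\<bar>) / 2^K + a
      \<le> (real K + 1) * (C1 + 2 * (1 + M3 * C1) + (1 + C1)) * (D * H / h)" .
    have "?W \<le> \<theta> * ((real K + 1) * ?g1 + (\<Sum>i=1..n. \<bar>G 0 (t i)\<bar>) / 2^K + a) + R"
      by (rule fluct[OF pr]) (use Gt in blast)
    also have "\<dots> \<le> \<theta> * ((real K + 1) * (C1 + 2 * (1 + M3 * C1) + (1 + C1)) * (D * H / h)) + R"
      using inner \<theta> by (intro add_right_mono mult_left_mono) auto
    finally have "1 / real n * ?W \<le> 1 / real n * (\<theta> * ((real K + 1) * (C1 + 2 * (1 + M3 * C1) + (1 + C1)) * (D * H / h)) + R)"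
      by (intro mult_left_mono) auto
    also have "\<dots> = 1 / real n * (\<theta> * ((real K + 1) * (C1 + 2 * (1 + M3 * C1) + (1 + C1)) * (D * H / h))) + R / real n"
      by (simp add: add_divide_distrib)
    also have "1 / real n * (\<theta> * ((real K + 1) * (C1 + 2 * (1 + M3 * C1) + (1 + C1)) * (D * H / h))) =
        H\<^sup>2 * (\<theta> * H * (real K + 1) * (C1 + 2 * (1 + M3 * C1) + (1 + C1)) * D)"
      unfolding inv_n using h by (simp add: mult_ac)
    finally show ?thesis .
  qed
  have cross: "2 * l * (l2_norm (F m) * ?gm) \<le> H\<^sup>2 * (D * (2 * sqrt c2 * l2_norm (F m)))"
  proof -
    have s1: "sqrt l * ?gm \<le> D * H"
    proof (rule power2_le_imp_le)
      show "(sqrt l * ?gm)\<^sup>2 \<le> (D * H)\<^sup>2" using lgm lpos by (simp add: power_mult_distrib)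
    qed (use D Hpos in auto)
    have s2: "sqrt l \<le> sqrt c2 * H" using real_sqrt_le_mono[OF l(2)] Hpos by (simp add: real_sqrt_mult)
    have "sqrt l * (sqrt l * ?gm) \<le> (sqrt c2 * H) * (D * H)"
      by (rule mult_mono[OF s2 s1]) (use lpos l Hpos in auto)
    moreover have "sqrt l * (sqrt l * ?gm) = l * ?gm" using lpos by (simp flip: mult.assoc)
    ultimately have "l * ?gm \<le> sqrt c2 * D * H\<^sup>2" by (simp add: power2_eq_square mult_ac)
    then have "2 * l2_norm (F m) * (l * ?gm) \<le> 2 * l2_norm (F m) * (sqrt c2 * D * H\<^sup>2)" by (intro mult_left_mono) auto
    then show ?thesis by (simp add: mult_ac)
  qed
  \<comment> \<open>The sphere fixes only the sum of the two squared norms, hence the common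
    constant \<open>min (\<xi> / 4) 1\<close>.\<close>
  have main: "min (\<xi> / 4) 1 * (D * H)\<^sup>2 - \<xi> / 2 * M3 * C1 * D\<^sup>2 * H^4 \<le> \<xi> / 4 * ?Q + l * ?gm\<^sup>2"
  proof -
    have "\<xi> / 4 * (?g0\<^sup>2 - 2 * M3 * C1 * D\<^sup>2 * H^4) \<le> \<xi> / 4 * ?Q" using qerr xi by (intro mult_left_mono) auto
    moreover have "min (\<xi> / 4) 1 * ?g0\<^sup>2 \<le> \<xi> / 4 * ?g0\<^sup>2" by (intro mult_right_mono) auto
    moreover have "min (\<xi> / 4) 1 * (l * ?gm\<^sup>2) \<le> 1 * (l * ?gm\<^sup>2)" using lpos by (intro mult_right_mono) auto
    moreover have "min (\<xi> / 4) 1 * (D * H)\<^sup>2 = min (\<xi> / 4) 1 * ?g0\<^sup>2 + min (\<xi> / 4) 1 * (l * ?gm\<^sup>2)"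
      unfolding sph[symmetric] by (simp add: distrib_left)
    moreover have "\<xi> / 4 * (?g0\<^sup>2 - 2 * M3 * C1 * D\<^sup>2 * H^4) = \<xi> / 4 * ?g0\<^sup>2 - \<xi> / 2 * M3 * C1 * D\<^sup>2 * H^4"
      by (simp add: algebra_simps)
    ultimately show ?thesis by linarith
  qed
  have "H\<^sup>2 * (min (\<xi> / 4) 1 * D\<^sup>2 - D * ((1 + C1) * sqrt B + 2 * sqrt c2 * l2_norm (F m))) =
      min (\<xi> / 4) 1 * (D * H)\<^sup>2 - H\<^sup>2 * (D * ((1 + C1) * sqrt B)) - H\<^sup>2 * (D * (2 * sqrt c2 * l2_norm (F m)))"
    by (simp add: power_mult_distrib algebra_simps)
  then show ?thesis
    using objective_expansion[OF sub F G n less_imp_le[OF lpos] apos a(2) Gt y low] main N W cross by linarith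
qed

end

text \<open>\<open>P\<close> stands for \<open>2 ^ K\<close> and k for \<open>K + 1\<close>; the
  left side is a Markov level for the fourth-moment bound, divided by the cube of
  \<open>\<theta> = \<eta> / H\<close> and by n. Counting exponents, the two parts are
  \<open>H\<^sup>2\<close> times \<open>H\<^sup>2 / \<eta> ^ 21\<close> and \<open>H\<^sup>2\<close>
  times \<open>H ^ 3 / \<eta> ^ 15\<close>, up to constants and k; both quotients are at most \<eta>
  because \<open>H \<le> \<eta> ^ 12\<close>.\<close>

lemma remainder_bound:
  fixes \<eta> H A P k n \<delta> M1 M2 :: real
  assumes \<eta>: "0 < \<eta>" "\<eta> \<le> 1" and H: "0 < H" "H \<le> \<eta>^12" and A: "0 \<le> A" and P: "0 \<le> P" "P * H\<^sup>2 \<le> 1"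
    and k: "0 \<le> k" and n: "0 < n" and \<delta>: "0 < \<delta>" and M2: "0 \<le> M2"
  defines "a \<equiv> A * H / \<eta>^6"
  shows "3 / \<delta> * (2 * a * n * (6 * P * (M2 * a)\<^sup>2 + k * (4 * M1\<^sup>2 * (M2 * a)))) / (\<eta> / H)^3 / n \<le>
    H\<^sup>2 * (36 / \<delta> * M2\<^sup>2 * A^3 * \<eta> + 24 / \<delta> * M1\<^sup>2 * M2 * A\<^sup>2 * (\<eta> * k))"
proof -
  have H2: "H^2 \<le> \<eta> * \<eta>^21"
  proof -
    have "H^2 \<le> (\<eta>^12)^2" using H by (intro power_mono) auto
    also have "\<dots> = \<eta>^24" by (simp add: power_mult[symmetric])
    also have "\<dots> \<le> \<eta>^22" using \<eta> by (intro power_decreasing) auto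
    finally show ?thesis by (simp add: power_Suc[symmetric] del: power_Suc)
  qed
  have H3: "H^3 \<le> \<eta> * \<eta>^15"
  proof -
    have "H^3 \<le> (\<eta>^12)^3" using H by (intro power_mono) auto
    also have "\<dots> = \<eta>^36" by (simp add: power_mult[symmetric])
    also have "\<dots> \<le> \<eta>^16" using \<eta> by (intro power_decreasing) auto
    finally show ?thesis by (simp add: power_Suc[symmetric] del: power_Suc)
  qed
  have e1: "a^3 * P / (\<eta> / H)^3 \<le> H\<^sup>2 * (A^3 * \<eta>)"
  proof -
    have "a^3 * P / (\<eta> / H)^3 = A^3 * (P * H\<^sup>2) * H\<^sup>2 * (H\<^sup>2 / \<eta>^21)"
      using \<eta> H by (simp add: a_def power_divide power_mult_distrib power_mult[symmetric] field_simps eval_nat_numeral)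
    also have "\<dots> \<le> A^3 * 1 * H\<^sup>2 * \<eta>"
    proof -
      have "H\<^sup>2 / \<eta>^21 \<le> \<eta>" using H2 \<eta> by (simp add: pos_divide_le_eq)
      then show ?thesis using P A \<eta> by (intro mult_mono mult_left_mono mult_right_mono) auto
    qed
    finally show ?thesis by (simp add: mult_ac)
  qed
  have e2: "a\<^sup>2 / (\<eta> / H)^3 \<le> H\<^sup>2 * (A\<^sup>2 * \<eta>)"
  proof -
    have "a\<^sup>2 / (\<eta> / H)^3 = A\<^sup>2 * H\<^sup>2 * (H^3 / \<eta>^15)"
      using \<eta> H by (simp add: a_def power_divide power_mult_distrib power_mult[symmetric] field_simps eval_nat_numeral)
    also have "\<dots> \<le> A\<^sup>2 * H\<^sup>2 * \<eta>"
    proof -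
      have "H^3 / \<eta>^15 \<le> \<eta>" using H3 \<eta> by (simp add: pos_divide_le_eq)
      then show ?thesis by (intro mult_left_mono) auto
    qed
    finally show ?thesis by (simp add: mult_ac)
  qed
  have "3 / \<delta> * (2 * a * n * (6 * P * (M2 * a)\<^sup>2 + k * (4 * M1\<^sup>2 * (M2 * a)))) / (\<eta> / H)^3 / n =
      36 / \<delta> * M2\<^sup>2 * (a^3 * P / (\<eta> / H)^3) + 24 / \<delta> * M1\<^sup>2 * M2 * k * (a\<^sup>2 / (\<eta> / H)^3)"
  proof -
    define q where "q = (\<eta> / H)^3"
    have "0 < q" using \<eta> H by (simp add: q_def)
    then show ?thesis unfolding q_def[symmetric] using n \<delta> by (simp add: field_simps power2_eq_square power3_eq_cube)
  qed
  also have "\<dots> \<le> 36 / \<delta> * M2\<^sup>2 * (H\<^sup>2 * (A^3 * \<eta>)) + 24 / \<delta> * M1\<^sup>2 * M2 * k * (H\<^sup>2 * (A\<^sup>2 * \<eta>))"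
    using e1 e2 \<delta> M2 k by (intro add_mono mult_left_mono) auto
  finally show ?thesis by (simp add: algebra_simps)
qed

lemma powr_neg_times_log_tendsto_0:
  assumes "(p::real) > 0"
  shows "(\<lambda>n. real n powr (- p) * (log 2 (real n) + 1)) \<longlonglongrightarrow> 0"
  using assms by real_asymp

lemma powr_neg_tendsto_0:
  assumes "(p::real) > 0"
  shows "(\<lambda>n. real n powr (- p)) \<longlonglongrightarrow> 0"
  using assms by real_asymp

context score_errors
begin

text \<open>The constants are chosen in the order \<open>B\<close>, \<open>Q\<close>,
  \<open>D\<close>: Markov at level \<delta> fixes \<open>B\<close>, the linear terms on the sphere
  amount to \<open>D * Q\<close>, and D is then large enough for half of the quadratic term to
  dominate them. The other half absorbs the errors that vanish as n grows.\<close>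

lemma eventually_minimizers_close:
  fixes lam :: "nat \<Rightarrow> real" and t :: "nat \<Rightarrow> nat \<Rightarrow> real" and b M2 M3 \<xi> c1 c2 \<delta> :: real
  assumes sub: "subgradient_selection \<rho> \<psi>" and conv: "convex_on UNIV \<rho>" and F: "sob_chain m F" and m: "m \<ge> 1"
    and t: "\<And>n i. i \<in> {1..n} \<Longrightarrow> t n i \<in> {0..1}"
    and b: "0 < b" "b \<le> \<kappa>"
    and M2: "0 < M2" "\<And>a s. 0 < a \<Longrightarrow> a < b \<Longrightarrow> s \<in> {-a..a} \<Longrightarrow>
      expectation (\<lambda>\<omega>. (\<psi> (\<epsilon> 1 \<omega> - s) - \<psi> (\<epsilon> 1 \<omega>))\<^sup>2) \<le> M2 * a"
    and low: "\<And>s. 0 \<le> s \<Longrightarrow> s < b \<Longrightarrow> \<xi> / 2 * s \<le> mu s" "\<And>s. -b < s \<Longrightarrow> s \<le> 0 \<Longrightarrow> mu s \<le> \<xi> / 2 * s"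
    and xi: "0 < \<xi>"
    and A5: "\<And>n f. n \<ge> 2 \<Longrightarrow> f \<in> sobolev 1 1 \<Longrightarrow>
      \<bar>1 / real n * (\<Sum>i=1..n. f (t n i)) - (LINT x|lebesgue_on {0..1}. f x)\<bar>
        \<le> M3 / real n * (LINT x|lebesgue_on {0..1}. \<bar>deriv01 1 f x\<bar>)" "0 \<le> M3"
    and lam: "\<forall>\<^sub>F n in sequentially. c1 * (hh n ^ m)\<^sup>2 \<le> lam n \<and> lam n \<le> c2 * (hh n ^ m)\<^sup>2" "0 < c1" "0 < c2"
    and hh: "\<And>n. hh n = real n powr (- (1 / (2 * real m + 1)))"
    and \<delta>: "0 < \<delta>"
  shows "\<exists>D>0. \<forall>\<^sub>F n in sequentially. \<exists>A\<in>sets M. emeasure M A \<le> ennreal \<delta> \<and>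
    (\<forall>\<omega>\<in>space M - A. \<forall>y Fh. (\<forall>i\<in>{1..n}. y i = F 0 (t n i) + \<epsilon> i \<omega>) \<longrightarrow> sob_chain m Fh \<longrightarrow>
      chain_objective m \<rho> (lam n) n (t n) y Fh \<le> chain_objective m \<rho> (lam n) n (t n) y F \<longrightarrow>
      (l2_norm (\<lambda>x. Fh 0 x - F 0 x))\<^sup>2 + lam n * (l2_norm (\<lambda>x. Fh m x - F m x))\<^sup>2 \<le> (D * hh n ^ m)\<^sup>2)"
proof -
  obtain Ci where Ci: "Ci > 0" "\<And>G h j. sob_chain m G \<Longrightarrow> 0 < h \<Longrightarrow> h \<le> 1/2 \<Longrightarrow> j \<le> m \<Longrightarrow>
     h ^ j * l2_norm (G j) \<le> Ci * (l2_norm (G 0) + h ^ m * l2_norm (G m))"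
    using interpolation_general[of m] by metis
  define C1 where "C1 = Ci * (1 + 1 / sqrt c1)"
  have C1: "0 < C1" using Ci lam by (simp add: C1_def add_pos_pos)
  define \<sigma> where "\<sigma> = expectation (\<lambda>\<omega>. (\<psi> (\<epsilon> 1 \<omega>))\<^sup>2)"
  have \<sigma>: "0 \<le> \<sigma>" by (simp add: \<sigma>_def)
  \<comment> \<open>Each of three exceptional events receives probability at most
    \<open>\<delta> / 3\<close>; the added 1 keeps \<open>B\<close> positive when \<sigma> is
    0.\<close>
  define B where "B = 3 * \<sigma> / \<delta> + 1"
  have B: "0 < B" using \<sigma> \<delta> by (simp add: B_def add_nonneg_pos)
  define k0 where "k0 = min (\<xi> / 4) 1"
  have k0: "0 < k0" using xi by (simp add: k0_def)
  define Q where "Q = (1 + C1) * sqrt B + 2 * sqrt c2 * l2_norm (F m)"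
  have Q: "0 \<le> Q" using C1 B lam by (simp add: Q_def)
  define D where "D = 2 * Q / k0 + 1"
  have D: "0 < D" using Q k0 by (simp add: D_def add_nonneg_pos)
  have DQ: "D * Q \<le> k0 * D\<^sup>2 / 2"
  proof -
    have "Q \<le> k0 * D / 2" using k0 by (simp add: D_def field_simps)
    then have "D * Q \<le> D * (k0 * D / 2)" using D by (intro mult_left_mono) auto
    then show ?thesis by (simp add: power2_eq_square mult_ac)
  qed
  define A' where "A' = (1 + C1) * D"
  have A': "0 < A'" using C1 D by (simp add: A'_def)
  define C5 where "C5 = C1 + 2 * (1 + M3 * C1) + (1 + C1)"
  define C6 where "C6 = 36 / \<delta> * M2\<^sup>2 * A' ^ 3"
  define C7 where "C7 = 24 / \<delta> * M1\<^sup>2 * M2 * A'\<^sup>2"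
  define C8 where "C8 = \<xi> / 2 * M3 * C1 * D\<^sup>2 + C6"
  define C9 where "C9 = C5 * D + C7"
  have C5: "0 \<le> C5" using C1 A5(2) by (simp add: C5_def)
  have C7: "0 \<le> C7" using \<delta> M2 by (simp add: C7_def)
  have C9: "0 \<le> C9" using C5 C7 D by (simp add: C9_def)
  (* e = n powr -p satisfies e^12 = h: all remainder terms become multiples of h^(2m) e log n. *)
  define p where "p = 1 / (12 * (2 * real m + 1))"
  have p: "p > 0" by (simp add: p_def)
  define \<eta> where "\<eta> = (\<lambda>n. real n powr (- p))"
  have lim1: "\<eta> \<longlonglongrightarrow> 0" unfolding \<eta>_def by (rule powr_neg_tendsto_0[OF p])
  have lim2: "(\<lambda>n. \<eta> n * (log 2 (real n) + 1)) \<longlonglongrightarrow> 0" unfolding \<eta>_def by (rule powr_neg_times_log_tendsto_0[OF p])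
  have lim3: "(\<lambda>n. C8 * \<eta> n + C9 * (\<eta> n * (log 2 (real n) + 1))) \<longlonglongrightarrow> C8 * 0 + C9 * 0"
    by (intro tendsto_intros lim1 lim2)
  have ev3: "\<forall>\<^sub>F n in sequentially. C8 * \<eta> n + C9 * (\<eta> n * (log 2 (real n) + 1)) < k0 * D\<^sup>2 / 2"
    by (rule order_tendstoD(2)[OF lim3]) (use k0 D in simp)
  have ev1: "\<forall>\<^sub>F n in sequentially. \<eta> n < 1/2" by (rule order_tendstoD(2)[OF lim1]) simp
  have ev2: "\<forall>\<^sub>F n in sequentially. \<eta> n < b / A'" by (rule order_tendstoD(2)[OF lim1]) (use b A' in simp)
  have ev0: "\<forall>\<^sub>F n in sequentially. n \<ge> 2" by (rule eventually_ge_at_top)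
  show ?thesis
  proof (intro exI[of _ D] conjI D)
    show "\<forall>\<^sub>F n in sequentially. \<exists>A\<in>sets M. emeasure M A \<le> ennreal \<delta> \<and>
    (\<forall>\<omega>\<in>space M - A. \<forall>y Fh. (\<forall>i\<in>{1..n}. y i = F 0 (t n i) + \<epsilon> i \<omega>) \<longrightarrow> sob_chain m Fh \<longrightarrow>
      chain_objective m \<rho> (lam n) n (t n) y Fh \<le> chain_objective m \<rho> (lam n) n (t n) y F \<longrightarrow>
      (l2_norm (\<lambda>x. Fh 0 x - F 0 x))\<^sup>2 + lam n * (l2_norm (\<lambda>x. Fh m x - F m x))\<^sup>2 \<le> (D * hh n ^ m)\<^sup>2)"
      using ev0 ev1 ev2 ev3 lam(1)
    proof eventually_elim
      fix n :: nat
      assume n2: "n \<ge> 2" and e_half: "\<eta> n < 1/2" and e_b: "\<eta> n < b / A'"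
        and small: "C8 * \<eta> n + C9 * (\<eta> n * (log 2 (real n) + 1)) < k0 * D\<^sup>2 / 2"
        and l: "c1 * (hh n ^ m)\<^sup>2 \<le> lam n \<and> lam n \<le> c2 * (hh n ^ m)\<^sup>2"
      have n: "n \<ge> 1" and npos: "0 < real n" using n2 by auto
      define e where "e = \<eta> n"
      define h where "h = hh n"
      define H where "H = h ^ m"
      have e: "0 < e" "e \<le> 1" "e < 1/2" using npos e_half by (auto simp: e_def \<eta>_def)
      have he: "h = e ^ 12"
      proof -
        have "e ^ 12 = real n powr (- p * real 12)"
          unfolding e_def \<eta>_def using npos by (subst powr_power) (auto simp: mult.commute)
        also have "- p * real 12 = - (1 / (2 * real m + 1))"
        proof -
          have "- (1 / (12 * d)) * 12 = - (1 / d)" for d :: real by simp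
          then show ?thesis by (simp only: p_def of_nat_numeral)
        qed
        finally show ?thesis by (simp add: h_def hh)
      qed
      have hle: "h \<le> e" unfolding he using e power_decreasing[of 1 12 e] by simp
      have h: "0 < h" "h \<le> 1/2" using e hle by (auto simp: he)
      have Hh: "H \<le> h" unfolding H_def using h m power_decreasing[of 1 m h] by simp
      have Hpos: "0 < H" using h by (simp add: H_def)
      have Hle: "H \<le> e ^ 12" "H \<le> e" "H \<le> 1" using Hh hle he e by auto
      \<comment> \<open>This is \<open>h ^ (2 * m + 1) = 1 / n\<close>: variance and squared bias
        agree at this scale.\<close>
      have nh: "real n * h * H\<^sup>2 = 1"
      proof -
        have "h * H\<^sup>2 = h ^ (2 * m + 1)" by (simp add: H_def power_mult[symmetric] mult.commute)
        also have "\<dots> = real n powr (- (1 / (2 * real m + 1)) * real (2 * m + 1))"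
          unfolding h_def hh using npos by (subst powr_power) auto
        also have "- (1 / (2 * real m + 1)) * real (2 * m + 1) = -1" by simp
        also have "real n powr -1 = 1 / real n" using npos by (simp add: powr_minus_divide)
        finally show ?thesis using npos by (simp add: field_simps)
      qed
      define a where "a = (1 + C1) * D * H / sqrt h"
      have sh: "sqrt h = e ^ 6"
        by (rule real_sqrt_unique) (use e in \<open>auto simp: he power_mult[symmetric]\<close>)
      have aA: "a = A' * H / e ^ 6" by (simp add: a_def A'_def sh)
      have apos: "0 < a" using A' Hpos e by (simp add: aA)
      have ab: "a < b"
      proof -
        have "H / e^6 \<le> e^12 / e^6" using Hle e by (intro divide_right_mono) auto
        also have "\<dots> = e ^ 6" using e by (simp add: field_simps power_add[symmetric])
        also have "\<dots> \<le> e" using e power_decreasing[of 1 6 e] by simp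
        finally have "A' * (H / e^6) \<le> A' * e" using A' by (intro mult_left_mono) auto
        also have "A' * e < b" using e_b A' by (simp add: e_def field_simps)
        finally show ?thesis by (simp add: aA)
      qed
      have ak: "a < \<kappa>" using ab b by simp
      define v where "v = M2 * a"
      have vpos: "0 < v" using M2 apos by (simp add: v_def)
      \<comment> \<open>The coarsest block size \<open>2 ^ K\<close> is within a factor 2 of
        \<open>real n * h\<close>, which for a nearly uniform design is about the number of points
        in a window.\<close>
      define K where "K = nat \<lfloor>log 2 (real n * h)\<rfloor>"
      have nh1: "1 \<le> real n * h"
      proof -
        have "H\<^sup>2 \<le> 1" using Hpos Hle by (simp add: power_le_one)
        then have "real n * h * H\<^sup>2 \<le> real n * h * 1" using h by (intro mult_left_mono) auto
        then show ?thesis using nh by simp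
      qed
      have lognn: "0 \<le> log 2 (real n * h)" using nh1 by simp
      have Kf: "real K \<le> log 2 (real n * h)" "log 2 (real n * h) < real K + 1"
        unfolding K_def using lognn by linarith+
      have KP: "2 ^ K \<le> real n * h" "real n * h \<le> 2 * 2 ^ K"
      proof -
        have "2 powr (real K) \<le> 2 powr (log 2 (real n * h))" using Kf by (intro powr_mono) auto
        then show "2 ^ K \<le> real n * h" using nh1 by (simp add: powr_realpow)
        have "2 powr (log 2 (real n * h)) \<le> 2 powr (real K + 1)" using Kf by (intro powr_mono) auto
        then show "real n * h \<le> 2 * 2 ^ K" using nh1 by (simp add: powr_realpow powr_add mult.commute)
      qed
      have Klog: "real K \<le> log 2 (real n)"
      proof -
        have "log 2 (real n * h) \<le> log 2 (real n)" using nh1 h npos by (subst log_le_cancel_iff) (auto simp: mult_le_cancel_left1)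
        then show ?thesis using Kf by linarith
      qed
      have vs: "expectation (\<lambda>\<omega>. (\<psi> (\<epsilon> 1 \<omega> - s) - \<psi> (\<epsilon> 1 \<omega>))\<^sup>2) \<le> v" if "s \<in> {-a..a}" for s
        unfolding v_def by (rule M2(2)[OF apos ab that])
      have tn: "t n i \<in> {0..1}" if "i \<in> {1..n}" for i by (rule t[OF that])
      obtain X1 X2 where X12: "integrable M X1" "integrable M X2" "\<And>\<omega>. 0 \<le> X1 \<omega>" "\<And>\<omega>. 0 \<le> X2 \<omega>"
        "expectation X1 \<le> real n * \<sigma> / h" "expectation X2 \<le> real n * \<sigma> * h"
        and noise: "\<And>\<omega> g g'. primitive01 g g' \<Longrightarrow> sq_int g' \<Longrightarrow>
          \<bar>\<Sum>i=1..n. \<psi> (\<epsilon> i \<omega>) * g (t n i)\<bar> \<le> l2_norm g * sqrt (X1 \<omega>) + l2_norm g' * sqrt (X2 \<omega>)"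
        by (rule noise_control[where n=n and t="t n", OF h tn, folded \<sigma>_def]; (assumption | (rule that; assumption)))
      define E3 where "E3 = 2 * a * real n * (6 * 2^K * v\<^sup>2 + (real K + 1) * (4 * M1\<^sup>2 * v))"
      have E3: "0 < E3" unfolding E3_def using apos npos vpos
        by (intro mult_pos_pos add_pos_nonneg) auto
      obtain X3 where X3: "X3 \<in> borel_measurable M" "(\<integral>\<^sup>+\<omega>. X3 \<omega> \<partial>M) \<le> ennreal E3"
        and fluct: "\<And>\<omega> g g' r \<theta>. primitive01 g g' \<Longrightarrow> sq_int g' \<Longrightarrow> (\<forall>i\<in>{1..n}. \<bar>g (t n i)\<bar> \<le> a) \<Longrightarrow> X3 \<omega> \<le> ennreal r \<Longrightarrow> 0 \<le> r \<Longrightarrow> \<theta> > 0 \<Longrightarrow>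
          \<bar>\<Sum>i=1..n. prim a (z i \<omega>) (g (t n i)) - prim a (z i \<omega>) 0\<bar> \<le>
          \<theta> * ((real K + 1) * l2_norm g' + (\<Sum>i=1..n. \<bar>g (t n i)\<bar>) / 2^K + a) + r / \<theta>^3"
        using fluctuation_control[where n=n and t="t n" and K=K, OF apos ak n tn vs, folded E3_def] by blast
      define r3 where "r3 = 3 / \<delta> * E3"
      have r3: "0 < r3" using E3 \<delta> by (simp add: r3_def)
      let ?A1 = "{\<omega> \<in> space M. \<not> ennreal (X1 \<omega>) \<le> ennreal (B * real n / h)}"
      let ?A2 = "{\<omega> \<in> space M. \<not> ennreal (X2 \<omega>) \<le> ennreal (B * real n * h)}"
      let ?A3 = "{\<omega> \<in> space M. \<not> X3 \<omega> \<le> ennreal r3}"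
      have Bd: "\<sigma> \<le> B * (\<delta> / 3)" using \<delta> by (simp add: B_def field_simps)
      have m1: "(\<lambda>\<omega>. ennreal (X1 \<omega>)) \<in> borel_measurable M" "(\<lambda>\<omega>. ennreal (X2 \<omega>)) \<in> borel_measurable M"
        using X12 by auto
      have i1: "(\<integral>\<^sup>+\<omega>. ennreal (X1 \<omega>) \<partial>M) \<le> ennreal (real n * \<sigma> / h)"
        using X12 by (subst nn_integral_eq_integral) (auto intro: ennreal_leI)
      have i2: "(\<integral>\<^sup>+\<omega>. ennreal (X2 \<omega>) \<partial>M) \<le> ennreal (real n * \<sigma> * h)"
        using X12 by (subst nn_integral_eq_integral) (auto intro: ennreal_leI)
      have d3: "0 \<le> \<delta> / 3" using \<delta> by simp
      have r1: "0 < B * real n / h" "real n * \<sigma> / h \<le> B * real n / h * (\<delta> / 3)"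
        using B npos h mult_left_mono[OF Bd, of "real n / h"] by (auto simp: mult_ac)
      have r2: "0 < B * real n * h" "real n * \<sigma> * h \<le> B * real n * h * (\<delta> / 3)"
        using B npos h mult_left_mono[OF Bd, of "real n * h"] by (auto simp: mult_ac)
      have e3: "E3 \<le> r3 * (\<delta> / 3)" using \<delta> by (simp add: r3_def)
      note S1 = Markov_ennreal[OF m1(1) i1 r1 d3] and S2 = Markov_ennreal[OF m1(2) i2 r2 d3]
        and S3 = Markov_ennreal[OF X3 r3 e3 d3]
      define A where "A = ?A1 \<union> ?A2 \<union> ?A3"
      have Am: "A \<in> sets M" unfolding A_def using S1(1) S2(1) S3(1) by auto
      have "emeasure M A \<le> emeasure M (?A1 \<union> ?A2) + emeasure M ?A3"
        unfolding A_def using S1(1) S2(1) S3(1) by (intro emeasure_subadditive) auto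
      also have "\<dots> \<le> (emeasure M ?A1 + emeasure M ?A2) + emeasure M ?A3"
        using S1(1) S2(1) by (intro add_right_mono emeasure_subadditive) auto
      also have "\<dots> \<le> (ennreal (\<delta> / 3) + ennreal (\<delta> / 3)) + ennreal (\<delta> / 3)"
        by (intro add_mono S1(2) S2(2) S3(2))
      also have "\<dots> = ennreal \<delta>" using \<delta> by (simp add: ennreal_plus[symmetric] del: ennreal_plus)
      finally have Ad: "emeasure M A \<le> ennreal \<delta>" .
      show "\<exists>A\<in>sets M. emeasure M A \<le> ennreal \<delta> \<and>
        (\<forall>\<omega>\<in>space M - A. \<forall>y Fh. (\<forall>i\<in>{1..n}. y i = F 0 (t n i) + \<epsilon> i \<omega>) \<longrightarrow> sob_chain m Fh \<longrightarrow>
          chain_objective m \<rho> (lam n) n (t n) y Fh \<le> chain_objective m \<rho> (lam n) n (t n) y F \<longrightarrow>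
          (l2_norm (\<lambda>x. Fh 0 x - F 0 x))\<^sup>2 + lam n * (l2_norm (\<lambda>x. Fh m x - F m x))\<^sup>2 \<le> (D * hh n ^ m)\<^sup>2)"
      proof (intro bexI[OF _ Am] conjI Ad ballI allI impI)
        fix \<omega> y Fh
        assume \<omega>: "\<omega> \<in> space M - A" and y: "\<forall>i\<in>{1..n}. y i = F 0 (t n i) + \<epsilon> i \<omega>" and Fh: "sob_chain m Fh"
          and le: "chain_objective m \<rho> (lam n) n (t n) y Fh \<le> chain_objective m \<rho> (lam n) n (t n) y F"
        have X1r: "X1 \<omega> \<le> B * real n / h" and X2r: "X2 \<omega> \<le> B * real n * h" and X3r: "X3 \<omega> \<le> ennreal r3"
          using \<omega> r1(1) r2(1) by (auto simp: A_def ennreal_le_iff)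
        have lc: "c1 * H\<^sup>2 \<le> lam n" "lam n \<le> c2 * H\<^sup>2" using l by (auto simp: H_def h_def)
        have l0: "0 \<le> lam n" using lc(1) lam(2) by (smt (verit) mult_nonneg_nonneg zero_le_power2)
        \<comment> \<open>Variation then costs a multiple of \<open>e\<close> per level relative to
          \<open>H\<^sup>2\<close>, and the number of levels is at most logarithmic in n.\<close>
        define \<theta> where "\<theta> = e / H"
        have \<theta>: "0 < \<theta>" "\<theta> * H = e" using e Hpos by (auto simp: \<theta>_def)
        have quad: "\<bar>1 / real n * (\<Sum>i=1..n. (g (t n i))\<^sup>2) - (l2_norm g)\<^sup>2\<bar> \<le> 2 * M3 / real n * (l2_norm g * l2_norm g')"
          if "primitive01 g g'" "sq_int g'" for g g'
          by (rule design_quadrature_squares[OF A5(1)[OF n2] A5(2) that])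
        have pos: "chain_objective m \<rho> (lam n) n (t n) y F < chain_objective m \<rho> (lam n) n (t n) y (\<lambda>k x. 1 * F k x + 1 * G k x)"
          if G: "sob_chain m G" and sph: "(l2_norm (G 0))\<^sup>2 + lam n * (l2_norm (G m))\<^sup>2 = (D * H)\<^sup>2" for G
        proof -
          have diff: "chain_objective m \<rho> (lam n) n (t n) y (\<lambda>k x. 1 * F k x + 1 * G k x)
            - chain_objective m \<rho> (lam n) n (t n) y F \<ge>
              H\<^sup>2 * (k0 * D\<^sup>2 - D * Q) - \<xi> / 2 * M3 * C1 * D\<^sup>2 * H^4 - H\<^sup>2 * (\<theta> * H * (real K + 1) * C5 * D) - r3 / \<theta>^3 / real n"
            unfolding k0_def Q_def C5_def
          proof (rule sphere_positive[OF sub F m n h H_def nh lc lam(2,3) Ci(2)[OF _ h] Ci(1) C1_def t quad A5(2) D a_def ak _ _ xi _ noise X1r X2r B fluct KP(2) \<theta>(1) G sph])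
            show "\<xi> / 2 * s \<le> mu s" if "0 \<le> s" "s \<le> a" for s using low(1)[of s] that ab by simp
            show "mu s \<le> \<xi> / 2 * s" if "- a \<le> s" "s \<le> 0" for s using low(2)[of s] that ab by simp
            show "y i = F 0 (t n i) + \<epsilon> i \<omega>" if "i \<in> {1..n}" for i using y that by blast
          qed (use X3r r3 \<theta> in auto)
          have "r3 / \<theta>^3 / real n \<le> H\<^sup>2 * (C6 * e + C7 * (e * (real K + 1)))"
          proof -
            have "2 ^ K * H\<^sup>2 \<le> real n * h * H\<^sup>2" using KP(1) by (intro mult_right_mono) auto
            then have "2 ^ K * H\<^sup>2 \<le> 1" using nh by simp
            from remainder_bound[OF e(1,2) Hpos Hle(1) less_imp_le[OF A'] _ this _ npos \<delta> less_imp_le[OF M2(1)], of "real K + 1" M1, folded aA]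
            show ?thesis unfolding r3_def E3_def \<theta>_def v_def C6_def C7_def by simp
          qed
          moreover have "H^4 \<le> H\<^sup>2 * e"
          proof -
            have "H\<^sup>2 \<le> e" using Hpos Hle by (simp add: power2_eq_square) (meson less_imp_le mult_le_one mult_left_le order_trans)
            then have "H\<^sup>2 * H\<^sup>2 \<le> H\<^sup>2 * e" by (intro mult_left_mono) auto
            then show ?thesis by (simp add: power2_eq_square power4_eq_xxxx mult.assoc)
          qed
          then have "\<xi> / 2 * M3 * C1 * D\<^sup>2 * H^4 \<le> \<xi> / 2 * M3 * C1 * D\<^sup>2 * (H\<^sup>2 * e)"
            using xi A5(2) C1 by (intro mult_left_mono) auto
          moreover have "H\<^sup>2 * (\<theta> * H * (real K + 1) * C5 * D) = H\<^sup>2 * (C5 * D * (e * (real K + 1)))"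
            unfolding \<theta>(2) by (simp add: mult_ac)
          ultimately have lower: "H\<^sup>2 * (k0 * D\<^sup>2 - D * Q - C8 * e - C9 * (e * (real K + 1))) \<le>
              chain_objective m \<rho> (lam n) n (t n) y (\<lambda>k x. 1 * F k x + 1 * G k x) - chain_objective m \<rho> (lam n) n (t n) y F"
            using diff unfolding C8_def C9_def by (simp add: algebra_simps)
          have "C9 * (e * (real K + 1)) \<le> C9 * (\<eta> n * (log 2 (real n) + 1))"
            unfolding e_def[symmetric] using Klog e C9 by (intro mult_left_mono) auto
          then have "0 < k0 * D\<^sup>2 - D * Q - C8 * e - C9 * (e * (real K + 1))"
            using small DQ unfolding e_def[symmetric] by linarith
          then have "0 < H\<^sup>2 * (k0 * D\<^sup>2 - D * Q - C8 * e - C9 * (e * (real K + 1)))" using Hpos by (intro mult_pos_pos) auto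
          then show ?thesis using lower by linarith
        qed
        have "0 < D * H" using D Hpos by simp
        from minimizer_in_ball[OF conv l0 F Fh le this pos]
        show "(l2_norm (\<lambda>x. Fh 0 x - F 0 x))\<^sup>2 + lam n * (l2_norm (\<lambda>x. Fh m x - F m x))\<^sup>2 \<le> (D * hh n ^ m)\<^sup>2"
          by (simp add: H_def h_def)
      qed
    qed
  qed
qed

end

section \<open>Stochastic order and the final rates\<close>

text \<open>The measurable set \<open>A\<close> contains the exceptional event, so its measure
  controls the outer measure of that event, measurable or not.\<close>

lemma bigO_prob_if_bounded_off_small_sets:
  assumes "\<And>\<delta>. \<delta> > 0 \<Longrightarrow> \<exists>C>0. \<forall>\<^sub>F n in sequentially. \<exists>A\<in>sets M. emeasure M A \<le> ennreal \<delta> \<and> (\<forall>\<omega>\<in>space M - A. \<bar>X n \<omega>\<bar> \<le> C * a n)"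
  shows "bigO_prob M X a"
  unfolding bigO_prob_def
proof (intro allI impI)
  fix \<delta> :: real assume "\<delta> > 0"
  from assms[OF this] obtain C where C: "C > 0"
    "\<forall>\<^sub>F n in sequentially. \<exists>A\<in>sets M. emeasure M A \<le> ennreal \<delta> \<and> (\<forall>\<omega>\<in>space M - A. \<bar>X n \<omega>\<bar> \<le> C * a n)" by blast
  show "\<exists>C>0. \<forall>\<^sub>F n in sequentially. outer_measure_of M {\<omega> \<in> space M. \<bar>X n \<omega>\<bar> > C * a n} \<le> ennreal \<delta>"
  proof (intro exI[of _ C] conjI C(1), use C(2) in eventually_elim)
    fix n assume "\<exists>A\<in>sets M. emeasure M A \<le> ennreal \<delta> \<and> (\<forall>\<omega>\<in>space M - A. \<bar>X n \<omega>\<bar> \<le> C * a n)"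
    then obtain A where A: "A \<in> sets M" "emeasure M A \<le> ennreal \<delta>" "\<forall>\<omega>\<in>space M - A. \<bar>X n \<omega>\<bar> \<le> C * a n" by blast
    have "{\<omega> \<in> space M. \<bar>X n \<omega>\<bar> > C * a n} \<subseteq> A" using A(3) by force
    then have "outer_measure_of M {\<omega> \<in> space M. \<bar>X n \<omega>\<bar> > C * a n} \<le> outer_measure_of M A" by (rule outer_measure_of_mono)
    also have "\<dots> = emeasure M A" using A(1) by (rule outer_measure_of_eq)
    finally show "outer_measure_of M {\<omega> \<in> space M. \<bar>X n \<omega>\<bar> > C * a n} \<le> ennreal \<delta>" using A(2) by simp
  qed
qed

theorem corollary1:
  fixes M :: "'a measure"
    and m :: nat
    and f\<^sub>o \<rho> \<psi> :: "real \<Rightarrow> real"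
    and t :: "nat \<Rightarrow> nat \<Rightarrow> real"
    and \<epsilon> :: "nat \<Rightarrow> 'a \<Rightarrow> real"
    and Y :: "nat \<Rightarrow> nat \<Rightarrow> 'a \<Rightarrow> real"
    and lam :: "nat \<Rightarrow> real"
  assumes "prob_space M"
    and "m \<ge> 1"
    and "f\<^sub>o \<in> sobolev m 2"
    and "\<And>n i. i \<in> {1..n} \<Longrightarrow> t n i \<in> {0..1}"
    and eps_indep: "prob_space.indep_vars M (\<lambda>_. borel) \<epsilon> {1..}"
    and eps_ident: "\<And>i. i \<ge> 1 \<Longrightarrow> distr M borel (\<epsilon> i) = distr M borel (\<epsilon> 1)"
    and model: "\<And>n i \<omega>. i \<in> {1..n} \<Longrightarrow> \<omega> \<in> space M \<Longrightarrow> Y n i \<omega> = f\<^sub>o (t n i) + \<epsilon> i \<omega>"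
    and rho: "\<And>x. \<rho> x \<ge> 0" "\<rho> 0 = 0"
    and A1: "\<And>a b. absolutely_continuous_on {a..b} \<rho>" "convex_on UNIV \<rho>"
            "subgradient_selection \<rho> \<psi>"
    and A2: "\<exists>\<kappa>>0. \<exists>M\<^sub>1. \<forall>x y. \<bar>y\<bar> < \<kappa> \<longrightarrow> \<bar>\<psi> (x + y) - \<psi> x\<bar> \<le> M\<^sub>1"
    and A3: "\<exists>M\<^sub>2. \<forall>\<^sub>F h in at_right 0.
               (SUP s\<in>{-h..h}. \<integral>\<^sup>+\<omega>. ennreal (\<bar>\<psi> (\<epsilon> 1 \<omega> + s) - \<psi> (\<epsilon> 1 \<omega>)\<bar>\<^sup>2) \<partial>M)
                 \<le> ennreal (M\<^sub>2 * \<bar>h\<bar>)"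
    and A4: "\<exists>\<tau>. (\<integral>\<^sup>+\<omega>. ennreal (\<bar>\<psi> (\<epsilon> 1 \<omega>)\<bar>\<^sup>2) \<partial>M) \<le> ennreal (\<tau>\<^sup>2)"
            "(LINT \<omega>|M. \<psi> (\<epsilon> 1 \<omega>)) = 0"
            "\<exists>\<xi>>0. (\<lambda>s. (LINT \<omega>|M. \<psi> (\<epsilon> 1 \<omega> + s)) - \<xi> * s) \<in> o[at 0](\<lambda>s. s)"
    and A5: "\<exists>M\<^sub>3. \<forall>n\<ge>2. \<forall>f\<in>sobolev 1 1.
               \<bar>1 / real n * (\<Sum>i=1..n. f (t n i)) - (LINT x|lebesgue_on {0..1}. f x)\<bar>
                 \<le> M\<^sub>3 / real n * (LINT x|lebesgue_on {0..1}. \<bar>deriv01 1 f x\<bar>)"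
    and lam_pos: "\<And>n. n \<ge> 1 \<Longrightarrow> lam n > 0"
    and lam_rate: "lam \<in> \<Theta>(\<lambda>n. real n powr (- (2 * real m) / (2 * real m + 1)))"
  shows "\<exists>fhat :: nat \<Rightarrow> 'a \<Rightarrow> real \<Rightarrow> real.
     (\<forall>n\<ge>1. \<forall>\<omega>\<in>space M.
        m_smoothing_spline m \<rho> (lam n) n (t n) (\<lambda>i. Y n i \<omega>) (fhat n \<omega>)) \<and>
     bigO_prob M (\<lambda>n \<omega>. (sobolev_norm m (lam n) (\<lambda>x. fhat n \<omega> x - f\<^sub>o x))\<^sup>2)
       (\<lambda>n. lam n + inverse (real n * lam n powr (1 / (2 * real m)))) \<and>
     (\<forall>j\<in>{1..m}.
        bigO_prob M (\<lambda>n \<omega>. (l2_norm (\<lambda>x. deriv01 j (fhat n \<omega>) x - deriv01 j f\<^sub>o x))\<^sup>2)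
          (\<lambda>n. real n powr (- 2 * (real m - real j) / (2 * real m + 1))))"
proof -
  interpret prob_space M by (rule assms(1))
  note m = assms(2) and fo = assms(3) and t = assms(4) and sub = A1(3)
  have mono: "mono \<psi>" by (rule subgradient_selection_mono[OF sub])
  have psim[measurable]: "\<psi> \<in> borel_measurable borel" using mono by (rule borel_measurable_mono)
  have epsm[measurable]: "\<epsilon> 1 \<in> borel_measurable M" using eps_indep unfolding indep_vars_def by auto
  obtain \<kappa> M1 where \<kappa>: "0 < \<kappa>" and incr: "\<And>x y. \<bar>y\<bar> < \<kappa> \<Longrightarrow> \<bar>\<psi> (x + y) - \<psi> x\<bar> \<le> M1" using A2 by blast
  obtain \<tau> where "(\<integral>\<^sup>+\<omega>. ennreal (\<bar>\<psi> (\<epsilon> 1 \<omega>)\<bar>\<^sup>2) \<partial>M) \<le> ennreal (\<tau>\<^sup>2)" using A4(1) by blast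
  then have "(\<integral>\<^sup>+\<omega>. ennreal ((\<psi> (\<epsilon> 1 \<omega>))\<^sup>2) \<partial>M) < \<infinity>" by (simp add: le_less_trans)
  then have sq: "integrable M (\<lambda>\<omega>. (\<psi> (\<epsilon> 1 \<omega>))\<^sup>2)"
    by (intro integrableI_nonneg borel_measurable_power measurable_compose[OF epsm psim]) auto
  interpret score_errors M \<psi> \<epsilon> \<kappa> M1
    by unfold_locales (rule mono eps_indep sq A4(2) \<kappa> | erule eps_ident incr)+
  obtain \<xi> where \<xi>: "\<xi> > 0" "(\<lambda>s. (LINT \<omega>|M. \<psi> (\<epsilon> 1 \<omega> + s)) - \<xi> * s) \<in> o[at 0](\<lambda>s. s)" using A4(3) by blast
  have "\<forall>\<^sub>F s in at 0. norm ((LINT \<omega>|M. \<psi> (\<epsilon> 1 \<omega> + s)) - \<xi> * s) \<le> \<xi> / 2 * norm s"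
    using landau_o.smallD[OF \<xi>(2), of "\<xi> / 2"] \<xi>(1) by simp
  then obtain b4 where b4: "b4 > 0" "\<And>s. s \<noteq> 0 \<Longrightarrow> \<bar>s\<bar> < b4 \<Longrightarrow> \<bar>(LINT \<omega>|M. \<psi> (\<epsilon> 1 \<omega> + s)) - \<xi> * s\<bar> \<le> \<xi> / 2 * \<bar>s\<bar>"
    unfolding eventually_at by (auto simp: dist_real_def)
  obtain M2 where "\<forall>\<^sub>F h in at_right 0. (SUP s\<in>{-h..h}. \<integral>\<^sup>+\<omega>. ennreal (\<bar>\<psi> (\<epsilon> 1 \<omega> + s) - \<psi> (\<epsilon> 1 \<omega>)\<bar>\<^sup>2) \<partial>M) \<le> ennreal (M2 * \<bar>h\<bar>)"
    using A3 by blast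
  then obtain b3 where b3: "b3 > 0" and b3': "\<And>h. 0 < h \<Longrightarrow> h < b3 \<Longrightarrow>
      (SUP s\<in>{-h..h}. \<integral>\<^sup>+\<omega>. ennreal (\<bar>\<psi> (\<epsilon> 1 \<omega> + s) - \<psi> (\<epsilon> 1 \<omega>)\<bar>\<^sup>2) \<partial>M) \<le> ennreal (M2 * \<bar>h\<bar>)"
    unfolding eventually_at_right_field by auto
  \<comment> \<open>Below b the bounded increments, the second-moment modulus and the linear
    approximation of the mean are all available.\<close>
  define b where "b = min \<kappa> (min b3 b4)"
  have b: "0 < b" "b \<le> \<kappa>" "b \<le> b3" "b \<le> b4" using \<kappa> b3 b4(1) by (auto simp: b_def)
  \<comment> \<open>The shifted score is integrable as the score minus a bounded increment, so the
    expectation of the difference can be split.\<close>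
  have mu_eq: "mu s = - (LINT \<omega>|M. \<psi> (\<epsilon> 1 \<omega> + (- s)))" if "\<bar>s\<bar> < b" for s
  proof -
    have i: "integrable M (\<lambda>\<omega>. \<psi> (\<epsilon> 1 \<omega>) - \<psi> (\<epsilon> 1 \<omega> - s))" using increment_integrable[of 1 s 1] that b by simp
    have "integrable M (\<lambda>\<omega>. \<psi> (\<epsilon> 1 \<omega>) - (\<psi> (\<epsilon> 1 \<omega>) - \<psi> (\<epsilon> 1 \<omega> - s)))"
      by (rule Bochner_Integration.integrable_diff[OF psi_integrable i])
    then have i2: "integrable M (\<lambda>\<omega>. \<psi> (\<epsilon> 1 \<omega> - s))" by simp
    show ?thesis unfolding mu_def using psi_integrable i2 A4(2) by simp
  qed
  \<comment> \<open>Half of the slope \<xi> is given up to absorb the o(s) term of (A4).\<close>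
  have low1: "\<xi> / 2 * s \<le> mu s" if "0 \<le> s" "s < b" for s
  proof (cases "s = 0")
    case False
    then have "\<bar>(LINT \<omega>|M. \<psi> (\<epsilon> 1 \<omega> + (- s))) - \<xi> * (- s)\<bar> \<le> \<xi> / 2 * \<bar>- s\<bar>" using that b by (intro b4(2)) auto
    then have "\<xi> / 2 * s \<le> - (LINT \<omega>|M. \<psi> (\<epsilon> 1 \<omega> + (- s)))" using that
      by (simp only: abs_le_iff abs_minus_cancel abs_of_nonneg) linarith
    then show ?thesis using mu_eq[of s] that by simp
  qed (simp add: mu_def)
  have low2: "mu s \<le> \<xi> / 2 * s" if "- b < s" "s \<le> 0" for s
  proof (cases "s = 0")
    case False
    then have "\<bar>(LINT \<omega>|M. \<psi> (\<epsilon> 1 \<omega> + (- s))) - \<xi> * (- s)\<bar> \<le> \<xi> / 2 * \<bar>- s\<bar>" using that b by (intro b4(2)) auto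
    then have "- (LINT \<omega>|M. \<psi> (\<epsilon> 1 \<omega> + (- s))) \<le> \<xi> / 2 * s" using that
      by (simp only: abs_le_iff abs_minus_cancel abs_of_nonpos) linarith
    then show ?thesis using mu_eq[of s] that by simp
  qed (simp add: mu_def)
  \<comment> \<open>The sign of the constant in (A3) is unspecified; the absolute value and the
    added 1 make it positive.\<close>
  have M2pos: "0 < \<bar>M2\<bar> + 1" by simp
  have M2bound: "expectation (\<lambda>\<omega>. (\<psi> (\<epsilon> 1 \<omega> - s) - \<psi> (\<epsilon> 1 \<omega>))\<^sup>2) \<le> (\<bar>M2\<bar> + 1) * a"
    if a: "0 < a" "a < b" and s: "s \<in> {-a..a}" for a s
  proof -
    have "integrable M (\<lambda>\<omega>. (\<psi> (\<epsilon> 1 \<omega>) - \<psi> (\<epsilon> 1 \<omega> - s))\<^sup>2)" using s a b by (intro increment_integrable) auto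
    then have i: "integrable M (\<lambda>\<omega>. (\<psi> (\<epsilon> 1 \<omega> - s) - \<psi> (\<epsilon> 1 \<omega>))\<^sup>2)" by (simp add: power2_commute)
    have "ennreal (expectation (\<lambda>\<omega>. (\<psi> (\<epsilon> 1 \<omega> - s) - \<psi> (\<epsilon> 1 \<omega>))\<^sup>2)) = (\<integral>\<^sup>+\<omega>. ennreal (\<bar>\<psi> (\<epsilon> 1 \<omega> + (- s)) - \<psi> (\<epsilon> 1 \<omega>)\<bar>\<^sup>2) \<partial>M)"
      using nn_integral_eq_integral[OF i] by simp
    also have "\<dots> \<le> (SUP s\<in>{-a..a}. \<integral>\<^sup>+\<omega>. ennreal (\<bar>\<psi> (\<epsilon> 1 \<omega> + s) - \<psi> (\<epsilon> 1 \<omega>)\<bar>\<^sup>2) \<partial>M)"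
      using s by (intro SUP_upper) auto
    also have "\<dots> \<le> ennreal (M2 * \<bar>a\<bar>)" using a b by (intro b3') auto
    also have "\<dots> \<le> ennreal ((\<bar>M2\<bar> + 1) * a)" using a by (intro ennreal_leI) (auto intro!: mult_right_mono)
    finally show ?thesis using a by (subst (asm) ennreal_le_iff) auto
  qed
  obtain M3 where M3: "\<And>n f. n \<ge> 2 \<Longrightarrow> f \<in> sobolev 1 1 \<Longrightarrow> \<bar>1 / real n * (\<Sum>i=1..n. f (t n i)) - (LINT x|lebesgue_on {0..1}. f x)\<bar>
      \<le> M3 / real n * (LINT x|lebesgue_on {0..1}. \<bar>deriv01 1 f x\<bar>)" using A5 by blast
  have M3': "\<bar>1 / real n * (\<Sum>i=1..n. f (t n i)) - (LINT x|lebesgue_on {0..1}. f x)\<bar>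
      \<le> \<bar>M3\<bar> / real n * (LINT x|lebesgue_on {0..1}. \<bar>deriv01 1 f x\<bar>)" if "n \<ge> 2" "f \<in> sobolev 1 1" for n f
    using M3[OF that] by (rule order_trans) (auto intro!: mult_right_mono divide_right_mono)
  \<comment> \<open>The mean score is negative at the shift \<open>- (b / 2)\<close> and positive at
    \<open>b / 2\<close>. So \<psi> takes both signs, and two supporting lines give
    coercivity.\<close>
  have coercive: "\<exists>R. \<forall>x. \<rho> x \<le> B \<longrightarrow> \<bar>x\<bar> \<le> R" for B
  proof -
    have half: "\<bar>b / 2\<bar> < b" "\<bar>- (b / 2)\<bar> < b" using b by auto
    have "0 < \<xi> / 2 * (b / 2)" using \<xi> b by simp
    also have "\<dots> \<le> mu (b / 2)" using b by (intro low1) auto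
    finally have neg: "(LINT \<omega>|M. \<psi> (\<epsilon> 1 \<omega> + (- (b / 2)))) < 0" unfolding mu_eq[OF half(1)] by simp
    have "\<exists>q. \<psi> q < 0"
    proof (rule ccontr)
      assume "\<not> (\<exists>q. \<psi> q < 0)"
      then have "0 \<le> (LINT \<omega>|M. \<psi> (\<epsilon> 1 \<omega> + (- (b / 2))))" by (intro integral_nonneg_AE AE_I2) (auto simp: not_less)
      then show False using neg by simp
    qed
    have "mu (- (b / 2)) \<le> \<xi> / 2 * (- (b / 2))" using b by (intro low2) auto
    also have "\<dots> < 0" using \<xi> b by simp
    finally have pos: "0 < (LINT \<omega>|M. \<psi> (\<epsilon> 1 \<omega> + (- (- (b / 2)))))" unfolding mu_eq[OF half(2)] by simp
    have "\<exists>p. 0 < \<psi> p"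
    proof (rule ccontr)
      assume "\<not> (\<exists>p. 0 < \<psi> p)"
      then have "0 \<le> (LINT \<omega>|M. - \<psi> (\<epsilon> 1 \<omega> + (- (- (b / 2)))))" by (intro integral_nonneg_AE AE_I2) (auto simp: not_less)
      then show False using pos by simp
    qed
    then show ?thesis using \<open>\<exists>q. \<psi> q < 0\<close> subgradient_coercive[OF sub] by blast
  qed
  have cont: "continuous_on UNIV \<rho>" using A1(2) by (intro convex_on_continuous) auto
  \<comment> \<open>Minimizers are selected outcome by outcome, with no claim of measurability in
    \<omega>.\<close>
  have "\<exists>f. m_smoothing_spline m \<rho> (lam n) n (t n) (\<lambda>i. Y n i \<omega>) f" if "n \<ge> 1" for n \<omega>
    by (rule m_smoothing_spline_exists[OF m that lam_pos[OF that] t rho(1) A1(2) cont coercive])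
  then obtain fhat where fhat: "\<And>n \<omega>. n \<ge> 1 \<Longrightarrow> m_smoothing_spline m \<rho> (lam n) n (t n) (\<lambda>i. Y n i \<omega>) (fhat n \<omega>)" by metis
  define F where "F = (\<lambda>k. deriv01 k f\<^sub>o)"
  have F: "sob_chain m F" unfolding F_def by (rule sobolev_chain[OF fo m])
  define hh where "hh = (\<lambda>n. real n powr (- (1 / (2 * real m + 1))))"
  have hhm: "(hh n ^ m)\<^sup>2 = real n powr (- (2 * real m) / (2 * real m + 1))" if "n \<ge> 1" for n
  proof -
    have "(hh n ^ m)\<^sup>2 = hh n ^ (2 * m)" by (simp add: power_mult[symmetric] mult.commute)
    also have "\<dots> = real n powr (- (1 / (2 * real m + 1)) * real (2 * m))"
      unfolding hh_def using that by (subst powr_power) auto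
    finally show ?thesis by simp
  qed
  from lam_rate obtain c1 c2 where c: "c1 > 0" "c2 > 0"
    and lamev: "\<forall>\<^sub>F n in sequentially. norm (lam n) \<le> c2 * norm (real n powr (- (2 * real m) / (2 * real m + 1)))"
      "\<forall>\<^sub>F n in sequentially. norm (lam n) \<ge> c1 * norm (real n powr (- (2 * real m) / (2 * real m + 1)))"
    unfolding bigtheta_def by (elim IntE landau_o.bigE landau_omega.bigE) (rule that)
  have lam: "\<forall>\<^sub>F n in sequentially. c1 * (hh n ^ m)\<^sup>2 \<le> lam n \<and> lam n \<le> c2 * (hh n ^ m)\<^sup>2"
    using lamev eventually_ge_at_top[of 1]
  proof eventually_elim
    case (elim n)
    then show ?case using lam_pos[of n] by (simp add: hhm)
  qed
  \<comment> \<open>The difference of the derivative chains, not the chain of the difference: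
    \<open>deriv01 m\<close> need not be additive at points where a derivative fails to
    exist.\<close>
  define Dc where "Dc = (\<lambda>n \<omega> k x. deriv01 k (fhat n \<omega>) x - F k x)"
  have key: "\<exists>D>0. \<forall>\<^sub>F n in sequentially. \<exists>A\<in>sets M. emeasure M A \<le> ennreal \<delta> \<and>
      (\<forall>\<omega>\<in>space M - A. sob_chain m (Dc n \<omega>) \<and> (l2_norm (Dc n \<omega> 0))\<^sup>2 + lam n * (l2_norm (Dc n \<omega> m))\<^sup>2 \<le> (D * hh n ^ m)\<^sup>2)"
    if "\<delta> > 0" for \<delta>
  proof -
    obtain D where D: "D > 0" and ev: "\<forall>\<^sub>F n in sequentially. \<exists>A\<in>sets M. emeasure M A \<le> ennreal \<delta> \<and>
    (\<forall>\<omega>\<in>space M - A. \<forall>y Fh. (\<forall>i\<in>{1..n}. y i = F 0 (t n i) + \<epsilon> i \<omega>) \<longrightarrow> sob_chain m Fh \<longrightarrow>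
      chain_objective m \<rho> (lam n) n (t n) y Fh \<le> chain_objective m \<rho> (lam n) n (t n) y F \<longrightarrow>
      (l2_norm (\<lambda>x. Fh 0 x - F 0 x))\<^sup>2 + lam n * (l2_norm (\<lambda>x. Fh m x - F m x))\<^sup>2 \<le> (D * hh n ^ m)\<^sup>2)"
      by (rule eventually_minimizers_close[OF sub A1(2) F m t b(1,2) M2pos M2bound low1 low2 \<xi>(1) M3' abs_ge_zero lam c fun_cong[OF hh_def] \<open>\<delta> > 0\<close>, THEN exE];
          (assumption | (erule conjE, erule (1) that)))
    show ?thesis
    proof (intro exI[of _ D] conjI D, use ev eventually_ge_at_top[of 1] in eventually_elim)
      case (elim n)
      then obtain A where A: "A \<in> sets M" "emeasure M A \<le> ennreal \<delta>"
        and close: "\<And>\<omega> y Fh. \<omega> \<in> space M - A \<Longrightarrow> (\<forall>i\<in>{1..n}. y i = F 0 (t n i) + \<epsilon> i \<omega>) \<Longrightarrow> sob_chain m Fh \<Longrightarrow>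
          chain_objective m \<rho> (lam n) n (t n) y Fh \<le> chain_objective m \<rho> (lam n) n (t n) y F \<Longrightarrow>
          (l2_norm (\<lambda>x. Fh 0 x - F 0 x))\<^sup>2 + lam n * (l2_norm (\<lambda>x. Fh m x - F m x))\<^sup>2 \<le> (D * hh n ^ m)\<^sup>2" by blast
      have "sob_chain m (Dc n \<omega>) \<and> (l2_norm (Dc n \<omega> 0))\<^sup>2 + lam n * (l2_norm (Dc n \<omega> m))\<^sup>2 \<le> (D * hh n ^ m)\<^sup>2"
        if \<omega>: "\<omega> \<in> space M - A" for \<omega>
      proof
        have spl: "fhat n \<omega> \<in> sobolev m 2"
          "m_objective m \<rho> (lam n) n (t n) (\<lambda>i. Y n i \<omega>) (fhat n \<omega>) \<le> m_objective m \<rho> (lam n) n (t n) (\<lambda>i. Y n i \<omega>) f\<^sub>o"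
          using fhat[OF elim(2), of \<omega>] fo unfolding m_smoothing_spline_def is_arg_min_linorder by auto
        have Fh: "sob_chain m (\<lambda>k. deriv01 k (fhat n \<omega>))" by (rule sobolev_chain[OF spl(1) m])
        show "sob_chain m (Dc n \<omega>)" using sob_chain_lin[OF Fh F, of 1 "-1"] by (simp add: Dc_def)
        show "(l2_norm (Dc n \<omega> 0))\<^sup>2 + lam n * (l2_norm (Dc n \<omega> m))\<^sup>2 \<le> (D * hh n ^ m)\<^sup>2"
          unfolding Dc_def
        proof (rule close[OF \<omega> _ Fh])
          show "\<forall>i\<in>{1..n}. Y n i \<omega> = F 0 (t n i) + \<epsilon> i \<omega>" using model \<omega> by (auto simp: F_def deriv01_0)
        qed (use spl(2) in \<open>simp add: m_objective_eq_chain F_def\<close>)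
      qed
      then show ?case using A by blast
    qed
  qed
  have rate1: "bigO_prob M (\<lambda>n \<omega>. (sobolev_norm m (lam n) (\<lambda>x. fhat n \<omega> x - f\<^sub>o x))\<^sup>2)
       (\<lambda>n. lam n + inverse (real n * lam n powr (1 / (2 * real m))))"
  proof (rule bigO_prob_if_bounded_off_small_sets)
    fix \<delta> :: real assume "\<delta> > 0"
    from key[OF this] obtain D where D: "D > 0" and ev: "\<forall>\<^sub>F n in sequentially. \<exists>A\<in>sets M. emeasure M A \<le> ennreal \<delta> \<and>
      (\<forall>\<omega>\<in>space M - A. sob_chain m (Dc n \<omega>) \<and> (l2_norm (Dc n \<omega> 0))\<^sup>2 + lam n * (l2_norm (Dc n \<omega> m))\<^sup>2 \<le> (D * hh n ^ m)\<^sup>2)" by blast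
    show "\<exists>C>0. \<forall>\<^sub>F n in sequentially. \<exists>A\<in>sets M. emeasure M A \<le> ennreal \<delta> \<and>
      (\<forall>\<omega>\<in>space M - A. \<bar>(sobolev_norm m (lam n) (\<lambda>x. fhat n \<omega> x - f\<^sub>o x))\<^sup>2\<bar> \<le> C * (lam n + inverse (real n * lam n powr (1 / (2 * real m)))))"
    \<comment> \<open>The inequality \<open>(hh n ^ m)\<^sup>2 \<le> lam n / c1\<close> converts the
      rate in h into the summand \<open>lam n\<close>; the other summand is nonnegative.\<close>
    proof (intro exI[of _ "D\<^sup>2 / c1"] conjI, use D c in simp, use ev lam eventually_ge_at_top[of 1] in eventually_elim)
      case (elim n)
      then obtain A where A: "A \<in> sets M" "emeasure M A \<le> ennreal \<delta>"
        "\<And>\<omega>. \<omega> \<in> space M - A \<Longrightarrow>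
          sob_chain m (Dc n \<omega>) \<and> (l2_norm (Dc n \<omega> 0))\<^sup>2 + lam n * (l2_norm (Dc n \<omega> m))\<^sup>2 \<le> (D * hh n ^ m)\<^sup>2" by blast
      have lp: "0 < lam n" using lam_pos elim(3) by simp
      have "\<bar>(sobolev_norm m (lam n) (\<lambda>x. fhat n \<omega> x - f\<^sub>o x))\<^sup>2\<bar>
        \<le> D\<^sup>2 / c1 * (lam n + inverse (real n * lam n powr (1 / (2 * real m))))"
        if \<omega>: "\<omega> \<in> space M - A" for \<omega>
      proof -
        note Aw = A(3)[OF \<omega>]
        have u: "(\<lambda>x. fhat n \<omega> x - f\<^sub>o x) = Dc n \<omega> 0" by (simp add: Dc_def F_def deriv01_0)
        \<comment> \<open>The m-th derivative of the difference and the difference of the m-th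
          derivatives agree off a null set.\<close>
        have "l2_norm (deriv01 m (Dc n \<omega> 0)) = l2_norm (Dc n \<omega> m)"
          using Aw chain_sobolev(2)[of m "Dc n \<omega>", OF _ m] sob_chain_sq_int[of m "Dc n \<omega>" m]
            by (intro l2_norm_cong_negligible(2)) auto
        moreover have "l2_inner v v = (l2_norm v)\<^sup>2" for v unfolding l2_norm_power2 l2_inner_def by (simp add: power2_eq_square)
        ultimately have "(sobolev_norm m (lam n) (Dc n \<omega> 0))\<^sup>2 = (l2_norm (Dc n \<omega> 0))\<^sup>2 + lam n * (l2_norm (Dc n \<omega> m))\<^sup>2"
          unfolding sobolev_norm_def sobolev_inner_def using lp by simp
        also have "\<dots> \<le> D\<^sup>2 * (hh n ^ m)\<^sup>2" using Aw by (simp add: power_mult_distrib)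
        also have "\<dots> \<le> D\<^sup>2 * (lam n / c1)"
          using elim(2) c by (intro mult_left_mono) (auto simp: pos_le_divide_eq mult.commute)
        also have "\<dots> = D\<^sup>2 / c1 * lam n" by simp
        also have "\<dots> \<le> D\<^sup>2 / c1 * (lam n + inverse (real n * lam n powr (1 / (2 * real m))))"
          using c by (intro mult_left_mono) auto
        finally show ?thesis unfolding u by simp
      qed
      then show ?case using A(1,2) by blast
    qed
  qed
  have rate2: "bigO_prob M (\<lambda>n \<omega>. (l2_norm (\<lambda>x. deriv01 j (fhat n \<omega>) x - deriv01 j f\<^sub>o x))\<^sup>2)
          (\<lambda>n. real n powr (- 2 * (real m - real j) / (2 * real m + 1)))" if j: "j \<in> {1..m}" for j
  proof (rule bigO_prob_if_bounded_off_small_sets)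
    fix \<delta> :: real assume "\<delta> > 0"
    from key[OF this] obtain D where D: "D > 0" and ev: "\<forall>\<^sub>F n in sequentially. \<exists>A\<in>sets M. emeasure M A \<le> ennreal \<delta> \<and>
      (\<forall>\<omega>\<in>space M - A. sob_chain m (Dc n \<omega>) \<and> (l2_norm (Dc n \<omega> 0))\<^sup>2 + lam n * (l2_norm (Dc n \<omega> m))\<^sup>2 \<le> (D * hh n ^ m)\<^sup>2)" by blast
    obtain Ci where Ci: "Ci > 0" "\<And>G h j. sob_chain m G \<Longrightarrow> 0 < h \<Longrightarrow> h \<le> 1/2 \<Longrightarrow> j \<le> m \<Longrightarrow>
       h ^ j * l2_norm (G j) \<le> Ci * (l2_norm (G 0) + h ^ m * l2_norm (G m))"
      using interpolation_general[of m] by metis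
    define C1 where "C1 = Ci * (1 + 1 / sqrt c1)"
    have C1: "0 < C1" using Ci c by (simp add: C1_def add_pos_pos)
    have "hh \<longlonglongrightarrow> 0" unfolding hh_def by (rule powr_neg_tendsto_0) simp
    then have evh: "\<forall>\<^sub>F n in sequentially. hh n < 1/2" by (rule order_tendstoD(2)) simp
    show "\<exists>C>0. \<forall>\<^sub>F n in sequentially. \<exists>A\<in>sets M. emeasure M A \<le> ennreal \<delta> \<and>
      (\<forall>\<omega>\<in>space M - A. \<bar>(l2_norm (\<lambda>x. deriv01 j (fhat n \<omega>) x - deriv01 j f\<^sub>o x))\<^sup>2\<bar> \<le> C * real n powr (- 2 * (real m - real j) / (2 * real m + 1)))"
    \<comment> \<open>Dividing \<open>H = h ^ m\<close> by \<open>h ^ j\<close> leaves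
      \<open>h ^ (m - j)\<close>, whose square is the claimed power of n; for j = m it is
      constant.\<close>
    proof (intro exI[of _ "(C1 * D)\<^sup>2"] conjI, use C1 D in simp, use ev lam evh eventually_ge_at_top[of 1] in eventually_elim)
      case (elim n)
      then obtain A where A: "A \<in> sets M" "emeasure M A \<le> ennreal \<delta>"
        "\<And>\<omega>. \<omega> \<in> space M - A \<Longrightarrow>
          sob_chain m (Dc n \<omega>) \<and> (l2_norm (Dc n \<omega> 0))\<^sup>2 + lam n * (l2_norm (Dc n \<omega> m))\<^sup>2 \<le> (D * hh n ^ m)\<^sup>2" by blast
      define h where "h = hh n"
      define H where "H = h ^ m"
      have h: "0 < h" "h \<le> 1/2" using elim(3,4) by (auto simp: h_def hh_def)
      have Hpos: "0 < H" using h by (simp add: H_def)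
      have lp: "0 < lam n" using lam_pos elim(4) by simp
      have hp: "(h ^ (m - j))\<^sup>2 = real n powr (- 2 * (real m - real j) / (2 * real m + 1))"
      proof -
        have "(h ^ (m - j))\<^sup>2 = h ^ (2 * (m - j))" by (simp add: power_mult[symmetric] mult.commute)
        also have "\<dots> = real n powr (- (1 / (2 * real m + 1)) * real (2 * (m - j)))"
          unfolding h_def hh_def using elim(4) by (subst powr_power) auto
        also have "- (1 / (2 * real m + 1)) * real (2 * (m - j)) = - 2 * (real m - real j) / (2 * real m + 1)"
        proof -
          have "- (1 / d) * (2 * q) = - 2 * q / d" for d q :: real by simp
          moreover have "real (2 * (m - j)) = 2 * (real m - real j)" using j by (simp add: of_nat_diff)
          ultimately show ?thesis by (simp only:)
        qed
        finally show ?thesis .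
      qed
      have "\<bar>(l2_norm (\<lambda>x. deriv01 j (fhat n \<omega>) x - deriv01 j f\<^sub>o x))\<^sup>2\<bar>
        \<le> (C1 * D)\<^sup>2 * real n powr (- 2 * (real m - real j) / (2 * real m + 1))"
        if \<omega>: "\<omega> \<in> space M - A" for \<omega>
      proof -
        note Aw = A(3)[OF \<omega>, folded h_def, folded H_def]
        let ?g0 = "l2_norm (Dc n \<omega> 0)" and ?gm = "l2_norm (Dc n \<omega> m)"
        have lgm: "0 \<le> lam n * ?gm\<^sup>2" using lp by simp
        have "?g0\<^sup>2 \<le> (D * H)\<^sup>2" using Aw lgm by linarith
        then have g0: "?g0 \<le> D * H" by (rule power2_le_imp_le) (use D Hpos in auto)
        have "c1 * H\<^sup>2 * ?gm\<^sup>2 \<le> lam n * ?gm\<^sup>2" using elim(2) by (intro mult_right_mono) (auto simp: H_def h_def)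
        also have "\<dots> \<le> (D * H)\<^sup>2" using Aw zero_le_power2[of ?g0] by linarith
        finally have "(sqrt c1 * (H * ?gm))\<^sup>2 \<le> (D * H)\<^sup>2" using c by (simp add: power_mult_distrib mult.assoc)
        then have "sqrt c1 * (H * ?gm) \<le> D * H" by (rule power2_le_imp_le) (use D Hpos in auto)
        then have gm: "H * ?gm \<le> D * H / sqrt c1" using c by (simp add: field_simps)
        have "h ^ j * l2_norm (Dc n \<omega> j) \<le> Ci * (?g0 + H * ?gm)"
          unfolding H_def using Aw h j by (intro Ci(2)) auto
        also have "\<dots> \<le> Ci * (D * H + D * H / sqrt c1)" using g0 gm Ci(1) by (intro mult_left_mono add_mono) auto
        also have "\<dots> = h ^ j * (C1 * D * h ^ (m - j))"
          using j by (simp add: C1_def H_def algebra_simps power_add[symmetric])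
        finally have "l2_norm (Dc n \<omega> j) \<le> C1 * D * h ^ (m - j)" using h by simp
        then have "(l2_norm (Dc n \<omega> j))\<^sup>2 \<le> (C1 * D * h ^ (m - j))\<^sup>2" by (intro power_mono) auto
        also have "\<dots> = (C1 * D)\<^sup>2 * (h ^ (m - j))\<^sup>2" by (simp add: power_mult_distrib)
        finally show ?thesis unfolding hp by (simp add: Dc_def F_def)
      qed
      then show ?case using A(1,2) by blast
    qed
  qed
  show ?thesis
    by (intro exI[of _ fhat] conjI allI impI ballI rate1 rate2 fhat)
qed

end
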